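(* Let $G=SL_2(\mathbb{Q})$, let $H$ denote the subgroup of upper-triangular matrices in $SL_2(\mathbb{Q})$, and let $\Lambda$ be an amenable ICC group. The following are inclusions of factors with the property that the smaller factor is an amenable maximal von Neumann subalgebra of the larger one: (1) $L(\Lambda\wr_G H)<L(\Lambda\wr G)$; (2) $L(\mathbb{Z}\wr_G H)<L(\mathbb{Z}\wr G)$.
   Context: All groups are discrete and countable; ICC means infinite conjugacy classes; $L(\Gamma)$ is the group von Neumann algebra. For a group $A$, $A^{\oplus G}$ is the direct sum of copies of $A$ indexed by $G$ with the shift action of $G$; $A\wr G=A^{\oplus G}\rtimes G$ and, for a subgroup $H<G$, $A\wr_G H=A^{\oplus G}\rtimes H$. A von Neumann subalgebra $\mathsf{N}$ of a von Neumann algebra $\mathsf{M}$ is maximal if for any von Neumann subalgebra $\mathsf{P}$ of $\mathsf{M}$ with $\mathsf{N}\subseteq\mathsf{P}$, either $\mathsf{P}=\mathsf{N}$ or $\mathsf{P}=\mathsf{M}$. Inclusions are unital. *)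

theory Defs
  imports
    "HOL-Analysis.Analysis"
    "HOL-Algebra.Product_Groups"
    "HOL-Algebra.Elementary_Groups"
begin

section \<open>Groups\<close>

definition special_linear :: "('r::comm_ring_1 ^ 'n ^ 'n) monoid" where
  "special_linear = \<lparr>carrier = {A. det A = 1}, monoid.mult = (**), one = mat 1\<rparr>"

abbreviation SL2Q :: "(rat ^ 2 ^ 2) monoid" where
  "SL2Q \<equiv> special_linear"

definition upper_triangular_SL2Q :: "(rat ^ 2 ^ 2) set" where
  "upper_triangular_SL2Q = {A \<in> carrier SL2Q. A $ 2 $ 1 = 0}"

definition conjugacy_class :: "('g, 'm) monoid_scheme \<Rightarrow> 'g \<Rightarrow> 'g set" where
  "conjugacy_class G g = {h \<otimes>\<^bsub>G\<^esub> g \<otimes>\<^bsub>G\<^esub> inv\<^bsub>G\<^esub> h | h. h \<in> carrier G}"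

text \<open>An ICC group is infinite by convention; without the first conjunct the trivial group
  would qualify vacuously.\<close>

definition ICC :: "('g, 'm) monoid_scheme \<Rightarrow> bool" where
  "ICC G \<longleftrightarrow> infinite (carrier G) \<and>
     (\<forall>g\<in>carrier G. g \<noteq> \<one>\<^bsub>G\<^esub> \<longrightarrow> infinite (conjugacy_class G g))"

text \<open>Amenability of a discrete group: a left-invariant mean on the real bounded functions.
  Functions are only required to be bounded on the carrier; by positivity and linearity the
  mean depends only on their values there.\<close>

definition bounded_functions :: "('g, 'm) monoid_scheme \<Rightarrow> ('g \<Rightarrow> real) set" where
  "bounded_functions G = {f. bounded (f ` carrier G)}"

definition invariant_mean :: "('g, 'm) monoid_scheme \<Rightarrow> (('g \<Rightarrow> real) \<Rightarrow> real) \<Rightarrow> bool" where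
  "invariant_mean G m \<longleftrightarrow>
     (\<forall>f\<in>bounded_functions G. \<forall>f'\<in>bounded_functions G. m (\<lambda>x. f x + f' x) = m f + m f') \<and>
     (\<forall>c. \<forall>f\<in>bounded_functions G. m (\<lambda>x. c * f x) = c * m f) \<and>
     (\<forall>f\<in>bounded_functions G. (\<forall>x\<in>carrier G. 0 \<le> f x) \<longrightarrow> 0 \<le> m f) \<and>
     m (\<lambda>x. 1) = 1 \<and>
     (\<forall>g\<in>carrier G. \<forall>f\<in>bounded_functions G. m (\<lambda>x. f (g \<otimes>\<^bsub>G\<^esub> x)) = m f)"

definition amenable_group :: "('g, 'm) monoid_scheme \<Rightarrow> bool" where
  "amenable_group G \<longleftrightarrow> group G \<and> (\<exists>m. invariant_mean G m)"


subsection \<open>Wreath products\<close>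

definition shift :: "('g, 'm) monoid_scheme \<Rightarrow> 'g \<Rightarrow> ('g \<Rightarrow> 'a) \<Rightarrow> ('g \<Rightarrow> 'a)" where
  "shift G g a = (\<lambda>x\<in>carrier G. a (inv\<^bsub>G\<^esub> g \<otimes>\<^bsub>G\<^esub> x))"

text \<open>\<open>wreath_over A G H\<close> is the semidirect product of the direct sum of copies of \<open>A\<close> indexed
  by all of \<open>G\<close> with the subgroup \<open>H\<close> of \<open>G\<close> acting by the shift.\<close>

definition wreath_over ::
  "('a, 'l) monoid_scheme \<Rightarrow> ('g, 'm) monoid_scheme \<Rightarrow> 'g set \<Rightarrow> (('g \<Rightarrow> 'a) \<times> 'g) monoid" where
  "wreath_over A G H =
    \<lparr>carrier = carrier (sum_group (carrier G) (\<lambda>_. A)) \<times> H,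
     monoid.mult = (\<lambda>(a, g) (b, h).
       (a \<otimes>\<^bsub>sum_group (carrier G) (\<lambda>_. A)\<^esub> shift G g b, g \<otimes>\<^bsub>G\<^esub> h)),
     one = (\<one>\<^bsub>sum_group (carrier G) (\<lambda>_. A)\<^esub>, \<one>\<^bsub>G\<^esub>)\<rparr>"

definition wreath ::
  "('a, 'l) monoid_scheme \<Rightarrow> ('g, 'm) monoid_scheme \<Rightarrow> (('g \<Rightarrow> 'a) \<times> 'g) monoid" where
  "wreath A G = wreath_over A G (carrier G)"


section \<open>Bounded operators on the complex Hilbert space of square-summable functions\<close>

text \<open>Vectors are functions vanishing outside the index set \<open>X\<close>; operators are extensional
  functions on this space, so that equality of operators is equality in HOL.\<close>

definition ell2 :: "'x set \<Rightarrow> ('x \<Rightarrow> complex) set" where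
  "ell2 X = {f. (\<forall>x. x \<notin> X \<longrightarrow> f x = 0) \<and> (\<lambda>x. (cmod (f x))\<^sup>2) summable_on X}"

definition ell2_inner :: "'x set \<Rightarrow> ('x \<Rightarrow> complex) \<Rightarrow> ('x \<Rightarrow> complex) \<Rightarrow> complex" where
  "ell2_inner X f g = (\<Sum>\<^sub>\<infinity>x\<in>X. cnj (f x) * g x)"

definition ell2_norm :: "'x set \<Rightarrow> ('x \<Rightarrow> complex) \<Rightarrow> real" where
  "ell2_norm X f = sqrt (\<Sum>\<^sub>\<infinity>x\<in>X. (cmod (f x))\<^sup>2)"

type_synonym 'x operator = "('x \<Rightarrow> complex) \<Rightarrow> ('x \<Rightarrow> complex)"

definition bounded_operators :: "'x set \<Rightarrow> 'x operator set" where
  "bounded_operators X = {T \<in> ell2 X \<rightarrow>\<^sub>E ell2 X.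
     (\<forall>f\<in>ell2 X. \<forall>g\<in>ell2 X. T (\<lambda>x. f x + g x) = (\<lambda>x. T f x + T g x)) \<and>
     (\<forall>c. \<forall>f\<in>ell2 X. T (\<lambda>x. c * f x) = (\<lambda>x. c * T f x)) \<and>
     (\<exists>C. \<forall>f\<in>ell2 X. ell2_norm X (T f) \<le> C * ell2_norm X f)}"

definition op_add :: "'x set \<Rightarrow> 'x operator \<Rightarrow> 'x operator \<Rightarrow> 'x operator" where
  "op_add X S T = (\<lambda>f\<in>ell2 X. \<lambda>x. S f x + T f x)"

definition op_scale :: "'x set \<Rightarrow> complex \<Rightarrow> 'x operator \<Rightarrow> 'x operator" where
  "op_scale X c T = (\<lambda>f\<in>ell2 X. \<lambda>x. c * T f x)"

abbreviation op_comp :: "'x set \<Rightarrow> 'x operator \<Rightarrow> 'x operator \<Rightarrow> 'x operator" where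
  "op_comp X S T \<equiv> compose (ell2 X) S T"

definition op_id :: "'x set \<Rightarrow> 'x operator" where
  "op_id X = (\<lambda>f\<in>ell2 X. f)"

definition is_adjoint :: "'x set \<Rightarrow> 'x operator \<Rightarrow> 'x operator \<Rightarrow> bool" where
  "is_adjoint X T S \<longleftrightarrow>
     (\<forall>f\<in>ell2 X. \<forall>g\<in>ell2 X. ell2_inner X (S f) g = ell2_inner X f (T g))"

definition positive_operator :: "'x set \<Rightarrow> 'x operator \<Rightarrow> bool" where
  "positive_operator X T \<longleftrightarrow> T \<in> bounded_operators X \<and>
     (\<forall>f\<in>ell2 X. ell2_inner X f (T f) \<in> \<real>\<^sub>\<ge>\<^sub>0)"


section \<open>Von Neumann algebras\<close>

definition commutant :: "'x set \<Rightarrow> 'x operator set \<Rightarrow> 'x operator set" where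
  "commutant X M = {T \<in> bounded_operators X. \<forall>S\<in>M. op_comp X S T = op_comp X T S}"

text \<open>A self-adjoint set of bounded operators that equals its bicommutant; being a commutant, it
  is automatically a unital, weakly closed subalgebra, so inclusions of von Neumann
  algebras on the same space are unital.\<close>

definition von_neumann_algebra :: "'x set \<Rightarrow> 'x operator set \<Rightarrow> bool" where
  "von_neumann_algebra X M \<longleftrightarrow> M \<subseteq> bounded_operators X \<and>
     (\<forall>T\<in>M. \<exists>S\<in>M. is_adjoint X T S) \<and>
     commutant X (commutant X M) = M"

definition factor :: "'x set \<Rightarrow> 'x operator set \<Rightarrow> bool" where
  "factor X M \<longleftrightarrow> von_neumann_algebra X M \<and>
     M \<inter> commutant X M = range (\<lambda>c. op_scale X c (op_id X))"

definition maximal_vN_subalgebra ::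
  "'x set \<Rightarrow> 'x operator set \<Rightarrow> 'x operator set \<Rightarrow> bool" where
  "maximal_vN_subalgebra X N M \<longleftrightarrow>
     von_neumann_algebra X N \<and> von_neumann_algebra X M \<and> N \<subseteq> M \<and>
     (\<forall>P. von_neumann_algebra X P \<and> N \<subseteq> P \<and> P \<subseteq> M \<longrightarrow> P = N \<or> P = M)"

text \<open>Conditional expectations from all bounded operators onto \<open>N\<close>; normality is not required.\<close>

definition conditional_expectation ::
  "'x set \<Rightarrow> 'x operator set \<Rightarrow> ('x operator \<Rightarrow> 'x operator) \<Rightarrow> bool" where
  "conditional_expectation X N E \<longleftrightarrow>
     (\<forall>T\<in>bounded_operators X. E T \<in> N) \<and>
     (\<forall>T\<in>N. E T = T) \<and>
     (\<forall>S\<in>bounded_operators X. \<forall>T\<in>bounded_operators X.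
        E (op_add X S T) = op_add X (E S) (E T)) \<and>
     (\<forall>c. \<forall>T\<in>bounded_operators X. E (op_scale X c T) = op_scale X c (E T)) \<and>
     (\<forall>T. positive_operator X T \<longrightarrow> positive_operator X (E T)) \<and>
     (\<forall>A\<in>N. \<forall>B\<in>N. \<forall>T\<in>bounded_operators X.
        E (op_comp X A (op_comp X T B)) = op_comp X A (op_comp X (E T) B))"

text \<open>Amenability (injectivity) of a von Neumann algebra; it does not depend on the
  space on which the algebra is faithfully and normally represented.\<close>

definition amenable_vN_algebra :: "'x set \<Rightarrow> 'x operator set \<Rightarrow> bool" where
  "amenable_vN_algebra X N \<longleftrightarrow>
     von_neumann_algebra X N \<and> (\<exists>E. conditional_expectation X N E)"


section \<open>Group von Neumann algebras\<close>

definition left_regular :: "('g, 'm) monoid_scheme \<Rightarrow> 'g \<Rightarrow> 'g operator" where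
  "left_regular G g = (\<lambda>f\<in>ell2 (carrier G).
     \<lambda>x. if x \<in> carrier G then f (inv\<^bsub>G\<^esub> g \<otimes>\<^bsub>G\<^esub> x) else 0)"

text \<open>For a subgroup \<open>K\<close> of \<open>G\<close>, the algebra \<open>L(K)\<close> is regarded as usual as the von Neumann
  subalgebra of \<open>L(G)\<close> generated by the unitaries indexed by \<open>K\<close>.\<close>

definition subgroup_vN :: "('g, 'm) monoid_scheme \<Rightarrow> 'g set \<Rightarrow> 'g operator set" where
  "subgroup_vN G K =
     commutant (carrier G) (commutant (carrier G) (left_regular G ` K))"

definition group_vN :: "('g, 'm) monoid_scheme \<Rightarrow> 'g operator set" where
  "group_vN G = subgroup_vN G (carrier G)"


section \<open>The groups involved are groups\<close>

lemma group_special_linear: "group (special_linear :: ('r::field ^ 'n ^ 'n) monoid)"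
proof (rule groupI)
  fix A assume "A \<in> carrier (special_linear :: ('r ^ 'n ^ 'n) monoid)"
  then have d: "det A = 1" by (simp add: special_linear_def)
  then obtain B where B: "B ** A = mat 1"
    by (metis invertible_det_nz invertible_def zero_neq_one)
  have "det B = 1" using arg_cong[OF B, of det] d by (simp add: det_mul)
  with B show "\<exists>B\<in>carrier special_linear. B \<otimes>\<^bsub>special_linear\<^esub> A = \<one>\<^bsub>special_linear\<^esub>"
    by (auto simp: special_linear_def)
qed (auto simp: special_linear_def det_mul matrix_mul_assoc)

lemma subgroup_upper_triangular: "subgroup upper_triangular_SL2Q SL2Q"
proof -
  interpret group SL2Q by (rule group_special_linear)
  show ?thesis
  proof (rule subgroupI)
    show "upper_triangular_SL2Q \<subseteq> carrier SL2Q" by (auto simp: upper_triangular_SL2Q_def)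
    have "mat 1 \<in> upper_triangular_SL2Q"
      by (simp add: upper_triangular_SL2Q_def special_linear_def) (simp add: mat_def)
    then show "upper_triangular_SL2Q \<noteq> {}" by blast
  next
    fix A B assume "A \<in> upper_triangular_SL2Q" "B \<in> upper_triangular_SL2Q"
    then show "A \<otimes>\<^bsub>SL2Q\<^esub> B \<in> upper_triangular_SL2Q"
      by (simp add: upper_triangular_SL2Q_def special_linear_def det_mul)
         (simp add: matrix_matrix_mult_def sum_2)
  next
    fix A assume A: "A \<in> upper_triangular_SL2Q"
    then have AC: "A \<in> carrier SL2Q" and A21: "A $ 2 $ 1 = 0"
      by (auto simp: upper_triangular_SL2Q_def)
    let ?B = "inv\<^bsub>SL2Q\<^esub> A"
    have B: "?B \<in> carrier SL2Q" using AC by simp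
    have "?B ** A = mat 1"
      using l_inv[OF AC] by (simp add: special_linear_def)
    then have "(?B ** A) $ 2 $ 1 = 0" by (simp add: mat_def)
    then have "?B $ 2 $ 1 * A $ 1 $ 1 = 0"
      using A21 by (simp add: matrix_matrix_mult_def sum_2)
    moreover have "A $ 1 $ 1 \<noteq> 0"
      using AC A21 by (auto simp: special_linear_def det_2)
    ultimately show "?B \<in> upper_triangular_SL2Q"
      using B by (simp add: upper_triangular_SL2Q_def)
  qed
qed

lemma shift_closed:
  assumes "group A" "group G" "g \<in> carrier G" "a \<in> carrier (sum_group (carrier G) (\<lambda>_. A))"
  shows "shift G g a \<in> carrier (sum_group (carrier G) (\<lambda>_. A))"
proof -
  interpret G: group G by fact
  have "{x \<in> carrier G. a (inv\<^bsub>G\<^esub> g \<otimes>\<^bsub>G\<^esub> x) \<noteq> \<one>\<^bsub>A\<^esub>}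
      \<subseteq> (\<lambda>y. g \<otimes>\<^bsub>G\<^esub> y) ` {y \<in> carrier G. a y \<noteq> \<one>\<^bsub>A\<^esub>}"
  proof
    fix x assume x: "x \<in> {x \<in> carrier G. a (inv\<^bsub>G\<^esub> g \<otimes>\<^bsub>G\<^esub> x) \<noteq> \<one>\<^bsub>A\<^esub>}"
    then have "x = g \<otimes>\<^bsub>G\<^esub> (inv\<^bsub>G\<^esub> g \<otimes>\<^bsub>G\<^esub> x)"
      using assms(3) by (simp add: G.m_assoc[symmetric])
    with x show "x \<in> (\<lambda>y. g \<otimes>\<^bsub>G\<^esub> y) ` {y \<in> carrier G. a y \<noteq> \<one>\<^bsub>A\<^esub>}"
      using assms(3) by (intro image_eqI[where x = "inv\<^bsub>G\<^esub> g \<otimes>\<^bsub>G\<^esub> x"]) auto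
  qed
  then have "finite {x \<in> carrier G. a (inv\<^bsub>G\<^esub> g \<otimes>\<^bsub>G\<^esub> x) \<noteq> \<one>\<^bsub>A\<^esub>}"
    using assms by (auto simp: carrier_sum_group intro: finite_subset)
  then show ?thesis
    using assms by (auto simp: carrier_sum_group shift_def PiE_iff cong: conj_cong)
qed

lemma group_wreath_over:
  assumes A: "group A" and G: "group G" and H: "subgroup H G"
  shows "group (wreath_over A G H)"
proof -
  interpret G: group G by fact
  interpret A: group A by fact
  let ?S = "sum_group (carrier G) (\<lambda>_. A)"
  interpret S: group ?S by (simp add: A)
  interpret H: subgroup H G by fact
  have HG: "h \<in> carrier G" if "h \<in> H" for h using that by (rule H.mem_carrier)
  have ext: "a \<in> extensional (carrier G)" if "a \<in> carrier ?S" for a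
    using that A by (auto simp: carrier_sum_group PiE_iff)
  have val: "a x \<in> carrier A" if "a \<in> carrier ?S" "x \<in> carrier G" for a x
    using that A by (auto simp: carrier_sum_group PiE_iff)
  have shift_mult: "shift G g (a \<otimes>\<^bsub>?S\<^esub> b) = shift G g a \<otimes>\<^bsub>?S\<^esub> shift G g b"
    if "g \<in> carrier G" for g a b
    using that by (auto simp: shift_def fun_eq_iff)
  have shift_comp: "shift G g (shift G h a) = shift G (g \<otimes>\<^bsub>G\<^esub> h) a"
    if "g \<in> carrier G" "h \<in> carrier G" for g h a
    using that by (auto simp: shift_def fun_eq_iff G.inv_mult_group G.m_assoc)
  have shift_one: "shift G \<one>\<^bsub>G\<^esub> a = a" if "a \<in> carrier ?S" for a
    using ext[OF that] by (auto simp: shift_def fun_eq_iff extensional_def)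
  note shc = shift_closed[OF A G]
  show ?thesis
  proof (rule groupI)
    fix p q r
    assume "p \<in> carrier (wreath_over A G H)" "q \<in> carrier (wreath_over A G H)"
      "r \<in> carrier (wreath_over A G H)"
    then obtain a g b h c k where
      pqr: "p = (a, g)" "q = (b, h)" "r = (c, k)"
      and a: "a \<in> carrier ?S" "b \<in> carrier ?S" "c \<in> carrier ?S"
      and g: "g \<in> H" "h \<in> H" "k \<in> H"
      by (auto simp: wreath_over_def)
    show "p \<otimes>\<^bsub>wreath_over A G H\<^esub> q \<otimes>\<^bsub>wreath_over A G H\<^esub> r =
      p \<otimes>\<^bsub>wreath_over A G H\<^esub> (q \<otimes>\<^bsub>wreath_over A G H\<^esub> r)"
      using a g by (simp add: pqr wreath_over_def shift_mult shift_comp shc HG S.m_assoc G.m_assoc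
          del: mult_sum_group)
  next
    fix p q
    assume "p \<in> carrier (wreath_over A G H)" "q \<in> carrier (wreath_over A G H)"
    then show "p \<otimes>\<^bsub>wreath_over A G H\<^esub> q \<in> carrier (wreath_over A G H)"
      by (auto simp: wreath_over_def shc HG H.m_closed simp del: mult_sum_group)
  next
    show "\<one>\<^bsub>wreath_over A G H\<^esub> \<in> carrier (wreath_over A G H)"
      by (auto simp: wreath_over_def H.one_closed simp del: one_sum_group)
  next
    fix p assume "p \<in> carrier (wreath_over A G H)"
    then show "\<one>\<^bsub>wreath_over A G H\<^esub> \<otimes>\<^bsub>wreath_over A G H\<^esub> p = p"
      by (auto simp: wreath_over_def shift_one HG simp del: one_sum_group mult_sum_group)
  next
    fix p assume "p \<in> carrier (wreath_over A G H)"
    then obtain a g where p: "p = (a, g)" "a \<in> carrier ?S" "g \<in> H"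
      by (auto simp: wreath_over_def)
    let ?q = "(shift G (inv\<^bsub>G\<^esub> g) (inv\<^bsub>?S\<^esub> a), inv\<^bsub>G\<^esub> g)"
    have "?q \<in> carrier (wreath_over A G H)"
      using p by (simp add: wreath_over_def shc HG H.m_inv_closed del: inv_sum_group)
    moreover have "shift G (inv\<^bsub>G\<^esub> g) \<one>\<^bsub>?S\<^esub> = \<one>\<^bsub>?S\<^esub>"
      using p by (auto simp: shift_def fun_eq_iff HG)
    then have "?q \<otimes>\<^bsub>wreath_over A G H\<^esub> p = \<one>\<^bsub>wreath_over A G H\<^esub>"
      using p by (simp add: wreath_over_def shift_mult[symmetric] HG S.l_inv
          del: inv_sum_group mult_sum_group one_sum_group)
    ultimately show "\<exists>q\<in>carrier (wreath_over A G H).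
        q \<otimes>\<^bsub>wreath_over A G H\<^esub> p = \<one>\<^bsub>wreath_over A G H\<^esub>" by blast
  qed
qed

lemma group_wreath: "group A \<Longrightarrow> group G \<Longrightarrow> group (wreath A G)"
  unfolding wreath_def by (intro group_wreath_over group.subgroup_self)

lemma subgroup_wreath_over:
  assumes "group A" "group G" "subgroup H G"
  shows "subgroup (carrier (wreath_over A G H)) (wreath A G)"
proof (rule group.group_incl_imp_subgroup[OF group_wreath[OF assms(1,2)]])
  show "carrier (wreath_over A G H) \<subseteq> carrier (wreath A G)"
    using subgroup.subset[OF assms(3)] by (auto simp: wreath_def wreath_over_def)
  have "(wreath A G)\<lparr>carrier := carrier (wreath_over A G H)\<rparr> = wreath_over A G H"
    by (simp add: wreath_def wreath_over_def)
  then show "group ((wreath A G)\<lparr>carrier := carrier (wreath_over A G H)\<rparr>)"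
    using group_wreath_over[OF assms] by simp
qed

end

theory Submission
  imports Defs
begin

text \<open>
  Let \<open>\<Gamma>\<close> be the full wreath product, \<open>\<Sigma>\<close> the subgroup, and let \<open>P\<close> be a von Neumann algebra with
  \<open>L(\<Sigma>) \<subseteq> P \<subseteq> L(\<Gamma>)\<close>. Each \<open>T\<close> in \<open>L(\<Gamma>)\<close> is determined by the vector \<open>T \<delta>\<^sub>1\<close>. If \<open>g\<close> is not in \<open>\<Sigma>\<close>
  and \<open>d\<close> is in \<open>\<Sigma> \<inter> g\<Sigma>g\<^sup>-\<^sup>1\<close>, then \<open>v \<mapsto> \<lambda>(d) v \<rho>(g\<^sup>-\<^sup>1dg)\<close> preserves \<open>P \<delta>\<^sub>1\<close> and fixes \<open>\<delta>\<^sub>g\<close>. The group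
  \<open>\<Sigma> \<inter> g\<Sigma>g\<^sup>-\<^sup>1\<close> contains the direct sum and an infinite torus, so it has infinite conjugation orbits
  on \<open>\<Gamma> - {1}\<close>, and \<open>\<delta>\<^sub>g\<close> spans the fixed vectors. Hence either all of \<open>P \<delta>\<^sub>1\<close> vanishes at \<open>g\<close>, or
  \<open>\<delta>\<^sub>g\<close> is in its closure and \<open>\<lambda>(g) \<in> P\<close>. As \<open>\<Gamma> - \<Sigma>\<close> is a single double coset of \<open>\<Sigma>\<close> (Bruhat
  decomposition), \<open>P\<close> is \<open>L(\<Sigma>)\<close> or \<open>L(\<Gamma>)\<close>. The same orbits give factoriality. An invariant mean
  on \<open>\<Sigma>\<close> averages the matrix coefficients of an operator along the right translates by \<open>\<Sigma>\<close>, which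
  yields a conditional expectation onto \<open>L(\<Sigma>)\<close>.
\<close>

section \<open>Square-summable functions\<close>

text \<open>The two kinds of elements in \<Sigma> \<inter> g\<Sigma>g^-1 do different work.
  Conjugation by the direct sum moves the elements of \<Gamma> whose component in G is not 1; for an
  abelian A it fixes the direct sum pointwise, and there it is the torus that moves the supports.
  Both inclusions are instances of one theorem about an amenable group A with an element other than
  the identity.

  Two obstacles shape the analysis. Closeness of U \<delta>_1 to \<delta>_g is closeness in l2 and
  gives no bound on the operators U, so \<lambda>(g) \<in> P is reached through the commutant of P.
  And averaging an operator T on l2(\<Gamma>) over right translations by \<Sigma> only yields an
  operator commuting with these translations, which need not lie in L(\<Sigma>). Hence T is first
  compressed to l2(\<Sigma>) and averaged there, and the resulting convolution operator is copied to
  every coset \<Sigma>r.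

  Operators are handled through their matrix entries throughout, so that adjoints, expectations and
  operator identities become statements about finite sums.\<close>

definition ket :: "'x \<Rightarrow> 'x \<Rightarrow> complex" where
  "ket x = (\<lambda>y. if y = x then 1 else 0)"

definition trunc :: "'x set \<Rightarrow> ('x \<Rightarrow> complex) \<Rightarrow> 'x \<Rightarrow> complex" where
  "trunc F f = (\<lambda>x. if x \<in> F then f x else 0)"

lemma ell2_norm_nonneg [simp]: "0 \<le> ell2_norm X f"
  by (simp add: ell2_norm_def infsum_nonneg)

lemma ell2_norm_cong: "(\<And>x. x \<in> X \<Longrightarrow> f x = g x) \<Longrightarrow> ell2_norm X f = ell2_norm X g"
  unfolding ell2_norm_def by (simp cong: infsum_cong)

lemma L2_set_le_ell2_norm:
  assumes "(\<lambda>x. (cmod (f x))\<^sup>2) summable_on X" "finite F" "F \<subseteq> X"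
  shows "L2_set (\<lambda>x. cmod (f x)) F \<le> ell2_norm X f"
  unfolding L2_set_def ell2_norm_def
  by (intro real_sqrt_le_mono finite_sum_le_infsum) (use assms in auto)

text \<open>Reduces the l2 estimates below to finite sums, where the inequalities for
  \<open>L2_set\<close> apply; summability comes out of the same bound.\<close>

lemma square_summable_if_L2_set_bounded:
  assumes "\<And>F. finite F \<Longrightarrow> F \<subseteq> X \<Longrightarrow> L2_set (\<lambda>x. cmod (f x)) F \<le> B"
  shows "(\<lambda>x. (cmod (f x))\<^sup>2) summable_on X" and "ell2_norm X f \<le> B"
proof -
  have B: "0 \<le> B" using assms[of "{}"] by simp
  have *: "(\<Sum>x\<in>F. (cmod (f x))\<^sup>2) \<le> B\<^sup>2" if "finite F" "F \<subseteq> X" for F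
    using assms[OF that] B by (simp add: L2_set_def real_sqrt_le_iff' sqrt_le_D)
  show "(\<lambda>x. (cmod (f x))\<^sup>2) summable_on X"
    by (rule nonneg_bdd_above_summable_on) (use * in \<open>auto intro!: bdd_aboveI2\<close>)
  then have "(\<Sum>\<^sub>\<infinity>x\<in>X. (cmod (f x))\<^sup>2) \<le> B\<^sup>2"
    by (rule infsum_le_finite_sums) (use * in auto)
  then show "ell2_norm X f \<le> B"
    unfolding ell2_norm_def using B by (simp add: real_le_lsqrt)
qed

lemma ell2_summable: "f \<in> ell2 X \<Longrightarrow> (\<lambda>x. (cmod (f x))\<^sup>2) summable_on X"
  by (simp add: ell2_def)

lemma ell2_outside: "f \<in> ell2 X \<Longrightarrow> x \<notin> X \<Longrightarrow> f x = 0"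
  by (simp add: ell2_def)

section \<open>Linear structure of the l2 space and its basis vectors\<close>

lemma L2_set_cmod_add:
  "L2_set (\<lambda>x. cmod (f x + g x)) F \<le> L2_set (\<lambda>x. cmod (f x)) F + L2_set (\<lambda>x. cmod (g x)) F"
proof -
  have "L2_set (\<lambda>x. cmod (f x + g x)) F \<le> L2_set (\<lambda>x. cmod (f x) + cmod (g x)) F"
    by (rule L2_set_mono) (auto simp: norm_triangle_ineq)
  also have "\<dots> \<le> L2_set (\<lambda>x. cmod (f x)) F + L2_set (\<lambda>x. cmod (g x)) F"
    by (rule L2_set_triangle_ineq)
  finally show ?thesis .
qed

lemma square_summable_add:
  assumes "(\<lambda>x. (cmod (f x))\<^sup>2) summable_on X" "(\<lambda>x. (cmod (g x))\<^sup>2) summable_on X"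
  shows "(\<lambda>x. (cmod (f x + g x))\<^sup>2) summable_on X"
    and "ell2_norm X (\<lambda>x. f x + g x) \<le> ell2_norm X f + ell2_norm X g"
proof -
  have "L2_set (\<lambda>x. cmod (f x + g x)) F \<le> ell2_norm X f + ell2_norm X g"
    if "finite F" "F \<subseteq> X" for F
    using L2_set_cmod_add[of f g F] L2_set_le_ell2_norm[OF assms(1) that]
      L2_set_le_ell2_norm[OF assms(2) that] by linarith
  from square_summable_if_L2_set_bounded[OF this]
  show "(\<lambda>x. (cmod (f x + g x))\<^sup>2) summable_on X"
    and "ell2_norm X (\<lambda>x. f x + g x) \<le> ell2_norm X f + ell2_norm X g" by auto
qed

lemma square_summable_scale:
  assumes "(\<lambda>x. (cmod (f x))\<^sup>2) summable_on X"
  shows "(\<lambda>x. (cmod (c * f x))\<^sup>2) summable_on X"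
  using summable_on_cmult_right[OF assms, of "(cmod c)\<^sup>2"] by (simp add: norm_mult power_mult_distrib)

lemma ell2_norm_scale: "ell2_norm X (\<lambda>x. c * f x) = cmod c * ell2_norm X f"
  unfolding ell2_norm_def
  by (simp add: norm_mult power_mult_distrib infsum_cmult_right' real_sqrt_mult)

lemma ell2_add: "f \<in> ell2 X \<Longrightarrow> g \<in> ell2 X \<Longrightarrow> (\<lambda>x. f x + g x) \<in> ell2 X"
  using square_summable_add(1)[of f X g] by (auto simp: ell2_def)

lemma ell2_scale: "f \<in> ell2 X \<Longrightarrow> (\<lambda>x. c * f x) \<in> ell2 X"
  using square_summable_scale[of f X c] by (auto simp: ell2_def)

lemma ell2_diff: "f \<in> ell2 X \<Longrightarrow> g \<in> ell2 X \<Longrightarrow> (\<lambda>x. f x - g x) \<in> ell2 X"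
  using ell2_add[OF _ ell2_scale[of g X "- 1"], of f] by simp

lemma ell2_zero [simp]: "(\<lambda>x. 0) \<in> ell2 X"
  by (simp add: ell2_def)

lemma ell2_norm_add:
  "f \<in> ell2 X \<Longrightarrow> g \<in> ell2 X \<Longrightarrow> ell2_norm X (\<lambda>x. f x + g x) \<le> ell2_norm X f + ell2_norm X g"
  by (intro square_summable_add) (auto simp: ell2_def)

lemma ell2_coord_le:
  assumes "f \<in> ell2 X" shows "cmod (f x) \<le> ell2_norm X f"
proof (cases "x \<in> X")
  case True
  then show ?thesis using L2_set_le_ell2_norm[OF ell2_summable[OF assms], of "{x}"] by simp
qed (simp add: ell2_outside[OF assms])

lemma ell2_finite_support:
  assumes "finite F" "F \<subseteq> X" "\<And>x. x \<notin> F \<Longrightarrow> f x = 0"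
  shows "f \<in> ell2 X"
proof -
  have "(\<lambda>x. (cmod (f x))\<^sup>2) summable_on X"
    by (rule finite_nonzero_values_imp_summable_on) (rule finite_subset[OF _ assms(1)], use assms in auto)
  then show ?thesis using assms by (auto simp: ell2_def)
qed

lemma ket_ell2 [simp]: "x \<in> X \<Longrightarrow> ket x \<in> ell2 X"
  by (rule ell2_finite_support[of "{x}"]) (auto simp: ket_def)

lemma ket_same [simp]: "ket x x = 1"
  by (simp add: ket_def)

lemma trunc_ell2: "f \<in> ell2 X \<Longrightarrow> finite F \<Longrightarrow> F \<subseteq> X \<Longrightarrow> trunc F f \<in> ell2 X"
  by (rule ell2_finite_support[of F]) (auto simp: trunc_def)

lemma ell2_norm_trunc:
  assumes "finite F" "F \<subseteq> X"
  shows "ell2_norm X (trunc F f) = L2_set (\<lambda>x. cmod (f x)) F"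
proof -
  have "(\<Sum>\<^sub>\<infinity>x\<in>X. (cmod (trunc F f x))\<^sup>2) = (\<Sum>\<^sub>\<infinity>x\<in>F. (cmod (f x))\<^sup>2)"
    by (rule infsum_cong_neutral) (use assms in \<open>auto simp: trunc_def\<close>)
  then show ?thesis using assms by (simp add: ell2_norm_def L2_set_def)
qed

lemma ell2_norm_ket: "x \<in> X \<Longrightarrow> ell2_norm X (ket x) = 1"
proof -
  assume x: "x \<in> X"
  have "trunc {x} (ket x) = ket x" by (auto simp: trunc_def ket_def)
  then show ?thesis using ell2_norm_trunc[of "{x}" X "ket x"] x by simp
qed

text \<open>The source of the limit interchanges below: a bounded functional, a quadratic form or a
  mean is compared with a finite truncation, and the error is at most a multiple of this
  tail.\<close>

lemma ell2_norm_tail: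
  assumes "(\<lambda>x. (cmod (f x))\<^sup>2) summable_on X"
  shows "((\<lambda>F. ell2_norm (X - F) f) \<longlongrightarrow> 0) (finite_subsets_at_top X)"
proof -
  let ?s = "\<lambda>x. (cmod (f x))\<^sup>2"
  have "((\<lambda>F. sqrt (infsum ?s X - sum ?s F)) \<longlongrightarrow> sqrt (infsum ?s X - infsum ?s X))
      (finite_subsets_at_top X)"
    by (intro tendsto_intros infsum_tendsto assms)
  then have "((\<lambda>F. sqrt (infsum ?s X - sum ?s F)) \<longlongrightarrow> 0) (finite_subsets_at_top X)"
    by simp
  moreover have "\<forall>\<^sub>F F in finite_subsets_at_top X. sqrt (infsum ?s X - sum ?s F) = ell2_norm (X - F) f"
  proof (rule eventually_finite_subsets_at_top_weakI)
    fix F assume F: "finite F" "F \<subseteq> X"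
    have "infsum ?s (X - F) = infsum ?s X - infsum ?s F"
      by (rule infsum_Diff) (use F assms in auto)
    then show "sqrt (infsum ?s X - sum ?s F) = ell2_norm (X - F) f"
      using F by (simp add: ell2_norm_def)
  qed
  ultimately show ?thesis by (rule Lim_transform_eventually)
qed

text \<open>Cauchy-Schwarz, without conjugation and for functions that are only square-summable on
  X: rows of matrices need not belong to \<open>ell2 X\<close>, because \<open>T (ket y)\<close> is
  \<open>undefined\<close> for y outside X.\<close>

lemma infsum_mult_summable:
  assumes f: "(\<lambda>x. (cmod (f x))\<^sup>2) summable_on X" and g: "(\<lambda>x. (cmod (g x))\<^sup>2) summable_on X"
  shows "(\<lambda>x. f x * g x) summable_on X"
    and "cmod (\<Sum>\<^sub>\<infinity>x\<in>X. f x * g x) \<le> ell2_norm X f * ell2_norm X g"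
proof -
  have *: "(\<Sum>x\<in>F. cmod (f x * g x)) \<le> ell2_norm X f * ell2_norm X g" if "finite F" "F \<subseteq> X" for F
  proof -
    have "(\<Sum>x\<in>F. cmod (f x * g x)) \<le> L2_set (\<lambda>x. cmod (f x)) F * L2_set (\<lambda>x. cmod (g x)) F"
      using L2_set_mult_ineq[of "\<lambda>x. cmod (f x)" "\<lambda>x. cmod (g x)" F] by (simp add: norm_mult)
    also have "\<dots> \<le> ell2_norm X f * ell2_norm X g"
      by (intro mult_mono L2_set_le_ell2_norm f g that) auto
    finally show ?thesis .
  qed
  have s: "(\<lambda>x. cmod (f x * g x)) summable_on X"
    by (rule nonneg_bdd_above_summable_on) (use * in \<open>auto intro!: bdd_aboveI2\<close>)
  then show "(\<lambda>x. f x * g x) summable_on X" by (rule abs_summable_summable)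
  have "cmod (\<Sum>\<^sub>\<infinity>x\<in>X. f x * g x) \<le> (\<Sum>\<^sub>\<infinity>x\<in>X. cmod (f x * g x))"
    by (rule norm_infsum_bound[OF s])
  also have "\<dots> \<le> ell2_norm X f * ell2_norm X g"
    by (rule infsum_le_finite_sums[OF s]) (use * in auto)
  finally show "cmod (\<Sum>\<^sub>\<infinity>x\<in>X. f x * g x) \<le> ell2_norm X f * ell2_norm X g" .
qed

section \<open>Parallelogram law and changes of variable\<close>

lemma ell2_parallelogram:
  assumes f: "f \<in> ell2 X" and g: "g \<in> ell2 X"
  shows "(ell2_norm X (\<lambda>x. f x - g x))\<^sup>2 + (ell2_norm X (\<lambda>x. f x + g x))\<^sup>2
       = 2 * (ell2_norm X f)\<^sup>2 + 2 * (ell2_norm X g)\<^sup>2"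
proof -
  have sq: "(ell2_norm X h)\<^sup>2 = (\<Sum>\<^sub>\<infinity>x\<in>X. (cmod (h x))\<^sup>2)" for h
    by (simp add: ell2_norm_def infsum_nonneg)
  note s = ell2_summable[OF f] ell2_summable[OF g] ell2_summable[OF ell2_add[OF f g]]
    ell2_summable[OF ell2_diff[OF f g]]
  have "(\<Sum>\<^sub>\<infinity>x\<in>X. (cmod (f x - g x))\<^sup>2) + (\<Sum>\<^sub>\<infinity>x\<in>X. (cmod (f x + g x))\<^sup>2)
      = (\<Sum>\<^sub>\<infinity>x\<in>X. (cmod (f x - g x))\<^sup>2 + (cmod (f x + g x))\<^sup>2)"
    by (rule infsum_add[symmetric]) (use s in auto)
  also have "\<dots> = (\<Sum>\<^sub>\<infinity>x\<in>X. 2 * (cmod (f x))\<^sup>2 + 2 * (cmod (g x))\<^sup>2)"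
    by (rule infsum_cong) (unfold cmod_power2, simp add: algebra_simps power2_eq_square)
  also have "\<dots> = 2 * (\<Sum>\<^sub>\<infinity>x\<in>X. (cmod (f x))\<^sup>2) + 2 * (\<Sum>\<^sub>\<infinity>x\<in>X. (cmod (g x))\<^sup>2)"
    using s by (simp add: infsum_add infsum_cmult_right' summable_on_cmult_right)
  finally show ?thesis by (simp add: sq)
qed

lemma ell2_norm_reindex:
  assumes "bij_betw \<pi> X X"
  shows "ell2_norm X (\<lambda>x. f (\<pi> x)) = ell2_norm X f"
  unfolding ell2_norm_def using infsum_reindex_bij_betw[OF assms, of "\<lambda>x. (cmod (f x))\<^sup>2"] by simp

lemma ell2_reindex:
  assumes "bij_betw \<pi> X X" "f \<in> ell2 X"
  shows "(\<lambda>x. if x \<in> X then f (\<pi> x) else 0) \<in> ell2 X"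
proof -
  have "(\<lambda>x. (cmod (f (\<pi> x)))\<^sup>2) summable_on X"
    using summable_on_reindex_bij_betw[OF assms(1), of "\<lambda>x. (cmod (f x))\<^sup>2"] ell2_summable[OF assms(2)]
    by simp
  then have "(\<lambda>x. (cmod (if x \<in> X then f (\<pi> x) else 0))\<^sup>2) summable_on X"
    by (rule summable_on_cong[THEN iffD1, rotated]) auto
  then show ?thesis by (auto simp: ell2_def)
qed

text \<open>The point where infinite orbits enter the analysis: an invariant vector is constant on
  each orbit, hence vanishes on the infinite ones.\<close>

lemma ell2_const_on_infinite:
  assumes "f \<in> ell2 X" "infinite Y" "Y \<subseteq> X" "\<And>y. y \<in> Y \<Longrightarrow> f y = c"
  shows "c = 0"
proof (rule ccontr)
  assume "c \<noteq> 0"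
  have "(\<lambda>x. (cmod (f x))\<^sup>2) summable_on Y"
    by (rule summable_on_subset_banach[OF ell2_summable[OF assms(1)] assms(3)])
  then have "(\<lambda>x. (cmod c)\<^sup>2) summable_on Y"
    by (rule summable_on_cong[THEN iffD1, rotated]) (use assms(4) in auto)
  then show False
    using infsum_diverge_constant[OF assms(2), of "(cmod c)\<^sup>2"] \<open>c \<noteq> 0\<close> by simp
qed

section \<open>Bounded operators and their matrices\<close>

lemma bounded_operatorE:
  assumes "T \<in> bounded_operators X"
  obtains C where "0 \<le> C" "\<And>f. f \<in> ell2 X \<Longrightarrow> ell2_norm X (T f) \<le> C * ell2_norm X f"
proof -
  from assms obtain C where C: "\<forall>f\<in>ell2 X. ell2_norm X (T f) \<le> C * ell2_norm X f"
    by (auto simp: bounded_operators_def)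
  have "ell2_norm X (T f) \<le> \<bar>C\<bar> * ell2_norm X f" if "f \<in> ell2 X" for f
  proof -
    have "C * ell2_norm X f \<le> \<bar>C\<bar> * ell2_norm X f" by (intro mult_right_mono) auto
    with C that show ?thesis by fastforce
  qed
  then show thesis using that[of "\<bar>C\<bar>"] by auto
qed

lemma op_closed: "T \<in> bounded_operators X \<Longrightarrow> f \<in> ell2 X \<Longrightarrow> T f \<in> ell2 X"
  by (auto simp: bounded_operators_def)

lemma op_undefined: "T \<in> bounded_operators X \<Longrightarrow> f \<notin> ell2 X \<Longrightarrow> T f = undefined"
  by (auto simp: bounded_operators_def PiE_def extensional_def)

lemma op_add_arg:
  "T \<in> bounded_operators X \<Longrightarrow> f \<in> ell2 X \<Longrightarrow> g \<in> ell2 X \<Longrightarrow> T (\<lambda>x. f x + g x) = (\<lambda>x. T f x + T g x)"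
  by (auto simp: bounded_operators_def)

lemma op_scale_arg:
  "T \<in> bounded_operators X \<Longrightarrow> f \<in> ell2 X \<Longrightarrow> T (\<lambda>x. c * f x) = (\<lambda>x. c * T f x)"
  by (auto simp: bounded_operators_def)

lemma op_diff_arg:
  assumes "T \<in> bounded_operators X" "f \<in> ell2 X" "g \<in> ell2 X"
  shows "T (\<lambda>x. f x - g x) = (\<lambda>x. T f x - T g x)"
  using op_add_arg[OF assms(1,2) ell2_scale[OF assms(3), of "-1"]] op_scale_arg[OF assms(1,3), of "-1"]
  by simp

lemma bounded_operatorsI:
  assumes "\<And>f. f \<in> ell2 X \<Longrightarrow> T f \<in> ell2 X" "\<And>f. f \<notin> ell2 X \<Longrightarrow> T f = undefined"
    and "\<And>f g. f \<in> ell2 X \<Longrightarrow> g \<in> ell2 X \<Longrightarrow> T (\<lambda>x. f x + g x) = (\<lambda>x. T f x + T g x)"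
    and "\<And>c f. f \<in> ell2 X \<Longrightarrow> T (\<lambda>x. c * f x) = (\<lambda>x. c * T f x)"
    and "\<And>f. f \<in> ell2 X \<Longrightarrow> ell2_norm X (T f) \<le> C * ell2_norm X f"
  shows "T \<in> bounded_operators X"
  unfolding bounded_operators_def using assms by (auto simp: extensional_def intro!: exI[of _ C])

text \<open>Boundedness controls the error of a truncation by the tail norm. Applied to
  \<open>\<lambda>f. T f x\<close> and to \<open>\<lambda>g. ell2_inner X f (T g)\<close>, this
  makes an operator readable from its matrix.\<close>

lemma bounded_functional_has_sum:
  assumes add: "\<And>f g. f \<in> ell2 X \<Longrightarrow> g \<in> ell2 X \<Longrightarrow> L (\<lambda>x. f x + g x) = L f + L g"
    and scale: "\<And>c f. f \<in> ell2 X \<Longrightarrow> L (\<lambda>x. c * f x) = c * L f"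
    and bound: "\<And>f. f \<in> ell2 X \<Longrightarrow> cmod (L f) \<le> C * ell2_norm X f"
    and f: "f \<in> ell2 X"
  shows "((\<lambda>y. f y * L (ket y)) has_sum L f) X"
proof -
  have fin: "L (trunc F f) = (\<Sum>y\<in>F. f y * L (ket y))" if "finite F" "F \<subseteq> X" for F
    using that
  proof (induction F)
    case empty
    \<comment> \<open>Homogeneity at the scalar 0 gives the value of L at the zero vector.\<close>
    have "L (\<lambda>x. 0 * 0) = 0 * L (\<lambda>x. 0)" by (rule scale) simp
    then show ?case by (simp add: trunc_def)
  next
    case (insert y F)
    have "trunc (insert y F) f = (\<lambda>x. f y * ket y x + trunc F f x)"
      using insert by (auto simp: trunc_def ket_def)
    moreover have "L (\<lambda>x. f y * ket y x + trunc F f x) = f y * L (ket y) + L (trunc F f)"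
      using insert f by (subst add) (auto simp: scale ell2_scale trunc_ell2)
    ultimately show ?case using insert by simp
  qed
  have "((\<lambda>F. (\<Sum>y\<in>F. f y * L (ket y)) - L f) \<longlongrightarrow> 0) (finite_subsets_at_top X)"
  proof (rule Lim_null_comparison)
    show "\<forall>\<^sub>F F in finite_subsets_at_top X.
        norm ((\<Sum>y\<in>F. f y * L (ket y)) - L f) \<le> C * ell2_norm (X - F) f"
    proof (rule eventually_finite_subsets_at_top_weakI)
      fix F assume F: "finite F" "F \<subseteq> X"
      have "trunc (X - F) f = (\<lambda>x. f x - trunc F f x)"
        using ell2_outside[OF f] by (auto simp: trunc_def)
      then have t: "trunc F f \<in> ell2 X" "trunc (X - F) f \<in> ell2 X"
        using trunc_ell2[OF f F] ell2_diff[OF f trunc_ell2[OF f F]] by simp_all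
      have "f = (\<lambda>x. trunc F f x + trunc (X - F) f x)"
        using ell2_outside[OF f] by (auto simp: trunc_def)
      then have "L f = L (trunc F f) + L (trunc (X - F) f)"
        using add[OF t] by simp
      then have "norm ((\<Sum>y\<in>F. f y * L (ket y)) - L f) = cmod (L (trunc (X - F) f))"
        using fin[OF F] by simp
      also have "\<dots> \<le> C * ell2_norm X (trunc (X - F) f)" by (rule bound[OF t(2)])
      also have "ell2_norm X (trunc (X - F) f) = ell2_norm (X - F) f"
        unfolding ell2_norm_def
        by (rule arg_cong[where f = sqrt], rule infsum_cong_neutral) (auto simp: trunc_def)
      finally show "norm ((\<Sum>y\<in>F. f y * L (ket y)) - L f) \<le> C * ell2_norm (X - F) f" .
    qed
    show "((\<lambda>F. C * ell2_norm (X - F) f) \<longlongrightarrow> 0) (finite_subsets_at_top X)"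
      using tendsto_mult_right_zero[OF ell2_norm_tail[OF ell2_summable[OF f]]] by blast
  qed
  then show ?thesis unfolding has_sum_def using LIM_zero_cancel by blast
qed

lemma op_has_sum:
  assumes T: "T \<in> bounded_operators X" and f: "f \<in> ell2 X"
  shows "((\<lambda>y. f y * T (ket y) x) has_sum T f x) X"
proof -
  obtain C where C: "\<And>f. f \<in> ell2 X \<Longrightarrow> ell2_norm X (T f) \<le> C * ell2_norm X f"
    using bounded_operatorE[OF T] by blast
  show ?thesis
  proof (rule bounded_functional_has_sum[where L = "\<lambda>f. T f x" and C = C, OF _ _ _ f])
    fix g assume g: "g \<in> ell2 X"
    show "cmod (T g x) \<le> C * ell2_norm X g"
      using ell2_coord_le[OF op_closed[OF T g], of x] C[OF g] by linarith
  qed (simp_all add: op_add_arg[OF T] op_scale_arg[OF T])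
qed

lemma op_apply:
  "T \<in> bounded_operators X \<Longrightarrow> f \<in> ell2 X \<Longrightarrow> T f x = (\<Sum>\<^sub>\<infinity>y\<in>X. f y * T (ket y) x)"
  using infsumI[OF op_has_sum] by metis

lemma op_trunc_apply:
  assumes T: "T \<in> bounded_operators X" and F: "finite F" "F \<subseteq> X"
  shows "T (trunc F f) x = (\<Sum>y\<in>F. f y * T (ket y) x)"
proof -
  have t: "trunc F f \<in> ell2 X" by (rule ell2_finite_support[OF F]) (auto simp: trunc_def)
  have "T (trunc F f) x = (\<Sum>\<^sub>\<infinity>y\<in>F. f y * T (ket y) x)"
    unfolding op_apply[OF T t] by (rule infsum_cong_neutral) (use F in \<open>auto simp: trunc_def\<close>)
  then show ?thesis using F by simp
qed

text \<open>The standard way to prove operator identities below. The values that entries do not see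
  agree by convention: \<open>undefined\<close> off \<open>ell2 X\<close>, and 0 at points off
  X.\<close>

lemma op_eqI:
  assumes T: "T \<in> bounded_operators X" and S: "S \<in> bounded_operators X"
    and eq: "\<And>x y. x \<in> X \<Longrightarrow> y \<in> X \<Longrightarrow> T (ket y) x = S (ket y) x"
  shows "T = S"
proof
  fix f show "T f = S f"
  proof (cases "f \<in> ell2 X")
    case True
    show ?thesis
    proof
      fix x show "T f x = S f x"
      proof (cases "x \<in> X")
        case True
        with \<open>f \<in> ell2 X\<close> show ?thesis
          by (simp add: op_apply[OF T] op_apply[OF S] eq cong: infsum_cong)
      next
        case False
        with \<open>f \<in> ell2 X\<close> show ?thesis
          using ell2_outside[OF op_closed[OF T]] ell2_outside[OF op_closed[OF S]] by metis
      qed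
    qed
  qed (simp add: op_undefined[OF T] op_undefined[OF S])
qed

text \<open>Closes the self-testing arguments below, where a vector of norm L is paired with its own
  conjugate: the square of L is at most C times L, and L is cancelled.\<close>

lemma le_if_square_le_mult: "0 \<le> (L::real) \<Longrightarrow> L\<^sup>2 \<le> C * L \<Longrightarrow> 0 \<le> C \<Longrightarrow> L \<le> C"
  by (cases "L = 0") (auto simp: power2_eq_square)

lemma op_row_bound:
  assumes T: "T \<in> bounded_operators X"
    and C: "0 \<le> C" "\<And>f. f \<in> ell2 X \<Longrightarrow> ell2_norm X (T f) \<le> C * ell2_norm X f"
  shows "(\<lambda>y. (cmod (T (ket y) x))\<^sup>2) summable_on X" and "ell2_norm X (\<lambda>y. T (ket y) x) \<le> C"
proof -
  have "L2_set (\<lambda>y. cmod (T (ket y) x)) F \<le> C" if F: "finite F" "F \<subseteq> X" for F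
  proof -
    \<comment> \<open>The conjugate of the row itself, cut off to F: coordinate x of
      \<open>T g\<close> is then the square of the norm of the row over F.\<close>
    define g where "g = trunc F (\<lambda>y. cnj (T (ket y) x))"
    let ?L = "L2_set (\<lambda>y. cmod (T (ket y) x)) F"
    have g: "g \<in> ell2 X" unfolding g_def by (rule ell2_finite_support[OF F]) (auto simp: trunc_def)
    have ng: "ell2_norm X g = ?L" unfolding g_def ell2_norm_trunc[OF F] by simp
    have "T g x = (\<Sum>y\<in>F. complex_of_real ((cmod (T (ket y) x))\<^sup>2))"
      unfolding g_def op_trunc_apply[OF T F] complex_norm_square by (simp add: mult.commute)
    also have "\<dots> = complex_of_real (?L\<^sup>2)"
      by (simp add: L2_set_def sum_nonneg)
    finally have "?L\<^sup>2 = cmod (T g x)" by (simp add: norm_power)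
    also have "\<dots> \<le> C * ?L"
      using ell2_coord_le[OF op_closed[OF T g], of x] C(2)[OF g] ng by simp
    finally show ?thesis by (rule le_if_square_le_mult[rotated]) (use C in auto)
  qed
  from square_summable_if_L2_set_bounded[OF this]
  show "(\<lambda>y. (cmod (T (ket y) x))\<^sup>2) summable_on X" and "ell2_norm X (\<lambda>y. T (ket y) x) \<le> C" by auto
qed

lemma op_row: "T \<in> bounded_operators X \<Longrightarrow> (\<lambda>y. (cmod (T (ket y) x))\<^sup>2) summable_on X"
  using bounded_operatorE[of T X] op_row_bound(1)[of T X] by metis

section \<open>Sums, multiples and products of bounded operators\<close>

lemma op_comp_apply: "f \<in> ell2 X \<Longrightarrow> op_comp X S T f = S (T f)"
  by (simp add: compose_def)

lemma op_comp_bounded: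
  assumes S: "S \<in> bounded_operators X" and T: "T \<in> bounded_operators X"
  shows "op_comp X S T \<in> bounded_operators X"
proof -
  obtain C where C: "0 \<le> C" "\<And>f. f \<in> ell2 X \<Longrightarrow> ell2_norm X (T f) \<le> C * ell2_norm X f"
    using bounded_operatorE[OF T] by blast
  obtain D where D: "0 \<le> D" "\<And>f. f \<in> ell2 X \<Longrightarrow> ell2_norm X (S f) \<le> D * ell2_norm X f"
    using bounded_operatorE[OF S] by blast
  show ?thesis
  proof (rule bounded_operatorsI[where C = "D * C"])
    fix f assume f: "f \<in> ell2 X"
    have "ell2_norm X (S (T f)) \<le> D * (C * ell2_norm X f)"
      using D(2)[OF op_closed[OF T f]] mult_left_mono[OF C(2)[OF f] D(1)] by linarith
    with f show "ell2_norm X (op_comp X S T f) \<le> D * C * ell2_norm X f"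
      by (simp add: op_comp_apply mult.assoc)
  qed (auto simp: compose_def op_closed[OF S] op_closed[OF T] op_add_arg[OF S] op_add_arg[OF T]
      op_scale_arg[OF S] op_scale_arg[OF T] ell2_add ell2_scale)
qed

lemma op_add_bounded:
  assumes S: "S \<in> bounded_operators X" and T: "T \<in> bounded_operators X"
  shows "op_add X S T \<in> bounded_operators X"
proof -
  obtain C where C: "0 \<le> C" "\<And>f. f \<in> ell2 X \<Longrightarrow> ell2_norm X (T f) \<le> C * ell2_norm X f"
    using bounded_operatorE[OF T] by blast
  obtain D where D: "0 \<le> D" "\<And>f. f \<in> ell2 X \<Longrightarrow> ell2_norm X (S f) \<le> D * ell2_norm X f"
    using bounded_operatorE[OF S] by blast
  show ?thesis
  proof (rule bounded_operatorsI[where C = "D + C"])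
    fix f assume f: "f \<in> ell2 X"
    show "ell2_norm X (op_add X S T f) \<le> (D + C) * ell2_norm X f"
      using f ell2_norm_add[OF op_closed[OF S f] op_closed[OF T f]] C(2)[OF f] D(2)[OF f]
      by (simp add: op_add_def algebra_simps)
  qed (auto simp: op_add_def op_closed[OF S] op_closed[OF T] op_add_arg[OF S] op_add_arg[OF T]
      op_scale_arg[OF S] op_scale_arg[OF T] ell2_add ell2_scale algebra_simps)
qed

lemma op_scale_bounded:
  assumes T: "T \<in> bounded_operators X"
  shows "op_scale X c T \<in> bounded_operators X"
proof -
  obtain C where C: "0 \<le> C" "\<And>f. f \<in> ell2 X \<Longrightarrow> ell2_norm X (T f) \<le> C * ell2_norm X f"
    using bounded_operatorE[OF T] by blast
  show ?thesis
  proof (rule bounded_operatorsI[where C = "cmod c * C"])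
    fix f assume f: "f \<in> ell2 X"
    show "ell2_norm X (op_scale X c T f) \<le> cmod c * C * ell2_norm X f"
      using f mult_left_mono[OF C(2)[OF f], of "cmod c"]
      by (simp add: op_scale_def ell2_norm_scale mult.assoc)
  qed (auto simp: op_scale_def op_closed[OF T] op_add_arg[OF T]
      op_scale_arg[OF T] ell2_add ell2_scale algebra_simps)
qed

lemma op_id_bounded: "op_id X \<in> bounded_operators X"
  by (rule bounded_operatorsI[where C = 1]) (auto simp: op_id_def ell2_add ell2_scale)

subsection \<open>Operators given by a matrix\<close>

definition kernel_op :: "'x set \<Rightarrow> ('x \<Rightarrow> 'x \<Rightarrow> complex) \<Rightarrow> 'x operator" where
  "kernel_op X K = (\<lambda>f\<in>ell2 X. \<lambda>x. if x \<in> X then \<Sum>\<^sub>\<infinity>y\<in>X. f y * K x y else 0)"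

text \<open>Recognises a matrix as a bounded operator from its forms on finite sets. Adjoints and
  conditional expectations are constructed in this way, because there the entries are known before
  the operator is.\<close>

lemma kernel_op:
  assumes C: "0 \<le> C"
    and K: "\<And>F f g. finite F \<Longrightarrow> F \<subseteq> X \<Longrightarrow> cmod (\<Sum>x\<in>F. \<Sum>y\<in>F. f x * K x y * g y)
      \<le> C * L2_set (\<lambda>x. cmod (f x)) F * L2_set (\<lambda>x. cmod (g x)) F"
  shows "kernel_op X K \<in> bounded_operators X"
    and "\<And>x y. x \<in> X \<Longrightarrow> y \<in> X \<Longrightarrow> kernel_op X K (ket y) x = K x y"
proof -
  \<comment> \<open>Different finite sets of row and column indices reduce to one set by padding
    both vectors with zeros on the union.\<close>
  have K2: "cmod (\<Sum>x\<in>F. \<Sum>y\<in>F'. f x * K x y * g y)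
      \<le> C * L2_set (\<lambda>x. cmod (f x)) F * L2_set (\<lambda>x. cmod (g x)) F'"
    if F: "finite F" "F \<subseteq> X" "finite F'" "F' \<subseteq> X" for F F' f g
  proof -
    let ?G = "F \<union> F'"
    have G: "finite ?G" "?G \<subseteq> X" using F by auto
    have "(\<Sum>x\<in>F. \<Sum>y\<in>F'. f x * K x y * g y)
      = (\<Sum>x\<in>?G. \<Sum>y\<in>?G. trunc F f x * K x y * trunc F' g y)"
    proof (rule sum.mono_neutral_cong_left)
      fix x assume "x \<in> F"
      then show "(\<Sum>y\<in>F'. f x * K x y * g y) = (\<Sum>y\<in>?G. trunc F f x * K x y * trunc F' g y)"
        by (intro sum.mono_neutral_cong_left) (use F in \<open>auto simp: trunc_def\<close>)
    qed (use F in \<open>auto simp: trunc_def\<close>)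
    also have "cmod \<dots> \<le> C * L2_set (\<lambda>x. cmod (trunc F f x)) ?G * L2_set (\<lambda>x. cmod (trunc F' g x)) ?G"
      by (rule K[OF G])
    also have "L2_set (\<lambda>x. cmod (trunc F f x)) ?G = L2_set (\<lambda>x. cmod (f x)) F"
      unfolding L2_set_def
      by (rule arg_cong[where f = sqrt], rule sum.mono_neutral_cong_right) (use F in \<open>auto simp: trunc_def\<close>)
    also have "L2_set (\<lambda>x. cmod (trunc F' g x)) ?G = L2_set (\<lambda>x. cmod (g x)) F'"
      unfolding L2_set_def
      by (rule arg_cong[where f = sqrt], rule sum.mono_neutral_cong_right) (use F in \<open>auto simp: trunc_def\<close>)
    finally show ?thesis .
  qed
  \<comment> \<open>Row x is tested against its own conjugate, with \<open>{x}\<close> as the set of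
    row indices. This makes the series in \<open>kernel_op\<close> converge.\<close>
  have row: "(\<lambda>y. (cmod (K x y))\<^sup>2) summable_on X" if x: "x \<in> X" for x
  proof -
    have "L2_set (\<lambda>y. cmod (K x y)) F \<le> C" if F: "finite F" "F \<subseteq> X" for F
    proof -
      let ?L = "L2_set (\<lambda>y. cmod (K x y)) F"
      have "(\<Sum>y\<in>F. K x y * cnj (K x y)) = complex_of_real (?L\<^sup>2)"
        unfolding complex_norm_square[symmetric] by (simp add: L2_set_def sum_nonneg)
      then have "?L\<^sup>2 = cmod (\<Sum>y\<in>F. K x y * cnj (K x y))" by (simp add: norm_power)
      also have "\<dots> \<le> C * ?L"
        using K2[of "{x}" F "\<lambda>_. 1" "\<lambda>y. cnj (K x y)"] F x by simp
      finally show ?thesis by (rule le_if_square_le_mult[rotated]) (use C in auto)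
    qed
    then show ?thesis by (rule square_summable_if_L2_set_bounded(1))
  qed
  have sm: "(\<lambda>y. g y * K x y) summable_on X" if "g \<in> ell2 X" "x \<in> X" for g x
    by (rule infsum_mult_summable(1)[OF ell2_summable row]) (use that in auto)
  \<comment> \<open>The image of g is tested against its own conjugate on F; the set F' of column
    indices then grows to X while F stays fixed.\<close>
  have bd: "L2_set (\<lambda>x. cmod (kernel_op X K g x)) F \<le> C * ell2_norm X g"
    if g: "g \<in> ell2 X" and F: "finite F" "F \<subseteq> X" for g F
  proof -
    let ?h = "kernel_op X K g"
    let ?L = "L2_set (\<lambda>x. cmod (?h x)) F"
    have h: "?h x = (\<Sum>\<^sub>\<infinity>y\<in>X. g y * K x y)" if "x \<in> F" for x
      using F that g by (auto simp: kernel_op_def)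
    have "((\<lambda>F'. \<Sum>x\<in>F. cnj (?h x) * (\<Sum>y\<in>F'. g y * K x y)) \<longlongrightarrow> (\<Sum>x\<in>F. cnj (?h x) * ?h x))
        (finite_subsets_at_top X)"
    proof (intro tendsto_intros)
      fix x assume "x \<in> F"
      then show "((\<lambda>F'. \<Sum>y\<in>F'. g y * K x y) \<longlongrightarrow> ?h x) (finite_subsets_at_top X)"
        using infsum_tendsto[OF sm[OF g, of x]] F h by auto
    qed
    then have "cmod (\<Sum>x\<in>F. cnj (?h x) * ?h x) \<le> C * ?L * ell2_norm X g"
    proof (rule Lim_norm_ubound[rotated])
      show "\<forall>\<^sub>F F' in finite_subsets_at_top X.
          norm (\<Sum>x\<in>F. cnj (?h x) * (\<Sum>y\<in>F'. g y * K x y)) \<le> C * ?L * ell2_norm X g"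
      proof (rule eventually_finite_subsets_at_top_weakI)
        fix F' assume F': "finite F'" "F' \<subseteq> X"
        have "(\<Sum>x\<in>F. cnj (?h x) * (\<Sum>y\<in>F'. g y * K x y)) = (\<Sum>x\<in>F. \<Sum>y\<in>F'. cnj (?h x) * K x y * g y)"
          by (simp add: sum_distrib_left mult_ac)
        also have "cmod \<dots> \<le> C * ?L * L2_set (\<lambda>x. cmod (g x)) F'"
          using K2[OF F F', of "\<lambda>x. cnj (?h x)" g] by simp
        also have "\<dots> \<le> C * ?L * ell2_norm X g"
          by (rule mult_left_mono[OF L2_set_le_ell2_norm[OF ell2_summable[OF g] F']]) (simp add: C)
        finally show "norm (\<Sum>x\<in>F. cnj (?h x) * (\<Sum>y\<in>F'. g y * K x y)) \<le> C * ?L * ell2_norm X g" .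
      qed
    qed simp
    moreover have "(\<Sum>x\<in>F. cnj (?h x) * ?h x) = complex_of_real (?L\<^sup>2)"
      unfolding mult.commute[of "cnj _"] complex_norm_square[symmetric] by (simp add: L2_set_def sum_nonneg)
    ultimately have "?L\<^sup>2 \<le> (C * ell2_norm X g) * ?L" by (simp add: norm_power mult_ac)
    then show ?thesis by (rule le_if_square_le_mult[rotated]) (use C in auto)
  qed
  have cl: "kernel_op X K g \<in> ell2 X" if "g \<in> ell2 X" for g
    using square_summable_if_L2_set_bounded(1)[OF bd[OF that]] that by (auto simp: ell2_def kernel_op_def)
  show "kernel_op X K \<in> bounded_operators X"
  proof (rule bounded_operatorsI[where C = C])
    fix f g assume f: "f \<in> ell2 X" and g: "g \<in> ell2 X"
    show "kernel_op X K (\<lambda>x. f x + g x) = (\<lambda>x. kernel_op X K f x + kernel_op X K g x)"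
      using f g by (auto simp: kernel_op_def fun_eq_iff ell2_add distrib_right infsum_add sm)
  next
    fix c f assume f: "f \<in> ell2 X"
    then show "kernel_op X K (\<lambda>x. c * f x) = (\<lambda>x. c * kernel_op X K f x)"
      by (auto simp: kernel_op_def fun_eq_iff ell2_scale mult.assoc infsum_cmult_right')
  next
    fix g assume "g \<in> ell2 X"
    then show "ell2_norm X (kernel_op X K g) \<le> C * ell2_norm X g"
      by (intro square_summable_if_L2_set_bounded(2) bd)
  qed (use cl in \<open>auto simp: kernel_op_def\<close>)
  show "kernel_op X K (ket y) x = K x y" if "x \<in> X" "y \<in> X" for x y
  proof -
    have "(\<Sum>\<^sub>\<infinity>z\<in>X. ket y z * K x z) = (\<Sum>\<^sub>\<infinity>z\<in>{y}. ket y z * K x z)"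
      by (rule infsum_cong_neutral) (use that in \<open>auto simp: ket_def\<close>)
    then show ?thesis using that by (simp add: kernel_op_def)
  qed
qed

text \<open>Converse to the hypothesis of \<open>kernel_op\<close>: bounds pass from an operator to
  its finite forms, are transformed there, and pass back.\<close>

lemma op_sum_bound:
  assumes T: "T \<in> bounded_operators X"
    and C: "0 \<le> C" "\<And>f. f \<in> ell2 X \<Longrightarrow> ell2_norm X (T f) \<le> C * ell2_norm X f"
    and F: "finite F" "F \<subseteq> X"
  shows "cmod (\<Sum>x\<in>F. \<Sum>y\<in>F. f x * T (ket y) x * g y)
      \<le> C * L2_set (\<lambda>x. cmod (f x)) F * L2_set (\<lambda>x. cmod (g x)) F"
proof -
  have tg: "trunc F g \<in> ell2 X" by (rule ell2_finite_support[OF F]) (auto simp: trunc_def)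
  have "(\<Sum>x\<in>F. \<Sum>y\<in>F. f x * T (ket y) x * g y) = (\<Sum>x\<in>F. f x * T (trunc F g) x)"
    by (simp add: op_trunc_apply[OF T F] sum_distrib_left mult_ac)
  also have "cmod \<dots> \<le> (\<Sum>x\<in>F. \<bar>cmod (f x)\<bar> * \<bar>cmod (T (trunc F g) x)\<bar>)"
    by (rule order_trans[OF norm_sum]) (simp add: norm_mult)
  also have "\<dots> \<le> L2_set (\<lambda>x. cmod (f x)) F * L2_set (\<lambda>x. cmod (T (trunc F g) x)) F"
    by (rule L2_set_mult_ineq)
  also have "\<dots> \<le> L2_set (\<lambda>x. cmod (f x)) F * (C * L2_set (\<lambda>x. cmod (g x)) F)"
  proof (rule mult_left_mono)
    show "L2_set (\<lambda>x. cmod (T (trunc F g) x)) F \<le> C * L2_set (\<lambda>x. cmod (g x)) F"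
      using L2_set_le_ell2_norm[OF ell2_summable[OF op_closed[OF T tg]] F] C(2)[OF tg] ell2_norm_trunc[OF F, of g]
      by simp
  qed simp
  finally show ?thesis by (simp add: mult_ac)
qed

subsection \<open>Adjoints\<close>

lemma ell2_inner_ket_left: "x \<in> X \<Longrightarrow> ell2_inner X (ket x) f = f x"
proof -
  assume x: "x \<in> X"
  have "ell2_inner X (ket x) f = (\<Sum>\<^sub>\<infinity>y\<in>{x}. cnj (ket x y) * f y)"
    unfolding ell2_inner_def by (rule infsum_cong_neutral) (use x in \<open>auto simp: ket_def\<close>)
  then show ?thesis by simp
qed

lemma ell2_inner_commute: "ell2_inner X f g = cnj (ell2_inner X g f)"
  unfolding ell2_inner_def by (subst infsum_cnj[symmetric]) (simp add: mult.commute)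

lemma ell2_inner_summable: "f \<in> ell2 X \<Longrightarrow> g \<in> ell2 X \<Longrightarrow> (\<lambda>x. cnj (f x) * g x) summable_on X"
  by (rule infsum_mult_summable) (simp_all add: ell2_summable)

lemma ell2_inner_bound:
  "f \<in> ell2 X \<Longrightarrow> g \<in> ell2 X \<Longrightarrow> cmod (ell2_inner X f g) \<le> ell2_norm X f * ell2_norm X g"
  using infsum_mult_summable(2)[of "\<lambda>x. cnj (f x)" X g]
  by (simp add: ell2_summable ell2_inner_def) (simp add: ell2_norm_def)

lemma ell2_inner_op_has_sum:
  assumes T: "T \<in> bounded_operators X" and f: "f \<in> ell2 X" and g: "g \<in> ell2 X"
  shows "((\<lambda>y. g y * ell2_inner X f (T (ket y))) has_sum ell2_inner X f (T g)) X"
proof -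
  obtain C where C: "0 \<le> C" "\<And>f. f \<in> ell2 X \<Longrightarrow> ell2_norm X (T f) \<le> C * ell2_norm X f"
    using bounded_operatorE[OF T] by blast
  show ?thesis
  proof (rule bounded_functional_has_sum[where C = "ell2_norm X f * C"])
    fix h assume h: "h \<in> ell2 X"
    show "cmod (ell2_inner X f (T h)) \<le> ell2_norm X f * C * ell2_norm X h"
      using ell2_inner_bound[OF f op_closed[OF T h]] mult_left_mono[OF C(2)[OF h], of "ell2_norm X f"]
      by simp
    fix k assume k: "k \<in> ell2 X"
    show "ell2_inner X f (T (\<lambda>x. h x + k x)) = ell2_inner X f (T h) + ell2_inner X f (T k)"
      using h k op_closed[OF T] f
      by (simp add: op_add_arg[OF T] ell2_inner_def distrib_left infsum_add ell2_inner_summable)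
  next
    fix c h assume h: "h \<in> ell2 X"
    show "ell2_inner X f (T (\<lambda>x. c * h x)) = c * ell2_inner X f (T h)"
      using h by (simp add: op_scale_arg[OF T] ell2_inner_def mult.left_commute infsum_cmult_right')
  qed (rule g)
qed

lemma is_adjointI:
  assumes T: "T \<in> bounded_operators X" and S: "S \<in> bounded_operators X"
    and eq: "\<And>x y. x \<in> X \<Longrightarrow> y \<in> X \<Longrightarrow> S (ket y) x = cnj (T (ket x) y)"
  shows "is_adjoint X T S"
  unfolding is_adjoint_def
proof (intro ballI)
  fix f g assume f: "f \<in> ell2 X" and g: "g \<in> ell2 X"
  have 1: "cnj (S f y) = ell2_inner X f (T (ket y))" if "y \<in> X" for y
    using that by (simp add: op_apply[OF S f] ell2_inner_def infsum_cnj[symmetric] eq del: infsum_cnj cong: infsum_cong)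
  have "ell2_inner X f (T g) = (\<Sum>\<^sub>\<infinity>y\<in>X. g y * ell2_inner X f (T (ket y)))"
    using infsumI[OF ell2_inner_op_has_sum[OF T f g]] by simp
  also have "\<dots> = (\<Sum>\<^sub>\<infinity>y\<in>X. cnj (S f y) * g y)"
    by (rule infsum_cong) (simp add: 1 mult.commute)
  finally show "ell2_inner X (S f) g = ell2_inner X f (T g)" by (simp add: ell2_inner_def)
qed

text \<open>The conjugate transpose satisfies the form bound of T with the same constant, because
  swapping the two sums and conjugating preserves the modulus; \<open>kernel_op\<close> then
  produces the operator.\<close>

lemma adjoint_exists:
  assumes T: "T \<in> bounded_operators X"
  obtains S where "S \<in> bounded_operators X" "is_adjoint X T S"
proof -
  obtain C where C: "0 \<le> C" "\<And>f. f \<in> ell2 X \<Longrightarrow> ell2_norm X (T f) \<le> C * ell2_norm X f"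
    using bounded_operatorE[OF T] by blast
  let ?K = "\<lambda>x y. cnj (T (ket x) y)"
  have b: "cmod (\<Sum>x\<in>F. \<Sum>y\<in>F. f x * ?K x y * g y)
      \<le> C * L2_set (\<lambda>x. cmod (f x)) F * L2_set (\<lambda>x. cmod (g x)) F" if F: "finite F" "F \<subseteq> X" for F f g
  proof -
    have "(\<Sum>x\<in>F. \<Sum>y\<in>F. f x * ?K x y * g y) = cnj (\<Sum>y\<in>F. \<Sum>x\<in>F. cnj (g y) * T (ket x) y * cnj (f x))"
      by (subst sum.swap) (simp add: mult_ac)
    then have "cmod (\<Sum>x\<in>F. \<Sum>y\<in>F. f x * ?K x y * g y)
        = cmod (\<Sum>y\<in>F. \<Sum>x\<in>F. cnj (g y) * T (ket x) y * cnj (f x))"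
      by (simp only: complex_mod_cnj)
    also have "\<dots> \<le> C * L2_set (\<lambda>x. cmod (cnj (g x))) F * L2_set (\<lambda>x. cmod (cnj (f x))) F"
      by (rule op_sum_bound[OF T C F])
    finally show ?thesis by (simp add: mult_ac)
  qed
  note k = kernel_op[OF C(1), of X ?K, OF b]
  show thesis
    by (rule that[OF k(1) is_adjointI[OF T k(1)]]) (use k(2) in auto)
qed

lemma is_adjoint_sym: "is_adjoint X T S \<Longrightarrow> is_adjoint X S T"
  unfolding is_adjoint_def by (metis ell2_inner_commute)

subsection \<open>Commutants\<close>

lemma op_comp_eq_iff:
  "op_comp X S T = op_comp X T S \<longleftrightarrow> (\<forall>f\<in>ell2 X. S (T f) = T (S f))"
  by (auto simp: compose_def fun_eq_iff restrict_def)

lemma commutant_iff: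
  "T \<in> commutant X M \<longleftrightarrow> T \<in> bounded_operators X \<and> (\<forall>S\<in>M. \<forall>f\<in>ell2 X. S (T f) = T (S f))"
  unfolding commutant_def op_comp_eq_iff by simp

lemma commutant_bounded: "commutant X M \<subseteq> bounded_operators X"
  by (auto simp: commutant_def)

lemma commutant_antimono: "M \<subseteq> N \<Longrightarrow> commutant X N \<subseteq> commutant X M"
  by (auto simp: commutant_def)

lemma double_commutant_increasing: "M \<subseteq> bounded_operators X \<Longrightarrow> M \<subseteq> commutant X (commutant X M)"
  by (auto simp: commutant_def)

lemma triple_commutant:
  assumes "M \<subseteq> bounded_operators X"
  shows "commutant X (commutant X (commutant X M)) = commutant X M"
proof
  show "commutant X (commutant X (commutant X M)) \<subseteq> commutant X M"
    by (rule commutant_antimono[OF double_commutant_increasing[OF assms]])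
  show "commutant X M \<subseteq> commutant X (commutant X (commutant X M))"
    by (rule double_commutant_increasing[OF commutant_bounded])
qed

lemma commutantD:
  assumes "T \<in> commutant X M" "S \<in> M" "f \<in> ell2 X"
  shows "S (T f) = T (S f)"
  using assms unfolding commutant_iff by blast

lemma commutant_comp:
  assumes M: "M \<subseteq> bounded_operators X" and S: "S \<in> commutant X M" and T: "T \<in> commutant X M"
  shows "op_comp X S T \<in> commutant X M"
  unfolding commutant_iff
proof (intro conjI ballI)
  have B: "S \<in> bounded_operators X" "T \<in> bounded_operators X"
    using S T commutant_bounded by blast+
  show "op_comp X S T \<in> bounded_operators X" by (rule op_comp_bounded[OF B])
  fix U f assume U: "U \<in> M" and f: "f \<in> ell2 X"
  have "U f \<in> ell2 X" "T f \<in> ell2 X" using op_closed U M f B by blast+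
  then show "U (op_comp X S T f) = op_comp X S T (U f)"
    using commutantD[OF S U] commutantD[OF T U] f by (simp add: op_comp_apply)
qed

lemma commutant_add:
  assumes M: "M \<subseteq> bounded_operators X" and S: "S \<in> commutant X M" and T: "T \<in> commutant X M"
  shows "op_add X S T \<in> commutant X M"
  unfolding commutant_iff
proof (intro conjI ballI)
  have B: "S \<in> bounded_operators X" "T \<in> bounded_operators X"
    using S T commutant_bounded by blast+
  show "op_add X S T \<in> bounded_operators X" by (rule op_add_bounded[OF B])
  fix U f assume U: "U \<in> M" and f: "f \<in> ell2 X"
  have UB: "U \<in> bounded_operators X" using U M by blast
  have "op_add X S T (U f) = (\<lambda>x. S (U f) x + T (U f) x)"
    using op_closed[OF UB f] by (simp add: op_add_def)
  also have "\<dots> = U (\<lambda>x. S f x + T f x)"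
    by (simp add: op_add_arg[OF UB op_closed[OF B(1) f] op_closed[OF B(2) f]]
        commutantD[OF S U f] commutantD[OF T U f])
  finally show "U (op_add X S T f) = op_add X S T (U f)"
    using f by (simp add: op_add_def)
qed

lemma commutant_scale:
  assumes M: "M \<subseteq> bounded_operators X" and T: "T \<in> commutant X M"
  shows "op_scale X c T \<in> commutant X M"
  unfolding commutant_iff
proof (intro conjI ballI)
  have B: "T \<in> bounded_operators X"
    using T commutant_bounded by blast
  show "op_scale X c T \<in> bounded_operators X" by (rule op_scale_bounded[OF B])
  fix U f assume U: "U \<in> M" and f: "f \<in> ell2 X"
  have UB: "U \<in> bounded_operators X" using U M by blast
  have "op_scale X c T (U f) = (\<lambda>x. c * T (U f) x)"
    using op_closed[OF UB f] by (simp add: op_scale_def)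
  also have "\<dots> = U (\<lambda>x. c * T f x)"
    by (simp add: op_scale_arg[OF UB op_closed[OF B f]] commutantD[OF T U f])
  finally show "U (op_scale X c T f) = op_scale X c T (U f)"
    using f by (simp add: op_scale_def)
qed

lemma op_id_commutant:
  assumes M: "M \<subseteq> bounded_operators X"
  shows "op_id X \<in> commutant X M"
  unfolding commutant_iff
proof (intro conjI ballI)
  fix U f assume U: "U \<in> M" and f: "f \<in> ell2 X"
  have "U f \<in> ell2 X" using op_closed U M f by blast
  then show "U (op_id X f) = op_id X (U f)" using f by (simp add: op_id_def)
qed (rule op_id_bounded)

text \<open>If V in M is an adjoint of U, then commutation of T with V becomes, after taking
  adjoints, commutation of S with U. The identity is tested coordinatewise against
  \<open>ket x\<close>.\<close>

lemma commutant_adjoint: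
  assumes M: "M \<subseteq> bounded_operators X" "\<And>T. T \<in> M \<Longrightarrow> \<exists>S\<in>M. is_adjoint X T S"
    and T: "T \<in> commutant X M"
  shows "\<exists>S\<in>commutant X M. is_adjoint X T S"
proof -
  have TB: "T \<in> bounded_operators X" using T by (simp add: commutant_def)
  obtain S where S: "S \<in> bounded_operators X" "is_adjoint X T S" by (rule adjoint_exists[OF TB])
  have "U (S f) = S (U f)" if U: "U \<in> M" and f: "f \<in> ell2 X" for U f
  proof
    fix x
    have UB: "U \<in> bounded_operators X" using U M by auto
    obtain V where V: "V \<in> M" "is_adjoint X U V" using M(2)[OF U] by auto
    then have VB: "V \<in> bounded_operators X" using M by auto
    show "U (S f) x = S (U f) x"
    proof (cases "x \<in> X")
      case True
      have "ell2_inner X (ket x) (U (S f)) = ell2_inner X (V (ket x)) (S f)"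
        using V(2) True op_closed[OF S(1) f] by (simp add: is_adjoint_def)
      also have "\<dots> = ell2_inner X (T (V (ket x))) f"
        using is_adjoint_sym[OF S(2)] f op_closed[OF VB] True by (simp add: is_adjoint_def)
      also have "T (V (ket x)) = V (T (ket x))"
        using commutantD[OF T V(1), of "ket x"] True by simp
      also have "ell2_inner X (V (T (ket x))) f = ell2_inner X (T (ket x)) (U f)"
        using V(2) True f op_closed[OF TB] by (simp add: is_adjoint_def)
      also have "\<dots> = ell2_inner X (ket x) (S (U f))"
        using is_adjoint_sym[OF S(2)] op_closed[OF UB f] True by (simp add: is_adjoint_def)
      finally show ?thesis using True by (simp add: ell2_inner_ket_left)
    next
      case False
      then show ?thesis
        using ell2_outside[OF op_closed[OF UB op_closed[OF S(1) f]]]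
          ell2_outside[OF op_closed[OF S(1) op_closed[OF UB f]]] by simp
    qed
  qed
  then have "S \<in> commutant X M" using S(1) unfolding commutant_iff by blast
  with S(2) show ?thesis by blast
qed

lemma von_neumann_algebra_double_commutant:
  assumes M: "M \<subseteq> bounded_operators X" "\<And>T. T \<in> M \<Longrightarrow> \<exists>S\<in>M. is_adjoint X T S"
  shows "von_neumann_algebra X (commutant X (commutant X M))"
  unfolding von_neumann_algebra_def
proof (intro conjI ballI)
  fix T assume T: "T \<in> commutant X (commutant X M)"
  show "\<exists>S\<in>commutant X (commutant X M). is_adjoint X T S"
    by (rule commutant_adjoint[OF commutant_bounded commutant_adjoint[OF M] T])
qed (use commutant_bounded triple_commutant[OF M(1)] in auto)

section \<open>Group von Neumann algebras in terms of matrix coefficients\<close>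

text \<open>With this convention \<open>ket y\<close> goes to
  \<open>ket (y \<otimes> inv g)\<close>, so \<open>right_regular G (inv y)\<close> carries the
  basis vector at the identity to \<open>ket y\<close>.\<close>

definition right_regular :: "('g, 'm) monoid_scheme \<Rightarrow> 'g \<Rightarrow> 'g operator" where
  "right_regular G g = (\<lambda>f\<in>ell2 (carrier G).
     \<lambda>x. if x \<in> carrier G then f (x \<otimes>\<^bsub>G\<^esub> g) else 0)"

lemma reindex_op_bounded:
  assumes "bij_betw \<pi> X X"
  shows "(\<lambda>f\<in>ell2 X. \<lambda>x. if x \<in> X then f (\<pi> x) else 0) \<in> bounded_operators X"
proof (rule bounded_operatorsI[where C = 1])
  fix f assume f: "f \<in> ell2 X"
  show "ell2_norm X ((\<lambda>f\<in>ell2 X. \<lambda>x. if x \<in> X then f (\<pi> x) else 0) f) \<le> 1 * ell2_norm X f"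
    using f ell2_norm_reindex[OF assms, of f]
    by (simp cong: ell2_norm_cong)
qed (auto simp: ell2_reindex[OF assms] ell2_add ell2_scale)

context group
begin

lemma inv_cancel_left:
  assumes "g \<in> carrier G" "x \<in> carrier G"
  shows "g \<otimes> (inv g \<otimes> x) = x" and "inv g \<otimes> (g \<otimes> x) = x"
  using assms by (simp_all add: m_assoc[symmetric])

section \<open>Translations of a group and the operators they induce\<close>

lemma bij_l_mult: "g \<in> carrier G \<Longrightarrow> bij_betw (\<lambda>x. g \<otimes> x) (carrier G) (carrier G)"
  by (rule bij_betwI[where g = "\<lambda>x. inv g \<otimes> x"]) (auto simp: m_assoc[symmetric])

lemma bij_r_mult: "g \<in> carrier G \<Longrightarrow> bij_betw (\<lambda>x. x \<otimes> g) (carrier G) (carrier G)"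
  by (rule bij_betwI[where g = "\<lambda>x. x \<otimes> inv g"]) (auto simp: m_assoc)

lemma bij_inv_l_mult: "g \<in> carrier G \<Longrightarrow> bij_betw (\<lambda>x. g \<otimes> inv x) (carrier G) (carrier G)"
  by (rule bij_betwI[where g = "\<lambda>x. inv x \<otimes> g"]) (auto simp: m_assoc inv_mult_group inv_cancel_left)

lemma bij_inv_r_mult: "g \<in> carrier G \<Longrightarrow> bij_betw (\<lambda>x. inv x \<otimes> g) (carrier G) (carrier G)"
  by (rule bij_betwI[where g = "\<lambda>x. g \<otimes> inv x"]) (auto simp: m_assoc inv_mult_group inv_cancel_left)

lemma left_regular_bounded: "g \<in> carrier G \<Longrightarrow> left_regular G g \<in> bounded_operators (carrier G)"
  unfolding left_regular_def by (intro reindex_op_bounded bij_l_mult) auto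

lemma right_regular_bounded: "g \<in> carrier G \<Longrightarrow> right_regular G g \<in> bounded_operators (carrier G)"
  unfolding right_regular_def by (intro reindex_op_bounded bij_r_mult) auto

lemma left_regular_apply:
  "f \<in> ell2 (carrier G) \<Longrightarrow> x \<in> carrier G \<Longrightarrow> left_regular G g f x = f (inv g \<otimes> x)"
  by (simp add: left_regular_def)

lemma right_regular_apply:
  "f \<in> ell2 (carrier G) \<Longrightarrow> x \<in> carrier G \<Longrightarrow> right_regular G g f x = f (x \<otimes> g)"
  by (simp add: right_regular_def)

lemma left_regular_ket:
  assumes "g \<in> carrier G" "y \<in> carrier G"
  shows "left_regular G g (ket y) = ket (g \<otimes> y)"
proof
  fix x
  have "inv g \<otimes> x = y \<longleftrightarrow> x = g \<otimes> y" if "x \<in> carrier G"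
    using that assms by (metis inv_solve_left)
  then show "left_regular G g (ket y) x = ket (g \<otimes> y) x"
    using assms by (simp add: left_regular_def) (auto simp: ket_def)
qed

lemma right_regular_ket:
  assumes "g \<in> carrier G" "y \<in> carrier G"
  shows "right_regular G g (ket y) = ket (y \<otimes> inv g)"
proof
  fix x
  have "x \<otimes> g = y \<longleftrightarrow> x = y \<otimes> inv g" if "x \<in> carrier G"
    using that assms by (metis inv_solve_right')
  then show "right_regular G g (ket y) x = ket (y \<otimes> inv g) x"
    using assms by (simp add: right_regular_def) (auto simp: ket_def)
qed

lemma left_regular_subset:
  "K \<subseteq> carrier G \<Longrightarrow> left_regular G ` K \<subseteq> bounded_operators (carrier G)"
  using left_regular_bounded by auto

lemma left_regular_adjoint:
  assumes "g \<in> carrier G"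
  shows "is_adjoint (carrier G) (left_regular G g) (left_regular G (inv g))"
proof (rule is_adjointI)
  fix x y assume xy: "x \<in> carrier G" "y \<in> carrier G"
  have "x = inv g \<otimes> y \<longleftrightarrow> y = g \<otimes> x" using assms xy by (metis inv_solve_left)
  then show "left_regular G (inv g) (ket y) x = cnj (left_regular G g (ket x) y)"
    using assms xy by (simp add: left_regular_ket) (auto simp: ket_def)
qed (use assms in \<open>auto intro: left_regular_bounded\<close>)

lemma von_neumann_algebra_subgroup_vN:
  assumes "subgroup K G"
  shows "von_neumann_algebra (carrier G) (subgroup_vN G K)"
  unfolding subgroup_vN_def
proof (rule von_neumann_algebra_double_commutant)
  show "left_regular G ` K \<subseteq> bounded_operators (carrier G)"
    by (rule left_regular_subset[OF subgroup.subset[OF assms]])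
  show "\<exists>S\<in>left_regular G ` K. is_adjoint (carrier G) T S" if "T \<in> left_regular G ` K" for T
    using that left_regular_adjoint subgroup.m_inv_closed[OF assms] subgroup.mem_carrier[OF assms] by blast
qed

lemma left_regular_in_subgroup_vN:
  assumes "K \<subseteq> carrier G" "g \<in> K"
  shows "left_regular G g \<in> subgroup_vN G K"
  using double_commutant_increasing[OF left_regular_subset[OF assms(1)]] assms(2)
  unfolding subgroup_vN_def by auto

lemma subgroup_vN_mono: "K \<subseteq> L \<Longrightarrow> subgroup_vN G K \<subseteq> subgroup_vN G L"
  unfolding subgroup_vN_def by (intro commutant_antimono image_mono)

lemma subgroup_vN_bounded: "subgroup_vN G K \<subseteq> bounded_operators (carrier G)"
  unfolding subgroup_vN_def by (rule commutant_bounded)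

lemma commutant_left_regular_coeff:
  assumes S: "S \<in> commutant (carrier G) (left_regular G ` K)" and s: "s \<in> K" "s \<in> carrier G"
    and xy: "x \<in> carrier G" "y \<in> carrier G"
  shows "S (ket (s \<otimes> y)) x = S (ket y) (inv s \<otimes> x)"
proof -
  have SB: "S \<in> bounded_operators (carrier G)" using S commutant_bounded by blast
  have "S (ket (s \<otimes> y)) = left_regular G s (S (ket y))"
    using commutantD[OF S imageI[OF s(1)], of "ket y"] xy s by (simp add: left_regular_ket)
  then show ?thesis
    using xy op_closed[OF SB] by (simp add: left_regular_apply)
qed

text \<open>Right translations commute with left ones, hence with the double commutant; moving
  \<open>ket \<one>\<close> to \<open>ket y\<close> by one of them shows that T is convolution by
  the vector \<open>T (ket \<one>)\<close>.\<close>

lemma subgroup_vN_coeff: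
  assumes T: "T \<in> subgroup_vN G K" and K: "K \<subseteq> carrier G"
    and xy: "x \<in> carrier G" "y \<in> carrier G"
  shows "T (ket y) x = T (ket \<one>) (x \<otimes> inv y)"
proof -
  have R: "right_regular G (inv y) \<in> commutant (carrier G) (left_regular G ` K)"
    unfolding commutant_iff
  proof (intro conjI ballI)
    fix U f assume U: "U \<in> left_regular G ` K" and f: "f \<in> ell2 (carrier G)"
    then obtain s where s: "s \<in> carrier G" "U = left_regular G s" using K by auto
    show "U (right_regular G (inv y) f) = right_regular G (inv y) (U f)"
      unfolding s(2) using f s(1) xy op_closed[OF left_regular_bounded[OF s(1)] f]
        op_closed[OF right_regular_bounded[of "inv y"] f]
      by (auto simp: left_regular_def right_regular_def m_assoc fun_eq_iff)
  qed (use xy in \<open>auto intro: right_regular_bounded\<close>)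
  have TB: "T \<in> bounded_operators (carrier G)" using T subgroup_vN_bounded by blast
  have "right_regular G (inv y) (T (ket \<one>)) = T (right_regular G (inv y) (ket \<one>))"
    using commutantD[OF T[unfolded subgroup_vN_def] R, of "ket \<one>"] by simp
  also have "right_regular G (inv y) (ket \<one>) = ket y"
    using xy by (simp add: right_regular_ket)
  finally have "T (ket y) = right_regular G (inv y) (T (ket \<one>))" ..
  then show ?thesis using xy op_closed[OF TB] by (simp add: right_regular_apply)
qed

text \<open>The projection onto the functions supported on K commutes with left translations by K,
  hence with T, and it fixes \<open>ket \<one>\<close>.\<close>

lemma subgroup_vN_support:
  assumes T: "T \<in> subgroup_vN G K" and K: "subgroup K G" and x: "x \<notin> K"
  shows "T (ket \<one>) x = 0"
proof -
  let ?X = "carrier G"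
  let ?p = "\<lambda>f\<in>ell2 ?X. trunc K f"
  interpret K: subgroup K G by fact
  have tr: "trunc K f \<in> ell2 ?X" "ell2_norm ?X (trunc K f) \<le> ell2_norm ?X f" if f: "f \<in> ell2 ?X" for f
  proof -
    have "L2_set (\<lambda>x. cmod (trunc K f x)) F \<le> ell2_norm ?X f" if "finite F" "F \<subseteq> ?X" for F
    proof -
      have "L2_set (\<lambda>x. cmod (trunc K f x)) F \<le> L2_set (\<lambda>x. cmod (f x)) F"
        by (rule L2_set_mono) (auto simp: trunc_def)
      then show ?thesis using L2_set_le_ell2_norm[OF ell2_summable[OF f] that] by linarith
    qed
    note * = square_summable_if_L2_set_bounded[of ?X, OF this]
    show "trunc K f \<in> ell2 ?X"
      using *(1) ell2_outside[OF f] by (auto simp: ell2_def trunc_def)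
    show "ell2_norm ?X (trunc K f) \<le> ell2_norm ?X f" by (rule *(2))
  qed
  have p: "?p \<in> commutant ?X (left_regular G ` K)"
    unfolding commutant_iff
  proof (intro conjI ballI)
    show "?p \<in> bounded_operators ?X"
      by (rule bounded_operatorsI[where C = 1])
        (auto simp: tr ell2_add ell2_scale, auto simp: trunc_def)
    fix U f assume U: "U \<in> left_regular G ` K" and f: "f \<in> ell2 ?X"
    then obtain s where s: "s \<in> K" "U = left_regular G s" by auto
    have sc: "s \<in> ?X" using s by auto
    have "inv s \<otimes> x \<in> K \<longleftrightarrow> x \<in> K" if "x \<in> ?X" for x
    proof
      assume "inv s \<otimes> x \<in> K"
      then have "s \<otimes> (inv s \<otimes> x) \<in> K" using s by blast
      then show "x \<in> K" using that sc by (simp add: m_assoc[symmetric])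
    qed (use s in auto)
    then show "U (?p f) = ?p (U f)"
      unfolding s(2) using f s(1) tr(1)[OF f] op_closed[OF left_regular_bounded[OF sc] f]
      by (auto simp: left_regular_def trunc_def fun_eq_iff)
  qed
  have TB: "T \<in> bounded_operators ?X" using T subgroup_vN_bounded by blast
  have "?p (T (ket \<one>)) = T (?p (ket \<one>))"
    using commutantD[OF T[unfolded subgroup_vN_def] p, of "ket \<one>"] by simp
  also have "?p (ket \<one>) = ket \<one>" by simp (auto simp: trunc_def ket_def)
  finally have "trunc K (T (ket \<one>)) = T (ket \<one>)"
    using op_closed[OF TB, of "ket \<one>"] by simp
  then show ?thesis using x by (metis trunc_def)
qed

text \<open>With the two preceding lemmas this identifies \<open>subgroup_vN G K\<close> with the
  bounded convolution operators whose symbol lives on K. Membership can then be checked on entries,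
  without approximating T by combinations of translations.\<close>

lemma subgroup_vNI:
  assumes K: "subgroup K G" and T: "T \<in> bounded_operators (carrier G)"
    and inv: "\<And>x y. x \<in> carrier G \<Longrightarrow> y \<in> carrier G \<Longrightarrow> T (ket y) x = T (ket \<one>) (x \<otimes> inv y)"
    and supp: "\<And>x. x \<in> carrier G \<Longrightarrow> x \<notin> K \<Longrightarrow> T (ket \<one>) x = 0"
  shows "T \<in> subgroup_vN G K"
  unfolding subgroup_vN_def commutant_iff[of T]
proof (intro conjI ballI)
  let ?X = "carrier G" and ?t = "T (ket \<one>)"
  fix S f assume S: "S \<in> commutant ?X (left_regular G ` K)" and f: "f \<in> ell2 ?X"
  have SB: "S \<in> bounded_operators ?X" using S commutant_bounded by blast
  have "op_comp ?X S T = op_comp ?X T S"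
  proof (rule op_eqI[OF op_comp_bounded[OF SB T] op_comp_bounded[OF T SB]])
    fix x y assume xy: "x \<in> ?X" "y \<in> ?X"
    have "op_comp ?X S T (ket y) x = (\<Sum>\<^sub>\<infinity>z\<in>?X. T (ket y) z * S (ket z) x)"
      using xy op_closed[OF T] by (simp add: op_comp_apply op_apply[OF SB])
    \<comment> \<open>Both products are expanded over the argument s of the symbol of T: the
      summation index z is \<open>s \<otimes> y\<close> in S T and \<open>inv s \<otimes> x\<close>
      in T S. For s in K the terms agree because S commutes with the translation by s; for other s
      the symbol is 0.\<close>
    also have "\<dots> = (\<Sum>\<^sub>\<infinity>s\<in>?X. T (ket y) (s \<otimes> y) * S (ket (s \<otimes> y)) x)"
      by (rule infsum_reindex_bij_betw[OF bij_r_mult[OF xy(2)], symmetric])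
    also have "\<dots> = (\<Sum>\<^sub>\<infinity>s\<in>?X. S (ket y) (inv s \<otimes> x) * T (ket (inv s \<otimes> x)) x)"
    proof (rule infsum_cong)
      fix s assume s: "s \<in> ?X"
      have 1: "T (ket y) (s \<otimes> y) = ?t s" using xy s by (subst inv) (simp_all add: m_assoc)
      have 2: "T (ket (inv s \<otimes> x)) x = ?t s"
        using xy s by (subst inv) (auto simp: inv_mult_group m_assoc[symmetric])
      show "T (ket y) (s \<otimes> y) * S (ket (s \<otimes> y)) x = S (ket y) (inv s \<otimes> x) * T (ket (inv s \<otimes> x)) x"
        unfolding 1 2 using commutant_left_regular_coeff[OF S _ s xy] supp[OF s] by (cases "s \<in> K") auto
    qed
    also have "\<dots> = (\<Sum>\<^sub>\<infinity>z\<in>?X. S (ket y) z * T (ket z) x)"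
      by (rule infsum_reindex_bij_betw[OF bij_inv_r_mult[OF xy(1)]])
    also have "\<dots> = op_comp ?X T S (ket y) x"
      using xy op_closed[OF SB] by (simp add: op_comp_apply op_apply[OF T])
    finally show "op_comp ?X S T (ket y) x = op_comp ?X T S (ket y) x" .
  qed
  then show "S (T f) = T (S f)" using f by (simp add: op_comp_eq_iff)
qed (rule T)

subsection \<open>Factors\<close>

text \<open>The vector \<open>T (ket \<one>)\<close> is constant on orbits of conjugation by D, so
  square-summability leaves only its value at the identity.\<close>

lemma relative_icc_imp_scalar:
  assumes T: "T \<in> group_vN G" and D: "D \<subseteq> carrier G"
    and comm: "T \<in> commutant (carrier G) (left_regular G ` D)"
    and icc: "\<And>x. x \<in> carrier G \<Longrightarrow> x \<noteq> \<one> \<Longrightarrow> infinite {d \<otimes> x \<otimes> inv d | d. d \<in> D}"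
  shows "\<exists>c. T = op_scale (carrier G) c (op_id (carrier G))"
proof -
  let ?X = "carrier G" and ?t = "T (ket \<one>)"
  have TB: "T \<in> bounded_operators ?X" using comm commutant_bounded by blast
  note coeff = subgroup_vN_coeff[OF T[unfolded group_vN_def] subset_refl]
  have orb: "?t (d \<otimes> x \<otimes> inv d) = ?t x" if "d \<in> D" "x \<in> ?X" for d x
  proof -
    have d: "d \<in> ?X" using that D by auto
    have "?t (d \<otimes> x \<otimes> inv d) = T (ket d) (d \<otimes> x)"
      using coeff[of "d \<otimes> x" d] d that by simp
    also have "\<dots> = ?t (inv d \<otimes> (d \<otimes> x))"
      using commutant_left_regular_coeff[OF comm that(1) d, of "d \<otimes> x" \<one>] d that by simp
    finally show ?thesis using d that by (simp add: m_assoc[symmetric])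
  qed
  have zero: "?t x = 0" if "x \<in> ?X" "x \<noteq> \<one>" for x
  proof (rule ell2_const_on_infinite[OF _ icc[OF that]])
    show "?t \<in> ell2 ?X" using op_closed[OF TB] by simp
    show "{d \<otimes> x \<otimes> inv d | d. d \<in> D} \<subseteq> ?X" using that D by auto
  qed (use orb that in auto)
  have "T = op_scale ?X (?t \<one>) (op_id ?X)"
  proof (rule op_eqI[OF TB op_scale_bounded[OF op_id_bounded]])
    fix x y assume xy: "x \<in> ?X" "y \<in> ?X"
    have "x \<otimes> inv y = \<one> \<longleftrightarrow> x = y" using xy by (metis inv_solve_right' l_one one_closed)
    then show "T (ket y) x = op_scale ?X (?t \<one>) (op_id ?X) (ket y) x"
      using xy coeff[OF xy] zero[of "x \<otimes> inv y"] by (simp add: op_scale_def op_id_def) (auto simp: ket_def)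
  qed
  then show ?thesis ..
qed

text \<open>The center lies in the relative commutant of \<open>subgroup_vN G K\<close> in
  \<open>group_vN G\<close>; infinite K-orbits on all of G make even that trivial.\<close>

lemma factor_subgroup_vN:
  assumes K: "subgroup K G"
    and icc: "\<And>x. x \<in> carrier G \<Longrightarrow> x \<noteq> \<one> \<Longrightarrow> infinite {d \<otimes> x \<otimes> inv d | d. d \<in> K}"
  shows "factor (carrier G) (subgroup_vN G K)"
  unfolding factor_def
proof (intro conjI von_neumann_algebra_subgroup_vN[OF K] equalityI subsetI)
  let ?X = "carrier G" and ?N = "subgroup_vN G K"
  have KG: "K \<subseteq> ?X" by (rule subgroup.subset[OF K])
  fix T
  {
    assume "T \<in> ?N \<inter> commutant ?X ?N"
    then have T: "T \<in> group_vN G" "T \<in> commutant ?X ?N"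
      using subgroup_vN_mono[OF KG] by (auto simp: group_vN_def)
    have "left_regular G ` K \<subseteq> ?N" using left_regular_in_subgroup_vN[OF KG] by auto
    then have "T \<in> commutant ?X (left_regular G ` K)" using T(2) commutant_antimono by blast
    from relative_icc_imp_scalar[OF T(1) KG this icc]
    show "T \<in> range (\<lambda>c. op_scale ?X c (op_id ?X))" by auto
  next
    assume "T \<in> range (\<lambda>c. op_scale ?X c (op_id ?X))"
    then obtain c where c: "T = op_scale ?X c (op_id ?X)" by auto
    have "T \<in> commutant ?X M" if "M \<subseteq> bounded_operators ?X" for M
      unfolding c by (intro commutant_scale op_id_commutant that)
    from this[OF subgroup_vN_bounded] this[OF commutant_bounded]
    show "T \<in> ?N \<inter> commutant ?X ?N"
      by (auto simp: subgroup_vN_def)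
  }
qed

end

section \<open>Maximality\<close>

text \<open>A sequence in \<open>{v \<in> V. v g = 1}\<close> of minimal norm in the limit converges, and by uniqueness of the
  limit it is invariant; being constant on infinite orbits, it is \<open>ket g\<close>.\<close>

lemma ell2_approx_ket:
  assumes V: "V \<subseteq> ell2 X"
    and add: "\<And>u v. u \<in> V \<Longrightarrow> v \<in> V \<Longrightarrow> (\<lambda>x. u x + v x) \<in> V"
    and scale: "\<And>c v. v \<in> V \<Longrightarrow> (\<lambda>x. c * v x) \<in> V"
    and perm: "\<And>\<pi>. \<pi> \<in> Q \<Longrightarrow> bij_betw \<pi> X X" "\<And>\<pi>. \<pi> \<in> Q \<Longrightarrow> \<pi> g = g"
    and inv: "\<And>\<pi> v. \<pi> \<in> Q \<Longrightarrow> v \<in> V \<Longrightarrow> (\<lambda>x. if x \<in> X then v (\<pi> x) else 0) \<in> V"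
    and orbit: "\<And>x. x \<in> X \<Longrightarrow> x \<noteq> g \<Longrightarrow> infinite {\<pi> x | \<pi>. \<pi> \<in> Q}"
    and g: "g \<in> X" and w: "w \<in> V" "w g \<noteq> 0" and \<epsilon>: "0 < \<epsilon>"
  shows "\<exists>v\<in>V. ell2_norm X (\<lambda>x. v x - ket g x) < \<epsilon>"
proof -
  \<comment> \<open>The constraint at g survives the permutations, which fix g, and it keeps the
    limit away from 0. V is not assumed closed, so the infimum d is only approached.\<close>
  define C where "C = {v \<in> V. v g = 1}"
  define N where "N v = (ell2_norm X v)\<^sup>2" for v
  define d where "d = Inf (N ` C)"
  define r where "r n = inverse (real (Suc n))" for n
  have r: "0 < r n" for n by (simp add: r_def)
  have r_le: "r m \<le> r n" if "n \<le> m" for n m using that by (simp add: r_def field_simps)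
  have CV: "v \<in> ell2 X" if "v \<in> C" for v using that V by (auto simp: C_def)
  have "(\<lambda>x. inverse (w g) * w x) \<in> C" using scale[OF w(1)] w(2) by (simp add: C_def)
  then have ne: "N ` C \<noteq> {}" by blast
  have bb: "bdd_below (N ` C)" by (rule bdd_belowI[of _ 0]) (auto simp: N_def)
  have dN: "d \<le> N v" if "v \<in> C" for v
    unfolding d_def by (rule cInf_lower[OF _ bb]) (use that in auto)
  \<comment> \<open>The midpoint of u and v is again in C, so the parallelogram law bounds their
    distance by the excess of their squared norms over the infimum.\<close>
  have close: "N (\<lambda>x. u x - v x) \<le> 2 * (N u - d) + 2 * (N v - d)" if "u \<in> C" "v \<in> C" for u v
  proof -
    have half: "(\<lambda>x. (1 / 2) * (u x + v x)) \<in> C"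
      using scale[OF add, of u v "1/2"] that by (simp add: C_def)
    have "N (\<lambda>x. u x + v x) = 4 * N (\<lambda>x. (1 / 2) * (u x + v x))"
      unfolding N_def ell2_norm_scale by (simp add: power_mult_distrib power_divide)
    then have "4 * d \<le> N (\<lambda>x. u x + v x)" using dN[OF half] by simp
    then show ?thesis using ell2_parallelogram[OF CV[OF that(1)] CV[OF that(2)]] by (simp add: N_def)
  qed
  have "\<exists>v\<in>C. N v < d + r n" for n
  proof -
    have "\<exists>y\<in>N ` C. y < d + r n"
      using cInf_lessD[OF ne, of "d + r n"] r[of n] by (auto simp: d_def)
    then show ?thesis by auto
  qed
  then obtain v where v: "\<And>n. v n \<in> C" "\<And>n. N (v n) < d + r n" by metis
  have diffC: "(\<lambda>x. v n x - v m x) \<in> ell2 X" for n m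
    using ell2_diff CV v by blast
  \<comment> \<open>Each of the two excesses is below \<open>r n\<close>, and \<open>close\<close>
    doubles both: hence the 4.\<close>
  have cl: "N (\<lambda>x. v n x - v m x) \<le> 4 * r n" if "n \<le> m" for n m
  proof -
    show ?thesis using r_le[OF that] close[OF v(1) v(1), of n m] v(2)[of n] v(2)[of m] by (simp add: algebra_simps)
  qed
  have sq: "cmod (f x) \<le> 2 * sqrt (r n)"
    if "f \<in> ell2 X" "N f \<le> 4 * r n" for f x n
  proof -
    have "(cmod (f x))\<^sup>2 \<le> N f"
      unfolding N_def by (rule power_mono[OF ell2_coord_le[OF that(1)]]) simp
    then have "cmod (f x) \<le> sqrt (4 * r n)" using that(2) by (intro real_le_rsqrt) linarith
    then show ?thesis by (simp add: real_sqrt_mult)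
  qed
  have lim0: "(\<lambda>n. 2 * sqrt (r n)) \<longlonglongrightarrow> 0"
    unfolding r_def
    using tendsto_mult[OF tendsto_const tendsto_real_sqrt[OF LIMSEQ_inverse_real_of_nat], of 2] by simp
  have conv: "convergent (\<lambda>n. v n x)" for x
  proof (rule Cauchy_convergent, rule metric_CauchyI)
    fix e :: real assume "0 < e"
    then have "\<forall>\<^sub>F n in sequentially. 2 * sqrt (r n) < e / 2"
      using order_tendstoD(2)[OF lim0, of "e / 2"] by simp
    then obtain M where M: "2 * sqrt (r M) < e / 2"
      by (auto simp: eventually_sequentially)
    have "dist (v M x) (v m x) < e / 2" if "m \<ge> M" for m
      using sq[OF diffC cl[OF that], of x] M by (simp add: dist_norm)
    then have "\<forall>m\<ge>M. \<forall>n\<ge>M. dist (v m x) (v n x) < e"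
      using dist_triangle_half_r by blast
    then show "\<exists>M. \<forall>m\<ge>M. \<forall>n\<ge>M. dist (v m x) (v n x) < e" ..
  qed
  define \<xi> where "\<xi> x = lim (\<lambda>n. v n x)" for x
  have lim: "(\<lambda>n. v n x) \<longlonglongrightarrow> \<xi> x" for x
    using conv[of x] by (simp add: \<xi>_def convergent_LIMSEQ_iff)
  have bound: "L2_set (\<lambda>x. cmod (v n x - \<xi> x)) F \<le> 2 * sqrt (r n)"
    if F: "finite F" "F \<subseteq> X" for F n
  proof (rule LIMSEQ_le_const2)
    show "(\<lambda>m. L2_set (\<lambda>x. cmod (v n x - v m x)) F) \<longlonglongrightarrow> L2_set (\<lambda>x. cmod (v n x - \<xi> x)) F"
      unfolding L2_set_def by (intro tendsto_intros lim)
    have "L2_set (\<lambda>x. cmod (v n x - v m x)) F \<le> 2 * sqrt (r n)" if "m \<ge> n" for m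
    proof -
      have "L2_set (\<lambda>x. cmod (v n x - v m x)) F \<le> ell2_norm X (\<lambda>x. v n x - v m x)"
        by (rule L2_set_le_ell2_norm[OF ell2_summable[OF diffC] F])
      also have "\<dots> = sqrt (N (\<lambda>x. v n x - v m x))" by (simp add: N_def)
      also have "\<dots> \<le> sqrt (4 * r n)" by (rule real_sqrt_le_mono[OF cl[OF that]])
      finally show ?thesis by (simp add: real_sqrt_mult)
    qed
    then show "\<exists>N. \<forall>m\<ge>N. L2_set (\<lambda>x. cmod (v n x - v m x)) F \<le> 2 * sqrt (r n)"
      by blast
  qed
  note near = square_summable_if_L2_set_bounded[of X, OF bound]
  have "\<xi> x = 0" if "x \<notin> X" for x
    using lim[of x] ell2_outside[OF CV[OF v(1)] that] by (simp add: LIMSEQ_const_iff)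
  then have "(\<lambda>x. v 0 x - \<xi> x) \<in> ell2 X"
    using near(1)[of 0] ell2_outside[OF CV[OF v(1)]] by (auto simp: ell2_def)
  from ell2_diff[OF CV[OF v(1)[of 0]] this] have \<xi>: "\<xi> \<in> ell2 X" by simp
  have \<xi>g: "\<xi> g = 1"
    using lim[of g] v(1) by (simp add: C_def LIMSEQ_const_iff)
  \<comment> \<open>The permuted sequence lies in C with the same norms, so it is minimizing as well
    and stays coordinatewise within \<open>2 * sqrt (r n)\<close> of the original one.\<close>
  have \<xi>inv: "\<xi> (\<pi> x) = \<xi> x" if \<pi>: "\<pi> \<in> Q" and x: "x \<in> X" for \<pi> x
  proof -
    let ?u = "\<lambda>n x. if x \<in> X then v n (\<pi> x) else 0"
    have uC: "?u n \<in> C" for n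
      using inv[OF \<pi>] v(1)[of n] perm(2)[OF \<pi>] g by (simp add: C_def)
    have "N (?u n) = N (v n)" for n
      using ell2_norm_reindex[OF perm(1)[OF \<pi>], of "v n"] by (simp add: N_def cong: ell2_norm_cong)
    then have "N (\<lambda>x. ?u n x - v n x) \<le> 4 * r n" for n
      using close[OF uC v(1), of n n] v(2)[of n] by simp
    from sq[OF ell2_diff[OF CV[OF uC] CV[OF v(1)]] this]
    have "cmod (?u n x - v n x) \<le> 2 * sqrt (r n)" for n .
    then have "cmod (v n (\<pi> x) - v n x) \<le> 2 * sqrt (r n)" for n
      using x by simp
    then have "(\<lambda>n. v n (\<pi> x) - v n x) \<longlonglongrightarrow> 0"
      by (intro Lim_null_comparison[OF _ lim0]) auto
    moreover have "(\<lambda>n. v n (\<pi> x) - v n x) \<longlonglongrightarrow> \<xi> (\<pi> x) - \<xi> x"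
      by (intro tendsto_intros lim)
    ultimately show ?thesis using LIMSEQ_unique by fastforce
  qed
  have "\<xi> x = ket g x" for x
  proof (cases "x \<in> X \<and> x \<noteq> g")
    case True
    have "\<xi> x = 0"
    proof (rule ell2_const_on_infinite[OF \<xi> orbit])
      show "{\<pi> x | \<pi>. \<pi> \<in> Q} \<subseteq> X" using perm(1) True bij_betwE by blast
      show "\<xi> y = \<xi> x" if "y \<in> {\<pi> x | \<pi>. \<pi> \<in> Q}" for y using that \<xi>inv True by auto
    qed (use True in auto)
    then show ?thesis using True by (simp add: ket_def)
  next
    case False
    then have "x = g \<or> x \<noteq> g \<and> \<xi> x = 0" using ell2_outside[OF \<xi>, of x] by blast
    then show ?thesis using \<xi>g by (auto simp: ket_def)
  qed
  then have \<xi>k: "\<xi> = ket g" by auto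
  have "\<forall>\<^sub>F n in sequentially. 2 * sqrt (r n) < \<epsilon>"
    by (rule order_tendstoD(2)[OF lim0 \<epsilon>])
  then obtain n where n: "2 * sqrt (r n) < \<epsilon>"
    by (auto simp: eventually_sequentially)
  have "ell2_norm X (\<lambda>x. v n x - ket g x) < \<epsilon>" using near(2)[of n] n \<xi>k by simp
  then show ?thesis using v(1)[of n] by (auto simp: C_def)
qed

context group
begin

text \<open>The approximants need not be bounded in operator norm: to commute with \<open>S\<close> it is enough to control
  the rows and columns of \<open>U - T\<close>, which all have the norm of its first column.\<close>

lemma in_von_neumann_subalgebra_if_approx:
  assumes P: "von_neumann_algebra (carrier G) P" "P \<subseteq> group_vN G"
    and T: "T \<in> group_vN G"
    and approx: "\<And>\<epsilon>. 0 < \<epsilon> \<Longrightarrow>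
      \<exists>U\<in>P. ell2_norm (carrier G) (\<lambda>x. U (ket \<one>) x - T (ket \<one>) x) < \<epsilon>"
  shows "T \<in> P"
proof -
  let ?X = "carrier G"
  have TB: "T \<in> bounded_operators ?X" using T subgroup_vN_bounded unfolding group_vN_def by blast
  have "T \<in> commutant ?X (commutant ?X P)"
    unfolding commutant_iff[of T]
  proof (intro conjI ballI TB)
    fix S f assume S: "S \<in> commutant ?X P" and f: "f \<in> ell2 ?X"
    have SB: "S \<in> bounded_operators ?X" using S commutant_bounded by blast
    obtain C where C: "0 \<le> C" "\<And>f. f \<in> ell2 ?X \<Longrightarrow> ell2_norm ?X (S f) \<le> C * ell2_norm ?X f"
      using bounded_operatorE[OF SB] by blast
    have "op_comp ?X S T = op_comp ?X T S"
    proof (rule op_eqI[OF op_comp_bounded[OF SB TB] op_comp_bounded[OF TB SB]])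
      fix x y assume xy: "x \<in> ?X" "y \<in> ?X"
      have "cmod (S (T (ket y)) x - T (S (ket y)) x) \<le> e" if e: "0 < e" for e
      proof -
        \<comment> \<open>Two error terms, each at most C times the norm of the first column of D,
          must add up to at most e; the summand 1 keeps the divisor positive when C = 0.\<close>
        have "0 < e / (2 * C + 1)" using e C(1) by simp
        then obtain U where U: "U \<in> P"
          and Ue: "ell2_norm ?X (\<lambda>x. U (ket \<one>) x - T (ket \<one>) x) < e / (2 * C + 1)"
          using approx by blast
        have UB: "U \<in> bounded_operators ?X" using U P by (auto simp: von_neumann_algebra_def)
        define D where "D = op_add ?X U (op_scale ?X (- 1) T)"
        have DB: "D \<in> bounded_operators ?X"
          unfolding D_def by (intro op_add_bounded op_scale_bounded UB TB)
        have D: "D h = (\<lambda>x. U h x - T h x)" if "h \<in> ell2 ?X" for h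
          using that op_closed[OF TB that] by (simp add: D_def op_add_def op_scale_def)
        let ?d = "D (ket \<one>)"
        have dn: "ell2_norm ?X ?d < e / (2 * C + 1)" using Ue by (simp add: D)
        have coeff: "D (ket z) x = ?d (x \<otimes> inv z)" if "x \<in> ?X" "z \<in> ?X" for x z
          using subgroup_vN_coeff[OF T[unfolded group_vN_def] subset_refl that]
            subgroup_vN_coeff[OF subsetD[OF P(2) U, unfolded group_vN_def] subset_refl that] that
          by (simp add: D)
        have col: "ell2_norm ?X (D (ket y)) = ell2_norm ?X ?d"
        proof -
          have "ell2_norm ?X (D (ket y)) = ell2_norm ?X (\<lambda>x. ?d (x \<otimes> inv y))"
            by (rule ell2_norm_cong) (rule coeff[OF _ xy(2)])
          then show ?thesis
            using ell2_norm_reindex[OF bij_r_mult[of "inv y"], of ?d] xy by simp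
        qed
        \<comment> \<open>Entries depend only on \<open>x \<otimes> inv z\<close>, and for fixed x
          this is a bijection in z. So rows, like columns, are rearrangements of the first
          column.\<close>
        have row: "ell2_norm ?X (\<lambda>z. D (ket z) x) = ell2_norm ?X ?d"
        proof -
          have "ell2_norm ?X (\<lambda>z. D (ket z) x) = ell2_norm ?X (\<lambda>z. ?d (x \<otimes> inv z))"
            by (rule ell2_norm_cong) (rule coeff[OF xy(1)])
          then show ?thesis
            using ell2_norm_reindex[OF bij_inv_l_mult[of x], of ?d] xy by simp
        qed
        have Sy: "S (ket y) \<in> ell2 ?X" using op_closed[OF SB] xy by simp
        have "cmod (S (D (ket y)) x) \<le> C * ell2_norm ?X ?d"
          using ell2_coord_le[OF op_closed[OF SB op_closed[OF DB]], of "ket y" x]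
            C(2)[OF op_closed[OF DB], of "ket y"] xy col by simp
        moreover have "cmod (D (S (ket y)) x) \<le> ell2_norm ?X (S (ket y)) * ell2_norm ?X ?d"
          unfolding op_apply[OF DB Sy] row[symmetric]
          by (rule infsum_mult_summable(2)[OF ell2_summable[OF Sy] op_row[OF DB]])
        moreover have "ell2_norm ?X (S (ket y)) * ell2_norm ?X ?d \<le> C * ell2_norm ?X ?d"
          using C(2)[of "ket y"] xy by (intro mult_right_mono) (auto simp: ell2_norm_ket)
        moreover have "S (T (ket y)) x - T (S (ket y)) x = D (S (ket y)) x - S (D (ket y)) x"
        proof -
          have "S (U (ket y)) = U (S (ket y))"
            using commutantD[OF S U, of "ket y"] xy by simp
          moreover have "S (D (ket y)) = (\<lambda>x. S (U (ket y)) x - S (T (ket y)) x)"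
            using xy op_closed[OF UB] op_closed[OF TB] by (simp add: D op_diff_arg[OF SB])
          ultimately show ?thesis by (simp add: D[OF Sy])
        qed
        moreover have "cmod (D (S (ket y)) x - S (D (ket y)) x)
            \<le> cmod (D (S (ket y)) x) + cmod (S (D (ket y)) x)" by (rule norm_triangle_ineq4)
        ultimately have "cmod (S (T (ket y)) x - T (S (ket y)) x) \<le> 2 * C * ell2_norm ?X ?d"
          by simp
        also have "\<dots> \<le> 2 * C * (e / (2 * C + 1))"
          using dn C(1) by (intro mult_left_mono) auto
        also have "\<dots> \<le> e" using C(1) e by (simp add: field_simps)
        finally show ?thesis .
      qed
      then have "cmod (S (T (ket y)) x - T (S (ket y)) x) \<le> 0" by (rule field_le_epsilon) simp
      then show "op_comp ?X S T (ket y) x = op_comp ?X T S (ket y) x"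
        using xy by (simp add: op_comp_apply)
    qed
    then show "S (T f) = T (S f)" using f by (simp add: op_comp_eq_iff)
  qed
  then show ?thesis using P(1) by (simp add: von_neumann_algebra_def)
qed

text \<open>The elements d in \<open>icc\<close> are those for which left translation by d and right
  translation by its conjugate under g both come from K: they preserve the vectors of an
  intermediate algebra and leave the coordinate g in place.\<close>

lemma maximal_subgroup_vN:
  assumes K: "subgroup K G"
    and double_coset: "\<And>g x. g \<in> carrier G - K \<Longrightarrow> x \<in> carrier G - K \<Longrightarrow> \<exists>s\<in>K. \<exists>t\<in>K. x = s \<otimes> g \<otimes> t"
    and icc: "\<And>g x. g \<in> carrier G - K \<Longrightarrow> x \<in> carrier G \<Longrightarrow> x \<noteq> \<one> \<Longrightarrow>
      infinite {d \<otimes> x \<otimes> inv d | d. d \<in> K \<and> inv g \<otimes> d \<otimes> g \<in> K}"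
  shows "maximal_vN_subalgebra (carrier G) (subgroup_vN G K) (group_vN G)"
  unfolding maximal_vN_subalgebra_def
proof (intro conjI allI impI)
  let ?X = "carrier G" and ?N = "subgroup_vN G K"
  interpret K: subgroup K G by fact
  show "von_neumann_algebra ?X ?N" by (rule von_neumann_algebra_subgroup_vN[OF K])
  show "von_neumann_algebra ?X (group_vN G)"
    unfolding group_vN_def by (rule von_neumann_algebra_subgroup_vN[OF subgroup_self])
  show "?N \<subseteq> group_vN G" unfolding group_vN_def by (rule subgroup_vN_mono[OF K.subset])
  fix P assume "von_neumann_algebra ?X P \<and> ?N \<subseteq> P \<and> P \<subseteq> group_vN G"
  then have P: "von_neumann_algebra ?X P" and NP: "?N \<subseteq> P" and PM: "P \<subseteq> group_vN G" by auto
  have PB: "P \<subseteq> bounded_operators ?X" and PP: "commutant ?X (commutant ?X P) = P"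
    using P by (auto simp: von_neumann_algebra_def)
  have Pcomp: "op_comp ?X S T \<in> P" and Padd: "op_add ?X S T \<in> P" if "S \<in> P" "T \<in> P" for S T
    using commutant_comp[OF commutant_bounded, of S ?X _ T]
      commutant_add[OF commutant_bounded, of S ?X _ T] that PP by blast+
  have Pscale: "op_scale ?X c T \<in> P" if "T \<in> P" for T c
    using commutant_scale[OF commutant_bounded, of T ?X _ c] that PP by blast
  have KP: "left_regular G s \<in> P" if "s \<in> K" for s
    using left_regular_in_subgroup_vN[OF K.subset that] NP by blast
  have coeff: "T (ket y) x = T (ket \<one>) (x \<otimes> inv y)" if "T \<in> P" "x \<in> ?X" "y \<in> ?X" for T x y
    using subgroup_vN_coeff[OF subsetD[OF PM that(1), unfolded group_vN_def]] that by blast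
  show "P = ?N \<or> P = group_vN G"
  proof (cases "\<exists>T\<in>P. \<exists>g\<in>?X - K. T (ket \<one>) g \<noteq> 0")
    case False
    have "P \<subseteq> ?N"
    proof
      fix T assume "T \<in> P"
      then show "T \<in> ?N"
        using False PB by (intro subgroup_vNI[OF K] coeff) auto
    qed
    then show ?thesis using NP by blast
  next
    case True
    then obtain T g where T: "T \<in> P" and g: "g \<in> ?X" "g \<notin> K" and Tg: "T (ket \<one>) g \<noteq> 0" by auto
    define D where "D = {d \<in> K. inv g \<otimes> d \<otimes> g \<in> K}"
    have DK: "d \<in> ?X" if "d \<in> D" for d using that by (auto simp: D_def)
    \<comment> \<open>Two-sided translation by \<open>inv d\<close> and by the conjugate of d; at g
      the two cancel, which makes g a fixed point.\<close>
    define \<pi> where "\<pi> d = (\<lambda>x. inv d \<otimes> x \<otimes> (inv g \<otimes> d \<otimes> g))" for d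
    define V where "V = (\<lambda>T. T (ket \<one>)) ` P"
    have "left_regular G g \<in> P"
    proof (rule in_von_neumann_subalgebra_if_approx[OF P PM])
      show "left_regular G g \<in> group_vN G"
        unfolding group_vN_def by (rule left_regular_in_subgroup_vN[OF _ g(1)]) simp
      fix \<epsilon> :: real assume \<epsilon>: "0 < \<epsilon>"
      have "\<exists>v\<in>V. ell2_norm ?X (\<lambda>x. v x - ket g x) < \<epsilon>"
      proof (rule ell2_approx_ket[where Q = "\<pi> ` D" and w = "T (ket \<one>)"])
        show "V \<subseteq> ell2 ?X" using PB op_closed by (fastforce simp: V_def)
        show "(\<lambda>x. u x + v x) \<in> V" if uv: "u \<in> V" "v \<in> V" for u v
        proof -
          obtain S U where SU: "S \<in> P" "U \<in> P" "u = S (ket \<one>)" "v = U (ket \<one>)"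
            using uv by (auto simp: V_def)
          show ?thesis
            unfolding V_def by (rule image_eqI[OF _ Padd[OF SU(1,2)]]) (simp add: op_add_def SU)
        qed
        show "(\<lambda>x. c * v x) \<in> V" if v: "v \<in> V" for c v
        proof -
          obtain U where U: "U \<in> P" "v = U (ket \<one>)" using v by (auto simp: V_def)
          show ?thesis
            unfolding V_def by (rule image_eqI[OF _ Pscale[OF U(1)]]) (simp add: op_scale_def U)
        qed
        show "bij_betw p ?X ?X" if p: "p \<in> \<pi> ` D" for p
        proof -
          obtain d where d: "d \<in> ?X" "p = \<pi> d" using p DK by auto
          have "bij_betw ((\<lambda>x. x \<otimes> (inv g \<otimes> d \<otimes> g)) \<circ> (\<lambda>x. inv d \<otimes> x)) ?X ?X"
            by (rule bij_betw_trans[OF bij_l_mult bij_r_mult]) (use d g in auto)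
          then show ?thesis by (simp add: d \<pi>_def o_def)
        qed
        show "p g = g" if p: "p \<in> \<pi> ` D" for p
        proof -
          obtain d where d: "d \<in> ?X" "p = \<pi> d" using p DK by auto
          have "inv d \<otimes> g \<otimes> (inv g \<otimes> d \<otimes> g) = inv d \<otimes> (g \<otimes> inv g) \<otimes> d \<otimes> g"
            using d g by (simp only: m_assoc m_closed inv_closed)
          then show ?thesis using d g by (simp add: \<pi>_def)
        qed
        show "(\<lambda>x. if x \<in> ?X then v (p x) else 0) \<in> V" if p: "p \<in> \<pi> ` D" and v: "v \<in> V" for p v
        proof -
          obtain d where d: "d \<in> D" "p = \<pi> d" using p by auto
          then have dX: "d \<in> ?X" using DK by auto
          obtain U where U: "U \<in> P" "v = U (ket \<one>)" using v by (auto simp: V_def)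
          let ?s = "inv g \<otimes> d \<otimes> g"
          have s: "?s \<in> K" "?s \<in> ?X" using d by (auto simp: D_def)
          \<comment> \<open>Precomposition with \<open>\<pi> d\<close> is realised inside P by
            multiplying U with translations from K on both sides. The inverse of \<open>?s\<close>
            appears because \<open>coeff\<close> turns the column at \<open>inv ?s\<close> into
            right multiplication by \<open>?s\<close>.\<close>
          let ?W = "op_comp ?X (left_regular G d) (op_comp ?X U (left_regular G (inv ?s)))"
          have W: "?W \<in> P"
            using d s by (intro Pcomp KP U) (auto simp: D_def)
          have Us: "U (ket (inv ?s)) \<in> ell2 ?X" using op_closed[of U ?X] U PB s by auto
          have "?W (ket \<one>) = (\<lambda>x. if x \<in> ?X then v (p x) else 0)"
          proof
            fix x
            show "?W (ket \<one>) x = (if x \<in> ?X then v (p x) else 0)"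
            proof (cases "x \<in> ?X")
              case True
              then have "?W (ket \<one>) x = U (ket (inv ?s)) (inv d \<otimes> x)"
                using s dX Us by (simp add: op_comp_apply left_regular_ket left_regular_apply)
              also have "\<dots> = v (p x)"
                using coeff[OF U(1), of "inv d \<otimes> x" "inv ?s"] True s dX by (simp add: U d \<pi>_def)
              finally show ?thesis using True by simp
            next
              case False
              then show ?thesis using ell2_outside[OF op_closed[of ?W ?X "ket \<one>"]] W PB by auto
            qed
          qed
          then show ?thesis unfolding V_def by (intro image_eqI[OF _ W]) simp
        qed
        show "infinite {p x | p. p \<in> \<pi> ` D}" if x: "x \<in> ?X" "x \<noteq> g" for x
        proof
          assume fin: "finite {p x | p. p \<in> \<pi> ` D}"
          \<comment> \<open>Right multiplication by \<open>inv g\<close> turns the orbit of x into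
            conjugates: \<open>\<pi> (inv d) x \<otimes> inv g\<close> equals
            \<open>d \<otimes> ?y \<otimes> inv d\<close>. A finite orbit would thus contradict
            \<open>icc\<close>.\<close>
          let ?y = "x \<otimes> inv g"
          have y: "?y \<in> ?X" "?y \<noteq> \<one>" using x g by (auto simp: inv_solve_right')
          have "{d \<otimes> ?y \<otimes> inv d | d. d \<in> K \<and> inv g \<otimes> d \<otimes> g \<in> K}
              \<subseteq> (\<lambda>z. z \<otimes> inv g) ` {p x | p. p \<in> \<pi> ` D}"
          proof
            fix z assume "z \<in> {d \<otimes> ?y \<otimes> inv d | d. d \<in> K \<and> inv g \<otimes> d \<otimes> g \<in> K}"
            then obtain d where d: "d \<in> D" "z = d \<otimes> ?y \<otimes> inv d" by (auto simp: D_def)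
            then have dX: "d \<in> ?X" using DK by auto
            have "inv g \<otimes> inv d \<otimes> g = inv (inv g \<otimes> d \<otimes> g)"
              using dX g by (simp add: inv_mult_group m_assoc)
            then have "inv d \<in> D" using d by (auto simp: D_def)
            moreover have "z = \<pi> (inv d) x \<otimes> inv g"
              using d dX g x by (simp add: \<pi>_def m_assoc)
            ultimately show "z \<in> (\<lambda>z. z \<otimes> inv g) ` {p x | p. p \<in> \<pi> ` D}" by blast
          qed
          then have "finite {d \<otimes> ?y \<otimes> inv d | d. d \<in> K \<and> inv g \<otimes> d \<otimes> g \<in> K}"
            using fin finite_surj by blast
          then show False using icc[of g ?y] g y by auto
        qed
      qed (use g T Tg \<epsilon> in \<open>auto simp: V_def\<close>)
      then show "\<exists>U\<in>P. ell2_norm ?X (\<lambda>x. U (ket \<one>) x - left_regular G g (ket \<one>) x) < \<epsilon>"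
        using g by (auto simp: V_def left_regular_ket)
    qed
    have all: "left_regular G x \<in> P" if x: "x \<in> ?X" for x
    proof (cases "x \<in> K")
      case False
      then obtain s t where st: "s \<in> K" "t \<in> K" "x = s \<otimes> g \<otimes> t" using double_coset[of g x] g x by auto
      have st': "s \<in> ?X" "t \<in> ?X" using st by auto
      have "op_comp ?X (left_regular G s) (op_comp ?X (left_regular G g) (left_regular G t)) = left_regular G x"
      proof (rule op_eqI)
        show "op_comp ?X (left_regular G s) (op_comp ?X (left_regular G g) (left_regular G t))
            \<in> bounded_operators ?X"
          using st' g by (intro op_comp_bounded left_regular_bounded)
        show "left_regular G x \<in> bounded_operators ?X" using x by (rule left_regular_bounded)
        fix u y assume "u \<in> ?X" "y \<in> ?X"
        then show "op_comp ?X (left_regular G s) (op_comp ?X (left_regular G g) (left_regular G t)) (ket y) u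
            = left_regular G x (ket y) u"
          using st' g by (simp add: op_comp_apply left_regular_ket st(3) m_assoc)
      qed
      moreover have "op_comp ?X (left_regular G s) (op_comp ?X (left_regular G g) (left_regular G t)) \<in> P"
        by (intro Pcomp KP st \<open>left_regular G g \<in> P\<close>)
      ultimately show ?thesis by simp
    qed (rule KP)
    then have "left_regular G ` ?X \<subseteq> P" by auto
    then have "group_vN G \<subseteq> P"
      unfolding group_vN_def subgroup_vN_def by (metis PP commutant_antimono)
    then show ?thesis using PM by blast
  qed
qed

end

section \<open>Means\<close>

text \<open>A finitely additive probability on Y, kept apart from any group law so that it applies
  to subgroups and can be iterated.\<close>

definition mean_on :: "'x set \<Rightarrow> (('x \<Rightarrow> real) \<Rightarrow> real) \<Rightarrow> bool" where
  "mean_on Y m \<longleftrightarrow>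
     (\<forall>f f'. bounded (f ` Y) \<longrightarrow> bounded (f' ` Y) \<longrightarrow> m (\<lambda>x. f x + f' x) = m f + m f') \<and>
     (\<forall>c f. bounded (f ` Y) \<longrightarrow> m (\<lambda>x. c * f x) = c * m f) \<and>
     (\<forall>f. bounded (f ` Y) \<longrightarrow> (\<forall>x\<in>Y. 0 \<le> f x) \<longrightarrow> 0 \<le> m f) \<and>
     m (\<lambda>x. 1) = 1"

lemma invariant_mean_iff:
  "invariant_mean G m \<longleftrightarrow> mean_on (carrier G) m \<and>
     (\<forall>g\<in>carrier G. \<forall>f. bounded (f ` carrier G) \<longrightarrow> m (\<lambda>x. f (g \<otimes>\<^bsub>G\<^esub> x)) = m f)"
  unfolding invariant_mean_def mean_on_def bounded_functions_def by blast

lemma bounded_image_real: "(\<And>x. x \<in> Y \<Longrightarrow> \<bar>f x\<bar> \<le> (C::real)) \<Longrightarrow> bounded (f ` Y)"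
  by (auto intro!: boundedI)

lemma bounded_image_add:
  fixes f g :: "'x \<Rightarrow> real"
  assumes "bounded (f ` Y)" "bounded (g ` Y)" shows "bounded ((\<lambda>x. f x + g x) ` Y)"
proof -
  obtain B C where "\<And>x. x \<in> Y \<Longrightarrow> \<bar>f x\<bar> \<le> B" "\<And>x. x \<in> Y \<Longrightarrow> \<bar>g x\<bar> \<le> C"
    using assms unfolding bounded_iff by auto
  then show ?thesis by (intro bounded_image_real[of _ _ "B + C"]) fastforce
qed

lemma bounded_image_scale:
  fixes f :: "'x \<Rightarrow> real"
  assumes "bounded (f ` Y)" shows "bounded ((\<lambda>x. c * f x) ` Y)"
proof -
  obtain B where "\<And>x. x \<in> Y \<Longrightarrow> \<bar>f x\<bar> \<le> B" using assms unfolding bounded_iff by auto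
  then show ?thesis
    by (intro bounded_image_real[of _ _ "\<bar>c\<bar> * B"]) (auto simp: abs_mult intro: mult_left_mono)
qed

lemma bounded_image_const [simp]: "bounded ((\<lambda>x. c::real) ` Y)"
  by (rule bounded_image_real[of _ _ "\<bar>c\<bar>"]) simp

context
  fixes Y :: "'x set" and m
  assumes m: "mean_on Y m"
begin

lemma mean_add: "bounded (f ` Y) \<Longrightarrow> bounded (g ` Y) \<Longrightarrow> m (\<lambda>x. f x + g x) = m f + m g"
  using m unfolding mean_on_def by blast

lemma mean_scale: "bounded (f ` Y) \<Longrightarrow> m (\<lambda>x. c * f x) = c * m f"
  using m unfolding mean_on_def by blast

lemma mean_const: "m (\<lambda>x. c) = c"
  using mean_scale[of "\<lambda>_. 1" c] m by (simp add: mean_on_def)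

lemma mean_nonneg: "bounded (f ` Y) \<Longrightarrow> (\<And>x. x \<in> Y \<Longrightarrow> 0 \<le> f x) \<Longrightarrow> 0 \<le> m f"
  using m unfolding mean_on_def by blast

lemma mean_diff: "bounded (f ` Y) \<Longrightarrow> bounded (g ` Y) \<Longrightarrow> m (\<lambda>x. f x - g x) = m f - m g"
  using mean_add[of f "\<lambda>x. - 1 * g x"] mean_scale[of g "-1"] bounded_image_scale[of g Y "-1"] by simp

lemma mean_mono:
  assumes "bounded (f ` Y)" "bounded (g ` Y)" "\<And>x. x \<in> Y \<Longrightarrow> f x \<le> g x"
  shows "m f \<le> m g"
proof -
  have "bounded ((\<lambda>x. g x + -1 * f x) ` Y)" by (intro bounded_image_add bounded_image_scale assms)
  then have "0 \<le> m (\<lambda>x. g x - f x)" by (intro mean_nonneg) (use assms in auto)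
  then show ?thesis using mean_diff[OF assms(2,1)] by simp
qed

lemma mean_cong:
  assumes "bounded (f ` Y)" "\<And>x. x \<in> Y \<Longrightarrow> f x = g x"
  shows "m f = m g"
proof -
  have "g ` Y = f ` Y" using assms(2) by (auto simp: image_iff)
  then have "bounded (g ` Y)" using assms(1) by simp
  then show ?thesis
    using mean_mono[of f g] mean_mono[of g f] assms by fastforce
qed

lemma mean_bound:
  assumes "\<And>x. x \<in> Y \<Longrightarrow> \<bar>f x\<bar> \<le> C"
  shows "\<bar>m f\<bar> \<le> C"
proof -
  have b: "bounded (f ` Y)" using assms by (rule bounded_image_real)
  have "m f \<le> m (\<lambda>x. C)" by (rule mean_mono[OF b]) (use assms in fastforce)+
  moreover have "m (\<lambda>x. - C) \<le> m f" by (rule mean_mono[OF _ b]) (use assms in fastforce)+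
  ultimately show ?thesis by (simp add: mean_const)
qed

end

section \<open>Means of complex functions\<close>

lemma sum_nonneg_Reals: "(\<And>i. i \<in> I \<Longrightarrow> f i \<in> \<real>\<^sub>\<ge>\<^sub>0) \<Longrightarrow> sum f I \<in> (\<real>\<^sub>\<ge>\<^sub>0 :: complex set)"
  by (induction I rule: infinite_finite_induct) auto

definition cmean :: "(('x \<Rightarrow> real) \<Rightarrow> real) \<Rightarrow> ('x \<Rightarrow> complex) \<Rightarrow> complex" where
  "cmean m f = Complex (m (\<lambda>x. Re (f x))) (m (\<lambda>x. Im (f x)))"

lemma bounded_Re_image: "bounded (f ` Y) \<Longrightarrow> bounded ((\<lambda>x. Re (f x)) ` Y)"
  using bounded_linear_image[OF _ bounded_linear_Re, of "f ` Y"] by (simp add: image_image)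

lemma bounded_Im_image: "bounded (f ` Y) \<Longrightarrow> bounded ((\<lambda>x. Im (f x)) ` Y)"
  using bounded_linear_image[OF _ bounded_linear_Im, of "f ` Y"] by (simp add: image_image)

lemma bounded_image_complex: "(\<And>x. x \<in> Y \<Longrightarrow> cmod (f x) \<le> C) \<Longrightarrow> bounded (f ` Y)"
  by (auto intro!: boundedI)

context
  fixes Y :: "'x set" and m
  assumes m: "mean_on Y m"
begin

lemma cmean_add:
  "bounded (f ` Y) \<Longrightarrow> bounded (g ` Y) \<Longrightarrow> cmean m (\<lambda>x. f x + g x) = cmean m f + cmean m g"
  by (simp add: cmean_def complex_eq_iff mean_add[OF m] bounded_Re_image bounded_Im_image)

lemma cmean_scale:
  assumes "bounded (f ` Y)"
  shows "cmean m (\<lambda>x. c * f x) = c * cmean m f"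
proof -
  note b = bounded_Re_image[OF assms] bounded_Im_image[OF assms]
  note b' = bounded_image_scale[OF b(1)] bounded_image_scale[OF b(2)]
  show ?thesis
    using b b' by (simp add: cmean_def complex_eq_iff mean_add[OF m] mean_diff[OF m] mean_scale[OF m])
qed

lemma cmean_const: "cmean m (\<lambda>x. c) = c"
  by (simp add: cmean_def mean_const[OF m])

lemma cmean_sum:
  assumes "finite I" "\<And>i. i \<in> I \<Longrightarrow> bounded (f i ` Y)"
  shows "cmean m (\<lambda>x. \<Sum>i\<in>I. f i x) = (\<Sum>i\<in>I. cmean m (f i))" and "bounded ((\<lambda>x. \<Sum>i\<in>I. f i x) ` Y)"
proof -
  have "cmean m (\<lambda>x. \<Sum>i\<in>I. f i x) = (\<Sum>i\<in>I. cmean m (f i)) \<and> bounded ((\<lambda>x. \<Sum>i\<in>I. f i x) ` Y)"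
    using assms
  proof (induction I)
    case empty
    then show ?case using cmean_const[of 0] by (auto intro: bounded_image_complex[of _ _ 0])
  next
    case (insert i I)
    obtain B C where "\<And>x. x \<in> Y \<Longrightarrow> cmod (f i x) \<le> B" "\<And>x. x \<in> Y \<Longrightarrow> cmod (\<Sum>i\<in>I. f i x) \<le> C"
      using insert unfolding bounded_iff by (auto simp: image_iff) metis
    then have "bounded ((\<lambda>x. f i x + (\<Sum>i\<in>I. f i x)) ` Y)"
      by (intro bounded_image_complex[of _ _ "B + C"]) (meson add_mono norm_triangle_le)
    then show ?case using insert by (simp add: cmean_add)
  qed
  then show "cmean m (\<lambda>x. \<Sum>i\<in>I. f i x) = (\<Sum>i\<in>I. cmean m (f i))"
    and "bounded ((\<lambda>x. \<Sum>i\<in>I. f i x) ` Y)" by auto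
qed

lemma cmean_cong:
  assumes "bounded (f ` Y)" "\<And>x. x \<in> Y \<Longrightarrow> f x = g x"
  shows "cmean m f = cmean m g"
  unfolding cmean_def complex_eq_iff
  using mean_cong[OF m bounded_Re_image[OF assms(1)], of "\<lambda>x. Re (g x)"]
    mean_cong[OF m bounded_Im_image[OF assms(1)], of "\<lambda>x. Im (g x)"] assms(2) by simp

text \<open>The factor 2 comes from bounding real and imaginary parts separately. It is harmless:
  averaged forms only have to be bounded, and tails only have to tend to 0.\<close>

lemma cmean_bound:
  assumes "\<And>x. x \<in> Y \<Longrightarrow> cmod (f x) \<le> C"
  shows "cmod (cmean m f) \<le> 2 * C"
proof -
  have "\<bar>m (\<lambda>x. Re (f x))\<bar> \<le> C" "\<bar>m (\<lambda>x. Im (f x))\<bar> \<le> C"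
    by (intro mean_bound[OF m] order_trans[OF abs_Re_le_cmod assms] order_trans[OF abs_Im_le_cmod assms];
        assumption)+
  then show ?thesis using cmod_le[of "cmean m f"] by (simp add: cmean_def)
qed

lemma cmean_nonneg:
  assumes "bounded (f ` Y)" "\<And>x. x \<in> Y \<Longrightarrow> f x \<in> \<real>\<^sub>\<ge>\<^sub>0"
  shows "cmean m f \<in> \<real>\<^sub>\<ge>\<^sub>0"
proof -
  have "0 \<le> m (\<lambda>x. Re (f x))"
    by (rule mean_nonneg[OF m bounded_Re_image[OF assms(1)]])
       (use assms(2) in \<open>auto simp: complex_nonneg_Reals_iff\<close>)
  moreover have "m (\<lambda>x. Im (f x)) = m (\<lambda>x. 0)"
    by (rule mean_cong[OF m bounded_Im_image[OF assms(1)]])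
       (use assms(2) in \<open>auto simp: complex_nonneg_Reals_iff\<close>)
  ultimately show ?thesis by (simp add: cmean_def complex_nonneg_Reals_iff mean_const[OF m])
qed

text \<open>A mean is only finitely additive; the interchange works because the tails of the series
  are small uniformly in the parameter being averaged.\<close>

lemma cmean_infsum:
  assumes a: "(\<lambda>r. (cmod (a r))\<^sup>2) summable_on X"
    and u: "\<And>\<sigma>. \<sigma> \<in> Y \<Longrightarrow> (\<lambda>r. (cmod (u \<sigma> r))\<^sup>2) summable_on X"
    and C: "\<And>\<sigma>. \<sigma> \<in> Y \<Longrightarrow> ell2_norm X (u \<sigma>) \<le> C" "0 \<le> C"
  shows "cmean m (\<lambda>\<sigma>. \<Sum>\<^sub>\<infinity>r\<in>X. a r * u \<sigma> r) = (\<Sum>\<^sub>\<infinity>r\<in>X. a r * cmean m (\<lambda>\<sigma>. u \<sigma> r))"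
proof (rule infsumI[symmetric])
  let ?S = "\<lambda>\<sigma>. \<Sum>\<^sub>\<infinity>r\<in>X. a r * u \<sigma> r"
  have bu: "bounded ((\<lambda>\<sigma>. u \<sigma> r) ` Y)" if "r \<in> X" for r
  proof (rule bounded_image_complex)
    fix \<sigma> assume \<sigma>: "\<sigma> \<in> Y"
    show "cmod (u \<sigma> r) \<le> C"
      using L2_set_le_ell2_norm[OF u[OF \<sigma>], of "{r}"] C(1)[OF \<sigma>] that by simp
  qed
  have bau: "bounded ((\<lambda>\<sigma>. a r * u \<sigma> r) ` Y)" if r: "r \<in> X" for r
  proof -
    obtain B where "\<And>\<sigma>. \<sigma> \<in> Y \<Longrightarrow> cmod (u \<sigma> r) \<le> B" using bu[OF r] unfolding bounded_iff by auto
    then show ?thesis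
      by (intro bounded_image_complex[of _ _ "cmod (a r) * B"]) (auto simp: norm_mult intro: mult_left_mono)
  qed
  have "((\<lambda>F. (\<Sum>r\<in>F. a r * cmean m (\<lambda>\<sigma>. u \<sigma> r)) - cmean m ?S) \<longlongrightarrow> 0) (finite_subsets_at_top X)"
  proof (rule Lim_null_comparison)
    show "((\<lambda>F. 2 * (ell2_norm (X - F) a * C)) \<longlongrightarrow> 0) (finite_subsets_at_top X)"
      using tendsto_mult[OF tendsto_const tendsto_mult[OF ell2_norm_tail[OF a] tendsto_const], of 2 C] by simp
    show "\<forall>\<^sub>F F in finite_subsets_at_top X.
      norm ((\<Sum>r\<in>F. a r * cmean m (\<lambda>\<sigma>. u \<sigma> r)) - cmean m ?S) \<le> 2 * (ell2_norm (X - F) a * C)"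
    proof (rule eventually_finite_subsets_at_top_weakI)
      fix F assume F: "finite F" "F \<subseteq> X"
      let ?R = "\<lambda>\<sigma>. \<Sum>\<^sub>\<infinity>r\<in>X - F. a r * u \<sigma> r"
      have sm: "(\<lambda>r. a r * u \<sigma> r) summable_on X" if "\<sigma> \<in> Y" for \<sigma>
        by (rule infsum_mult_summable(1)[OF a u[OF that]])
      have split: "?S \<sigma> = (\<Sum>r\<in>F. a r * u \<sigma> r) + ?R \<sigma>" if "\<sigma> \<in> Y" for \<sigma>
        using infsum_Diff[OF sm[OF that] summable_on_finite[OF F(1)] F(2)] F(1) by simp
      have R: "cmod (?R \<sigma>) \<le> ell2_norm (X - F) a * C" if \<sigma>: "\<sigma> \<in> Y" for \<sigma>
      proof -
        have 1: "(\<lambda>r. (cmod (a r))\<^sup>2) summable_on (X - F)" "(\<lambda>r. (cmod (u \<sigma> r))\<^sup>2) summable_on (X - F)"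
          using a u[OF \<sigma>] by (auto intro: summable_on_subset_banach)
        have "cmod (?R \<sigma>) \<le> ell2_norm (X - F) a * ell2_norm (X - F) (u \<sigma>)"
          by (rule infsum_mult_summable(2)[OF 1])
        also have "ell2_norm (X - F) (u \<sigma>) \<le> ell2_norm X (u \<sigma>)"
          unfolding ell2_norm_def by (intro real_sqrt_le_mono infsum_mono2 1 u \<sigma>) auto
        also have "\<dots> \<le> C" by (rule C(1)[OF \<sigma>])
        finally show ?thesis by (simp add: mult_left_mono)
      qed
      have bR: "bounded (?R ` Y)" by (rule bounded_image_complex[OF R])
      note fs = cmean_sum[OF F(1), of "\<lambda>r \<sigma>. a r * u \<sigma> r"]
      have bF: "bounded ((\<lambda>\<sigma>. \<Sum>r\<in>F. a r * u \<sigma> r) ` Y)" using fs(2) bau F(2) by blast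
      obtain B1 B2 where "\<And>\<sigma>. \<sigma> \<in> Y \<Longrightarrow> cmod (\<Sum>r\<in>F. a r * u \<sigma> r) \<le> B1"
        "\<And>\<sigma>. \<sigma> \<in> Y \<Longrightarrow> cmod (?R \<sigma>) \<le> B2"
        using bF R unfolding bounded_iff by auto
      then have b: "bounded ((\<lambda>\<sigma>. (\<Sum>r\<in>F. a r * u \<sigma> r) + ?R \<sigma>) ` Y)"
        by (intro bounded_image_complex[of _ _ "B1 + B2"]) (meson add_mono norm_triangle_le)
      have "cmean m ?S = cmean m (\<lambda>\<sigma>. (\<Sum>r\<in>F. a r * u \<sigma> r) + ?R \<sigma>)"
        by (rule cmean_cong[OF b, symmetric]) (rule split[symmetric])
      also have "\<dots> = cmean m (\<lambda>\<sigma>. \<Sum>r\<in>F. a r * u \<sigma> r) + cmean m ?R"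
        by (rule cmean_add[OF bF bR])
      also have "cmean m (\<lambda>\<sigma>. \<Sum>r\<in>F. a r * u \<sigma> r) = (\<Sum>r\<in>F. cmean m (\<lambda>\<sigma>. a r * u \<sigma> r))"
        using fs(1) bau F(2) by blast
      also have "\<dots> = (\<Sum>r\<in>F. a r * cmean m (\<lambda>\<sigma>. u \<sigma> r))"
        by (rule sum.cong) (use bu F(2) cmean_scale in auto)
      finally show "norm ((\<Sum>r\<in>F. a r * cmean m (\<lambda>\<sigma>. u \<sigma> r)) - cmean m ?S)
          \<le> 2 * (ell2_norm (X - F) a * C)"
        using cmean_bound[OF R] by simp
    qed
  qed
  then show "((\<lambda>r. a r * cmean m (\<lambda>\<sigma>. u \<sigma> r)) has_sum cmean m ?S) X"
    unfolding has_sum_def using LIM_zero_cancel by blast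
qed

end

section \<open>Amenability of group von Neumann algebras\<close>

text \<open>Transfers positivity from finite forms to operators. Truncating the first argument gives
  a partial sum of the inner product; truncating the second as well changes it by at most a multiple
  of the tail norm.\<close>

lemma ell2_inner_quadratic_limit:
  assumes T: "T \<in> bounded_operators X" and f: "f \<in> ell2 X"
  shows "((\<lambda>F. \<Sum>x\<in>F. \<Sum>y\<in>F. cnj (f x) * T (ket y) x * f y) \<longlongrightarrow> ell2_inner X f (T f))
    (finite_subsets_at_top X)"
proof -
  obtain C where C: "0 \<le> C" "\<And>f. f \<in> ell2 X \<Longrightarrow> ell2_norm X (T f) \<le> C * ell2_norm X f"
    using bounded_operatorE[OF T] by blast
  let ?Q = "\<lambda>F. \<Sum>x\<in>F. \<Sum>y\<in>F. cnj (f x) * T (ket y) x * f y"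
  have "((\<lambda>F. ?Q F - (\<Sum>x\<in>F. cnj (f x) * T f x)) \<longlongrightarrow> 0) (finite_subsets_at_top X)"
  proof (rule Lim_null_comparison)
    show "((\<lambda>F. ell2_norm X f * (C * ell2_norm (X - F) f)) \<longlongrightarrow> 0) (finite_subsets_at_top X)"
      using tendsto_mult[OF tendsto_const tendsto_mult[OF tendsto_const
          ell2_norm_tail[OF ell2_summable[OF f]]], of "ell2_norm X f" C] by simp
    show "\<forall>\<^sub>F F in finite_subsets_at_top X.
      norm (?Q F - (\<Sum>x\<in>F. cnj (f x) * T f x)) \<le> ell2_norm X f * (C * ell2_norm (X - F) f)"
    proof (rule eventually_finite_subsets_at_top_weakI)
      fix F assume F: "finite F" "F \<subseteq> X"
      have t: "trunc F f \<in> ell2 X" by (rule trunc_ell2[OF f F])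
      let ?h = "\<lambda>x. trunc F f x - f x"
      have h: "?h \<in> ell2 X" by (rule ell2_diff[OF t f])
      have "?Q F - (\<Sum>x\<in>F. cnj (f x) * T f x) = (\<Sum>x\<in>F. cnj (f x) * T ?h x)"
        by (simp add: op_diff_arg[OF T t f] op_trunc_apply[OF T F] algebra_simps sum_subtractf sum_distrib_left)
      also have "cmod \<dots> \<le> (\<Sum>x\<in>F. \<bar>cmod (f x)\<bar> * \<bar>cmod (T ?h x)\<bar>)"
        by (rule order_trans[OF norm_sum]) (simp add: norm_mult)
      also have "\<dots> \<le> L2_set (\<lambda>x. cmod (f x)) F * L2_set (\<lambda>x. cmod (T ?h x)) F"
        by (rule L2_set_mult_ineq)
      also have "\<dots> \<le> ell2_norm X f * ell2_norm X (T ?h)"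
        by (intro mult_mono L2_set_le_ell2_norm ell2_summable f F op_closed[OF T h]) auto
      also have "\<dots> \<le> ell2_norm X f * (C * ell2_norm X ?h)"
        by (intro mult_left_mono C(2) h) auto
      also have "ell2_norm X ?h = ell2_norm (X - F) f"
        unfolding ell2_norm_def
        by (rule arg_cong[where f = sqrt], rule infsum_cong_neutral) (auto simp: trunc_def)
      finally show "norm (?Q F - (\<Sum>x\<in>F. cnj (f x) * T f x)) \<le> ell2_norm X f * (C * ell2_norm (X - F) f)" .
    qed
  qed
  moreover have "((\<lambda>F. \<Sum>x\<in>F. cnj (f x) * T f x) \<longlongrightarrow> ell2_inner X f (T f)) (finite_subsets_at_top X)"
    unfolding ell2_inner_def by (rule infsum_tendsto[OF ell2_inner_summable[OF f op_closed[OF T f]]])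
  ultimately show ?thesis using tendsto_add by fastforce
qed

section \<open>The conditional expectation defined by an invariant mean on a subgroup\<close>

locale subgroup_mean = group G for G (structure) +
  fixes K and m
  assumes K: "subgroup K G"
    and mean: "mean_on K m"
    and mean_inv: "k \<in> K \<Longrightarrow> bounded (f ` K) \<Longrightarrow> m (\<lambda>\<sigma>. f (k \<otimes> \<sigma>)) = m f"
begin

lemma KG: "k \<in> K \<Longrightarrow> k \<in> carrier G"
  by (rule subgroup.mem_carrier[OF K])

lemma K_closed: "k \<in> K \<Longrightarrow> l \<in> K \<Longrightarrow> k \<otimes> l \<in> K" "k \<in> K \<Longrightarrow> inv k \<in> K" "\<one> \<in> K"
  using K by (auto simp: subgroup_def)

lemma K_mult_iff:
  assumes "k \<in> K" "x \<in> carrier G"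
  shows "k \<otimes> x \<in> K \<longleftrightarrow> x \<in> K" and "x \<otimes> k \<in> K \<longleftrightarrow> x \<in> K"
proof -
  have "inv k \<otimes> (k \<otimes> x) = x" "x \<otimes> k \<otimes> inv k = x"
    using assms KG by (auto simp: inv_cancel_left m_assoc)
  then show "k \<otimes> x \<in> K \<longleftrightarrow> x \<in> K" "x \<otimes> k \<in> K \<longleftrightarrow> x \<in> K"
    using K_closed assms by metis+
qed

lemma cmean_inv:
  assumes "k \<in> K" "bounded (f ` K)"
  shows "cmean m (\<lambda>\<sigma>. f (k \<otimes> \<sigma>)) = cmean m f"
  unfolding cmean_def
  using mean_inv[OF assms(1) bounded_Re_image[OF assms(2)]] mean_inv[OF assms(1) bounded_Im_image[OF assms(2)]]
  by simp

text \<open>The average of the entries of T along one diagonal of the block of rows and columns in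
  K: the symbol of the convolution operator obtained by compressing T to \<open>ell2 K\<close> and
  averaging over right translations by K.\<close>

definition symb :: "'a operator \<Rightarrow> 'a \<Rightarrow> complex" where
  "symb T s = (if s \<in> K then cmean m (\<lambda>\<sigma>. T (ket \<sigma>) (s \<otimes> \<sigma>)) else 0)"

text \<open>Since \<open>symb T\<close> vanishes off K, this matrix is block diagonal over the
  cosets K r, and every block is a copy of the one on K.\<close>

definition expect :: "'a operator \<Rightarrow> 'a operator" where
  "expect T = kernel_op (carrier G) (\<lambda>x y. symb T (x \<otimes> inv y))"

lemma coeff_bound:
  assumes T: "T \<in> bounded_operators (carrier G)"
    and C: "\<And>f. f \<in> ell2 (carrier G) \<Longrightarrow> ell2_norm (carrier G) (T f) \<le> C * ell2_norm (carrier G) f"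
    and y: "y \<in> carrier G"
  shows "cmod (T (ket y) x) \<le> C"
  using ell2_coord_le[OF op_closed[OF T], of "ket y" x] C[of "ket y"] y by (simp add: ell2_norm_ket)

lemma coeff_bounded:
  assumes T: "T \<in> bounded_operators (carrier G)" and p: "\<And>\<sigma>. \<sigma> \<in> K \<Longrightarrow> p \<sigma> \<in> carrier G"
  shows "bounded ((\<lambda>\<sigma>. T (ket (p \<sigma>)) (q \<sigma>)) ` K)"
proof -
  obtain C where C: "\<And>f. f \<in> ell2 (carrier G) \<Longrightarrow> ell2_norm (carrier G) (T f) \<le> C * ell2_norm (carrier G) f"
    using bounded_operatorE[OF T] by blast
  show ?thesis
    by (rule bounded_image_complex[of _ _ C]) (use coeff_bound[OF T C] p in blast)
qed

definition rep :: "'a \<Rightarrow> 'a" where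
  "rep x = (SOME y. y \<in> carrier G \<and> x \<otimes> inv y \<in> K)"

lemma rep:
  assumes "x \<in> carrier G"
  shows "rep x \<in> carrier G" "x \<otimes> inv (rep x) \<in> K"
proof -
  have "rep x \<in> carrier G \<and> x \<otimes> inv (rep x) \<in> K"
    unfolding rep_def by (rule someI[of _ x]) (use assms K_closed in simp)
  then show "rep x \<in> carrier G" "x \<otimes> inv (rep x) \<in> K" by auto
qed

text \<open>Elements of one coset K x satisfy the same predicate in the definition of
  \<open>rep\<close>, so the choice operator returns the same representative.\<close>

lemma rep_eq_iff:
  assumes "x \<in> carrier G" "y \<in> carrier G"
  shows "rep x = rep y \<longleftrightarrow> x \<otimes> inv y \<in> K"
proof
  assume "rep x = rep y"
  then have "(x \<otimes> inv (rep x)) \<otimes> inv (y \<otimes> inv (rep x)) \<in> K"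
    using rep[OF assms(1)] rep[OF assms(2)] K_closed by metis
  then show "x \<otimes> inv y \<in> K"
    using assms rep(1)[OF assms(1)] by (simp add: inv_mult_group m_assoc inv_cancel_left)
next
  assume xy: "x \<otimes> inv y \<in> K"
  have "x \<otimes> inv z \<in> K \<longleftrightarrow> y \<otimes> inv z \<in> K" if "z \<in> carrier G" for z
    using K_mult_iff(1)[OF xy, of "y \<otimes> inv z"] assms that by (simp add: m_assoc inv_cancel_left)
  then show "rep x = rep y" unfolding rep_def by metis
qed

text \<open>With x = k r, where r is \<open>rep x\<close> and k is in K, the value is k \<sigma>:
  the right translation carrying the coset K r onto K.\<close>

definition slide :: "'a \<Rightarrow> 'a \<Rightarrow> 'a" where
  "slide \<sigma> x = x \<otimes> inv (rep x) \<otimes> \<sigma>"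

text \<open>The form of \<open>expect T\<close> is the mean over \<open>\<sigma>\<close> of forms that are orthogonal sums, over the cosets
  \<open>K r\<close>, of copies of the form of \<open>T\<close> transported by right translation from \<open>K r\<close> to \<open>K\<close>.\<close>

definition coset_form ::
  "'a operator \<Rightarrow> 'a set \<Rightarrow> ('a \<Rightarrow> complex) \<Rightarrow> ('a \<Rightarrow> complex) \<Rightarrow> 'a \<Rightarrow> complex" where
  "coset_form T F f g \<sigma> = (\<Sum>r\<in>rep ` F. \<Sum>x\<in>{x\<in>F. rep x = r}. \<Sum>y\<in>{y\<in>F. rep y = r}.
      f x * T (ket (slide \<sigma> y)) (slide \<sigma> x) * g y)"

lemma symb_form:
  assumes T: "T \<in> bounded_operators (carrier G)" and F: "finite F" "F \<subseteq> carrier G"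
  shows "(\<Sum>x\<in>F. \<Sum>y\<in>F. f x * symb T (x \<otimes> inv y) * g y) =
    cmean m (coset_form T F f g)"
    and "bounded (coset_form T F f g ` K)"
proof -
  have sl: "slide \<sigma> y \<in> carrier G" if "\<sigma> \<in> K" "y \<in> F" for \<sigma> y
    using that F rep[of y] KG by (auto simp: slide_def)
  have b0: "bounded ((\<lambda>\<sigma>. T (ket (slide \<sigma> y)) (slide \<sigma> x)) ` K)" if "y \<in> F" for x y
    by (rule coeff_bounded[OF T]) (use sl that in auto)
  have bs: "bounded ((\<lambda>\<sigma>. f x * T (ket (slide \<sigma> y)) (slide \<sigma> x) * g y) ` K)" if y: "y \<in> F" for x y
  proof -
    obtain B where "\<And>\<sigma>. \<sigma> \<in> K \<Longrightarrow> cmod (T (ket (slide \<sigma> y)) (slide \<sigma> x)) \<le> B"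
      using b0[OF y, of x] unfolding bounded_iff by auto
    then show ?thesis
      by (intro bounded_image_complex[of _ _ "cmod (f x) * B * cmod (g y)"])
         (auto simp: norm_mult intro!: mult_right_mono mult_left_mono)
  qed
  \<comment> \<open>Put k = \<open>y \<otimes> inv (rep y)\<close>, an element of K. Then
    \<open>slide \<sigma> y\<close> is k \<sigma> and \<open>slide \<sigma> x\<close> is
    \<open>x \<otimes> inv y\<close> times k \<sigma>. Invariance of the mean removes k and leaves
    the diagonal average that defines \<open>symb\<close>.\<close>
  have cs: "cmean m (\<lambda>\<sigma>. f x * T (ket (slide \<sigma> y)) (slide \<sigma> x) * g y)
      = f x * symb T (x \<otimes> inv y) * g y" if xy: "x \<in> F" "y \<in> F" "rep x = rep y" for x y
  proof -
    have c: "x \<in> carrier G" "y \<in> carrier G" using xy F by auto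
    have k: "y \<otimes> inv (rep y) \<in> K" using rep[OF c(2)] by simp
    have xyK: "x \<otimes> inv y \<in> K" using rep_eq_iff[OF c] xy by simp
    have e: "slide \<sigma> x = (x \<otimes> inv y) \<otimes> (y \<otimes> inv (rep y) \<otimes> \<sigma>)" if "\<sigma> \<in> K" for \<sigma>
      using c rep[OF c(2)] KG[OF that] xy(3) by (simp add: slide_def m_assoc inv_cancel_left)
    have "cmean m (\<lambda>\<sigma>. f x * T (ket (slide \<sigma> y)) (slide \<sigma> x) * g y)
        = cmean m (\<lambda>\<sigma>. (f x * g y) * T (ket (slide \<sigma> y)) (slide \<sigma> x))"
      by (simp add: mult_ac)
    also have "\<dots> = (f x * g y) * cmean m (\<lambda>\<sigma>. T (ket (slide \<sigma> y)) (slide \<sigma> x))"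
      by (rule cmean_scale[OF mean b0[OF xy(2)]])
    also have "cmean m (\<lambda>\<sigma>. T (ket (slide \<sigma> y)) (slide \<sigma> x))
        = cmean m (\<lambda>\<sigma>. T (ket (y \<otimes> inv (rep y) \<otimes> \<sigma>)) ((x \<otimes> inv y) \<otimes> (y \<otimes> inv (rep y) \<otimes> \<sigma>)))"
      by (rule cmean_cong[OF mean b0[OF xy(2)]]) (simp add: e, simp add: slide_def)
    also have "\<dots> = cmean m (\<lambda>\<sigma>. T (ket \<sigma>) ((x \<otimes> inv y) \<otimes> \<sigma>))"
      by (rule cmean_inv[OF k coeff_bounded[OF T KG]])
    also have "\<dots> = symb T (x \<otimes> inv y)" using xyK by (simp add: symb_def)
    finally show ?thesis by (simp add: mult_ac)
  qed
  have fin: "finite (rep ` F)" "finite {x\<in>F. rep x = r}" for r using F by auto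
  have "(\<Sum>x\<in>F. \<Sum>y\<in>F. f x * symb T (x \<otimes> inv y) * g y)
      = (\<Sum>r\<in>rep ` F. \<Sum>x\<in>{x\<in>F. rep x = r}. \<Sum>y\<in>F. f x * symb T (x \<otimes> inv y) * g y)"
    by (rule sum.image_gen[OF F(1)])
  \<comment> \<open>Pairs from different cosets drop out, as \<open>symb T\<close> vanishes off
    K.\<close>
  also have "\<dots> = (\<Sum>r\<in>rep ` F. \<Sum>x\<in>{x\<in>F. rep x = r}. \<Sum>y\<in>{y\<in>F. rep y = r}.
      f x * symb T (x \<otimes> inv y) * g y)"
  proof (rule sum.cong[OF refl], rule sum.cong[OF refl], rule sum.mono_neutral_right)
    fix r x
    assume x: "x \<in> {x\<in>F. rep x = r}"
    show "\<forall>y\<in>F - {y\<in>F. rep y = r}. f x * symb T (x \<otimes> inv y) * g y = 0"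
    proof
      fix y assume y: "y \<in> F - {y\<in>F. rep y = r}"
      then have "x \<in> carrier G" "y \<in> carrier G" "rep x \<noteq> rep y" using x F by auto
      then have "x \<otimes> inv y \<notin> K" using rep_eq_iff[of x y] by simp
      then show "f x * symb T (x \<otimes> inv y) * g y = 0" by (simp add: symb_def)
    qed
  qed (use F in auto)
  also have "\<dots> = (\<Sum>r\<in>rep ` F. \<Sum>x\<in>{x\<in>F. rep x = r}. \<Sum>y\<in>{y\<in>F. rep y = r}.
      cmean m (\<lambda>\<sigma>. f x * T (ket (slide \<sigma> y)) (slide \<sigma> x) * g y))"
    by (intro sum.cong refl cs[symmetric]) auto
  also have "\<dots> = (\<Sum>r\<in>rep ` F. \<Sum>x\<in>{x\<in>F. rep x = r}. cmean m (\<lambda>\<sigma>. \<Sum>y\<in>{y\<in>F. rep y = r}.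
      f x * T (ket (slide \<sigma> y)) (slide \<sigma> x) * g y))"
    by (intro sum.cong refl cmean_sum(1)[OF mean, symmetric] fin bs) auto
  also have "\<dots> = (\<Sum>r\<in>rep ` F. cmean m (\<lambda>\<sigma>. \<Sum>x\<in>{x\<in>F. rep x = r}. \<Sum>y\<in>{y\<in>F. rep y = r}.
      f x * T (ket (slide \<sigma> y)) (slide \<sigma> x) * g y))"
    by (intro sum.cong refl cmean_sum(1)[OF mean, symmetric] cmean_sum(2)[OF mean] fin bs) auto
  also have "\<dots> = cmean m (coset_form T F f g)"
    unfolding coset_form_def
    by (intro cmean_sum(1)[OF mean, symmetric] cmean_sum(2)[OF mean] fin bs) auto
  finally show "(\<Sum>x\<in>F. \<Sum>y\<in>F. f x * symb T (x \<otimes> inv y) * g y) = cmean m (coset_form T F f g)" .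
  show "bounded (coset_form T F f g ` K)"
    unfolding coset_form_def
    by (intro cmean_sum(2)[OF mean] fin bs) auto
qed

lemma slide_inj:
  assumes "\<sigma> \<in> K" "F \<subseteq> carrier G" shows "inj_on (slide \<sigma>) {x\<in>F. rep x = r}"
proof (rule inj_onI)
  fix x y assume xy: "x \<in> {x\<in>F. rep x = r}" "y \<in> {x\<in>F. rep x = r}" and e: "slide \<sigma> x = slide \<sigma> y"
  then have c: "x \<in> carrier G" "y \<in> carrier G" "r \<in> carrier G" "rep x = r" "rep y = r" "\<sigma> \<in> carrier G"
    using assms KG rep(1) by auto
  then show "x = y" using e by (simp add: slide_def)
qed

text \<open>A block is the form of T itself in relabelled vectors with the same l2 norms, because
  \<open>slide \<sigma>\<close> is injective on a coset. Bounds and positivity of T therefore carry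
  over to blocks.\<close>

lemma slide_form:
  assumes \<sigma>: "\<sigma> \<in> K" and F: "finite F" "F \<subseteq> carrier G"
    and A: "A = {x\<in>F. rep x = r}" and q_def: "q = inv_into A (slide \<sigma>)"
  shows "(\<Sum>x\<in>A. \<Sum>y\<in>A. f x * T (ket (slide \<sigma> y)) (slide \<sigma> x) * g y)
      = (\<Sum>x\<in>slide \<sigma> ` A. \<Sum>y\<in>slide \<sigma> ` A. f (q x) * T (ket y) x * g (q y))"
    and "finite (slide \<sigma> ` A)" and "slide \<sigma> ` A \<subseteq> carrier G"
    and "L2_set (\<lambda>x. cmod (h (q x))) (slide \<sigma> ` A) = L2_set (\<lambda>x. cmod (h x)) A"
proof -
  have inj: "inj_on (slide \<sigma>) A" unfolding A by (rule slide_inj[OF \<sigma> F(2)])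
  have q: "q (slide \<sigma> x) = x" if "x \<in> A" for x
    unfolding q_def by (rule inv_into_f_f[OF inj that])
  show "(\<Sum>x\<in>A. \<Sum>y\<in>A. f x * T (ket (slide \<sigma> y)) (slide \<sigma> x) * g y)
      = (\<Sum>x\<in>slide \<sigma> ` A. \<Sum>y\<in>slide \<sigma> ` A. f (q x) * T (ket y) x * g (q y))"
    by (simp add: sum.reindex[OF inj] q)
  show "finite (slide \<sigma> ` A)" using F by (simp add: A)
  show "slide \<sigma> ` A \<subseteq> carrier G" using F rep KG[OF \<sigma>] by (auto simp: A slide_def)
  show "L2_set (\<lambda>x. cmod (h (q x))) (slide \<sigma> ` A) = L2_set (\<lambda>x. cmod (h x)) A"
    by (simp add: L2_set_def sum.reindex[OF inj] q)
qed

text \<open>For each \<sigma> the blocks are orthogonal: T bounds each of them by C, and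
  Cauchy-Schwarz over the cosets assembles the pieces into the full norms. The 2 is that of
  \<open>cmean_bound\<close>.\<close>

lemma symb_form_bound:
  assumes T: "T \<in> bounded_operators (carrier G)"
    and C: "0 \<le> C" "\<And>f. f \<in> ell2 (carrier G) \<Longrightarrow> ell2_norm (carrier G) (T f) \<le> C * ell2_norm (carrier G) f"
    and F: "finite F" "F \<subseteq> carrier G"
  shows "cmod (\<Sum>x\<in>F. \<Sum>y\<in>F. f x * symb T (x \<otimes> inv y) * g y)
    \<le> 2 * C * L2_set (\<lambda>x. cmod (f x)) F * L2_set (\<lambda>x. cmod (g x)) F"
proof -
  let ?A = "\<lambda>r. {x\<in>F. rep x = r}"
  let ?L = "\<lambda>f r. L2_set (\<lambda>x. cmod (f x)) (?A r)"
  have L: "L2_set (?L f) (rep ` F) = L2_set (\<lambda>x. cmod (f x)) F" for f :: "'a \<Rightarrow> complex"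
  proof -
    have "(\<Sum>r\<in>rep ` F. (?L f r)\<^sup>2) = (\<Sum>r\<in>rep ` F. \<Sum>x\<in>?A r. (cmod (f x))\<^sup>2)"
      by (intro sum.cong refl) (simp add: L2_set_def sum_nonneg)
    also have "\<dots> = (\<Sum>x\<in>F. (cmod (f x))\<^sup>2)"
      by (rule sum.image_gen[OF F(1), symmetric])
    finally show ?thesis by (simp add: L2_set_def)
  qed
  have "cmod (coset_form T F f g \<sigma>)
      \<le> C * L2_set (\<lambda>x. cmod (f x)) F * L2_set (\<lambda>x. cmod (g x)) F" if \<sigma>: "\<sigma> \<in> K" for \<sigma>
  proof -
    have "cmod (\<Sum>r\<in>rep ` F. \<Sum>x\<in>?A r. \<Sum>y\<in>?A r. f x * T (ket (slide \<sigma> y)) (slide \<sigma> x) * g y)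
        \<le> (\<Sum>r\<in>rep ` F. C * ?L f r * ?L g r)"
    proof (rule sum_norm_le)
      fix r
      note sf = slide_form[OF \<sigma> F refl refl, where r = r]
      show "cmod (\<Sum>x\<in>?A r. \<Sum>y\<in>?A r. f x * T (ket (slide \<sigma> y)) (slide \<sigma> x) * g y) \<le> C * ?L f r * ?L g r"
        unfolding sf(1)[where T = T] sf(4)[where h = f, symmetric] sf(4)[where h = g, symmetric]
        by (rule op_sum_bound[OF T C sf(2,3)])
    qed
    also have "\<dots> = C * (\<Sum>r\<in>rep ` F. \<bar>?L f r\<bar> * \<bar>?L g r\<bar>)"
      by (simp add: sum_distrib_left mult_ac)
    also have "\<dots> \<le> C * (L2_set (?L f) (rep ` F) * L2_set (?L g) (rep ` F))"
      by (intro mult_left_mono L2_set_mult_ineq C)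
    finally show ?thesis unfolding coset_form_def by (simp add: L mult_ac)
  qed
  from cmean_bound[OF mean this] show ?thesis
    unfolding symb_form(1)[OF T F] by (simp add: mult_ac)
qed

lemma expect:
  assumes T: "T \<in> bounded_operators (carrier G)"
  shows "expect T \<in> bounded_operators (carrier G)"
    and "x \<in> carrier G \<Longrightarrow> y \<in> carrier G \<Longrightarrow> expect T (ket y) x = symb T (x \<otimes> inv y)"
proof -
  obtain C where C: "0 \<le> C" "\<And>f. f \<in> ell2 (carrier G) \<Longrightarrow> ell2_norm (carrier G) (T f) \<le> C * ell2_norm (carrier G) f"
    using bounded_operatorE[OF T] by blast
  note k = kernel_op[of "2 * C" "carrier G" "\<lambda>x y. symb T (x \<otimes> inv y)", OF _ symb_form_bound[OF T C]]
  show "expect T \<in> bounded_operators (carrier G)"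
    unfolding expect_def by (rule k(1)) (use C in auto)
  show "expect T (ket y) x = symb T (x \<otimes> inv y)" if "x \<in> carrier G" "y \<in> carrier G"
    unfolding expect_def by (rule k(2)) (use C that in auto)
qed

text \<open>Every finite quadratic form of \<open>expect T\<close> is a mean of sums of such forms
  of T, and the nonnegative reals are stable under sums, means and limits.\<close>

lemma expect_positive:
  assumes "positive_operator (carrier G) T"
  shows "positive_operator (carrier G) (expect T)"
  unfolding positive_operator_def
proof (intro conjI ballI)
  let ?X = "carrier G"
  have T: "T \<in> bounded_operators ?X" and pos: "\<And>f. f \<in> ell2 ?X \<Longrightarrow> ell2_inner ?X f (T f) \<in> \<real>\<^sub>\<ge>\<^sub>0"
    using assms by (auto simp: positive_operator_def)
  show "expect T \<in> bounded_operators ?X" by (rule expect(1)[OF T])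
  fix f assume f: "f \<in> ell2 ?X"
  have fin: "(\<Sum>x\<in>F. \<Sum>y\<in>F. cnj (h x) * T (ket y) x * h y) \<in> \<real>\<^sub>\<ge>\<^sub>0"
    if F: "finite F" "F \<subseteq> ?X" for F h
  proof -
    have t: "trunc F h \<in> ell2 ?X" by (rule ell2_finite_support[OF F]) (auto simp: trunc_def)
    have "ell2_inner ?X (trunc F h) (T (trunc F h)) = (\<Sum>\<^sub>\<infinity>x\<in>F. cnj (h x) * T (trunc F h) x)"
      unfolding ell2_inner_def by (rule infsum_cong_neutral) (use F in \<open>auto simp: trunc_def\<close>)
    also have "\<dots> = (\<Sum>x\<in>F. cnj (h x) * T (trunc F h) x)" using F by simp
    also have "\<dots> = (\<Sum>x\<in>F. \<Sum>y\<in>F. cnj (h x) * T (ket y) x * h y)"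
      by (simp add: op_trunc_apply[OF T F] sum_distrib_left mult_ac)
    finally show ?thesis using pos[OF t] by simp
  qed
  have "(\<Sum>x\<in>F. \<Sum>y\<in>F. cnj (f x) * expect T (ket y) x * f y) \<in> \<real>\<^sub>\<ge>\<^sub>0" if F: "finite F" "F \<subseteq> ?X" for F
  proof -
    have "(\<Sum>x\<in>F. \<Sum>y\<in>F. cnj (f x) * expect T (ket y) x * f y)
        = (\<Sum>x\<in>F. \<Sum>y\<in>F. cnj (f x) * symb T (x \<otimes> inv y) * f y)"
      using expect(2)[OF T] F(2) by (intro sum.cong refl) (simp add: subset_iff)
    also have "\<dots> \<in> \<real>\<^sub>\<ge>\<^sub>0"
      unfolding symb_form(1)[OF T F, of "\<lambda>x. cnj (f x)"]
    proof (rule cmean_nonneg[OF mean symb_form(2)[OF T F]])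
      fix \<sigma> assume \<sigma>: "\<sigma> \<in> K"
      show "coset_form T F (\<lambda>x. cnj (f x)) f \<sigma> \<in> \<real>\<^sub>\<ge>\<^sub>0"
        unfolding coset_form_def
      proof (rule sum_nonneg_Reals)
        fix r
        note sf = slide_form[OF \<sigma> F refl refl, where r = r]
        show "(\<Sum>x\<in>{x\<in>F. rep x = r}. \<Sum>y\<in>{y\<in>F. rep y = r}.
          cnj (f x) * T (ket (slide \<sigma> y)) (slide \<sigma> x) * f y) \<in> \<real>\<^sub>\<ge>\<^sub>0"
          unfolding sf(1)[where T = T] by (rule fin[OF sf(2,3), of "\<lambda>x. f (inv_into {x\<in>F. rep x = r} (slide \<sigma>) x)"])
      qed
    qed
    finally show ?thesis .
  qed
  then show "ell2_inner ?X f (expect T f) \<in> \<real>\<^sub>\<ge>\<^sub>0"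
    by (intro Lim_in_closed_set[OF closed_nonneg_Reals_complex _ finite_subsets_at_top_neq_bot
          ell2_inner_quadratic_limit[OF expect(1)[OF T] f]] eventually_finite_subsets_at_top_weakI)
qed

section \<open>Range, linearity and bimodule property of the expectation\<close>

lemma expect_eqI:
  assumes T: "T \<in> bounded_operators (carrier G)" and S: "S \<in> bounded_operators (carrier G)"
    and "\<And>x y. x \<in> carrier G \<Longrightarrow> y \<in> carrier G \<Longrightarrow> S (ket y) x = symb T (x \<otimes> inv y)"
  shows "expect T = S"
  by (rule op_eqI[OF expect(1)[OF T] S]) (simp add: expect(2)[OF T] assms(3))

lemma expect_in: "T \<in> bounded_operators (carrier G) \<Longrightarrow> expect T \<in> subgroup_vN G K"
  by (rule subgroup_vNI[OF K expect(1)]) (auto simp: expect(2) symb_def)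

lemma expect_id:
  assumes T: "T \<in> subgroup_vN G K"
  shows "expect T = T"
proof -
  have TB: "T \<in> bounded_operators (carrier G)" using T subgroup_vN_bounded by blast
  note coeff = subgroup_vN_coeff[OF T subgroup.subset[OF K]]
  show ?thesis
  proof (rule expect_eqI[OF TB TB])
    fix x y assume xy: "x \<in> carrier G" "y \<in> carrier G"
    let ?s = "x \<otimes> inv y"
    have "symb T ?s = T (ket \<one>) ?s"
    proof (cases "?s \<in> K")
      case True
      have "T (ket \<sigma>) (?s \<otimes> \<sigma>) = T (ket \<one>) ?s" if "\<sigma> \<in> K" for \<sigma>
        using coeff[of "?s \<otimes> \<sigma>" \<sigma>] xy KG[OF that] by (simp add: m_assoc)
      then have "cmean m (\<lambda>\<sigma>. T (ket \<sigma>) (?s \<otimes> \<sigma>)) = cmean m (\<lambda>\<sigma>. T (ket \<one>) ?s)"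
        by (intro cmean_cong[OF mean coeff_bounded[OF TB KG]])
      then show ?thesis using True by (simp add: symb_def cmean_const[OF mean])
    qed (simp add: symb_def subgroup_vN_support[OF T K])
    then show "T (ket y) x = symb T ?s" using coeff[OF xy] by simp
  qed
qed

lemma expect_add:
  assumes S: "S \<in> bounded_operators (carrier G)" and T: "T \<in> bounded_operators (carrier G)"
  shows "expect (op_add (carrier G) S T) = op_add (carrier G) (expect S) (expect T)"
proof (rule expect_eqI[OF op_add_bounded[OF S T] op_add_bounded[OF expect(1)[OF S] expect(1)[OF T]]])
  fix x y assume xy: "x \<in> carrier G" "y \<in> carrier G"
  let ?s = "x \<otimes> inv y"
  have bS: "bounded ((\<lambda>\<sigma>. S (ket \<sigma>) (?s \<otimes> \<sigma>)) ` K)" by (rule coeff_bounded[OF S KG])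
  have bT: "bounded ((\<lambda>\<sigma>. T (ket \<sigma>) (?s \<otimes> \<sigma>)) ` K)" by (rule coeff_bounded[OF T KG])
  have bST: "bounded ((\<lambda>\<sigma>. op_add (carrier G) S T (ket \<sigma>) (?s \<otimes> \<sigma>)) ` K)"
    by (rule coeff_bounded[OF op_add_bounded[OF S T] KG])
  have "cmean m (\<lambda>\<sigma>. op_add (carrier G) S T (ket \<sigma>) (?s \<otimes> \<sigma>))
      = cmean m (\<lambda>\<sigma>. S (ket \<sigma>) (?s \<otimes> \<sigma>) + T (ket \<sigma>) (?s \<otimes> \<sigma>))"
    by (rule cmean_cong[OF mean bST]) (simp add: op_add_def KG)
  then have "symb (op_add (carrier G) S T) ?s = symb S ?s + symb T ?s"
    by (simp add: symb_def cmean_add[OF mean bS bT])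
  then show "op_add (carrier G) (expect S) (expect T) (ket y) x = symb (op_add (carrier G) S T) ?s"
    using xy by (simp add: op_add_def[of _ "expect S"] expect(2)[OF S] expect(2)[OF T])
qed

lemma expect_scale:
  assumes T: "T \<in> bounded_operators (carrier G)"
  shows "expect (op_scale (carrier G) c T) = op_scale (carrier G) c (expect T)"
proof (rule expect_eqI[OF op_scale_bounded[OF T] op_scale_bounded[OF expect(1)[OF T]]])
  fix x y assume xy: "x \<in> carrier G" "y \<in> carrier G"
  let ?s = "x \<otimes> inv y"
  have bT: "bounded ((\<lambda>\<sigma>. T (ket \<sigma>) (?s \<otimes> \<sigma>)) ` K)" by (rule coeff_bounded[OF T KG])
  have bcT: "bounded ((\<lambda>\<sigma>. op_scale (carrier G) c T (ket \<sigma>) (?s \<otimes> \<sigma>)) ` K)"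
    by (rule coeff_bounded[OF op_scale_bounded[OF T] KG])
  have "cmean m (\<lambda>\<sigma>. op_scale (carrier G) c T (ket \<sigma>) (?s \<otimes> \<sigma>))
      = cmean m (\<lambda>\<sigma>. c * T (ket \<sigma>) (?s \<otimes> \<sigma>))"
    by (rule cmean_cong[OF mean bcT]) (simp add: op_scale_def KG)
  then have "symb (op_scale (carrier G) c T) ?s = c * symb T ?s"
    by (simp add: symb_def cmean_scale[OF mean bT])
  then show "op_scale (carrier G) c (expect T) (ket y) x = symb (op_scale (carrier G) c T) ?s"
    using xy by (simp add: op_scale_def[of _ _ "expect T"] expect(2)[OF T])
qed

text \<open>A acts as convolution by its first column, which is supported on K, so the mean has to
  pass through an infinite sum. \<open>cmean_infsum\<close> applies because the columns
  \<open>T (ket \<sigma>)\<close> are bounded in norm uniformly in \<sigma>.\<close>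

lemma expect_left_module:
  assumes A: "A \<in> subgroup_vN G K" and T: "T \<in> bounded_operators (carrier G)"
  shows "expect (op_comp (carrier G) A T) = op_comp (carrier G) A (expect T)"
proof -
  let ?X = "carrier G" and ?a = "A (ket \<one>)"
  have AB: "A \<in> bounded_operators ?X" using A subgroup_vN_bounded by blast
  note coeff = subgroup_vN_coeff[OF A subgroup.subset[OF K]]
  obtain C where C: "0 \<le> C" "\<And>f. f \<in> ell2 ?X \<Longrightarrow> ell2_norm ?X (T f) \<le> C * ell2_norm ?X f"
    using bounded_operatorE[OF T] by blast
  have conv: "A f x = (\<Sum>\<^sub>\<infinity>r\<in>?X. ?a r * f (inv r \<otimes> x))" if f: "f \<in> ell2 ?X" and x: "x \<in> ?X" for f x
  proof -
    have "A f x = (\<Sum>\<^sub>\<infinity>z\<in>?X. f z * A (ket z) x)" by (rule op_apply[OF AB f])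
    also have "\<dots> = (\<Sum>\<^sub>\<infinity>r\<in>?X. f (inv r \<otimes> x) * A (ket (inv r \<otimes> x)) x)"
      by (rule infsum_reindex_bij_betw[OF bij_inv_r_mult[OF x], symmetric])
    also have "\<dots> = (\<Sum>\<^sub>\<infinity>r\<in>?X. ?a r * f (inv r \<otimes> x))"
    proof (rule infsum_cong)
      fix r assume r: "r \<in> ?X"
      have "x \<otimes> inv (inv r \<otimes> x) = r" using r x by (simp add: inv_mult_group m_assoc[symmetric])
      then show "f (inv r \<otimes> x) * A (ket (inv r \<otimes> x)) x = ?a r * f (inv r \<otimes> x)"
        using coeff[of x "inv r \<otimes> x"] r x by simp
    qed
    finally show ?thesis .
  qed
  show ?thesis
  proof (rule expect_eqI[OF op_comp_bounded[OF AB T] op_comp_bounded[OF AB expect(1)[OF T]]])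
    fix x y assume xy: "x \<in> ?X" "y \<in> ?X"
    let ?s = "x \<otimes> inv y"
    have s: "?s \<in> ?X" using xy by simp
    have "op_comp ?X A (expect T) (ket y) x = (\<Sum>\<^sub>\<infinity>r\<in>?X. ?a r * expect T (ket y) (inv r \<otimes> x))"
      using xy op_closed[OF expect(1)[OF T]] by (simp add: op_comp_apply conv)
    also have "\<dots> = (\<Sum>\<^sub>\<infinity>r\<in>?X. ?a r * symb T (inv r \<otimes> ?s))"
      by (rule infsum_cong) (use xy in \<open>simp add: expect(2)[OF T] m_assoc\<close>)
    also have "\<dots> = symb (op_comp ?X A T) ?s"
    proof (cases "?s \<in> K")
      case False
      have "?a r * symb T (inv r \<otimes> ?s) = 0" if "r \<in> ?X" for r
        using K_mult_iff(1)[of "inv r" ?s] K_closed(2)[of r] subgroup_vN_support[OF A K, of r] s False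
        by (cases "r \<in> K") (auto simp: symb_def)
      then have "(\<Sum>\<^sub>\<infinity>r\<in>?X. ?a r * symb T (inv r \<otimes> ?s)) = 0" by (rule infsum_0)
      then show ?thesis using False by (simp add: symb_def)
    next
      case True
      have Tk: "T (ket \<sigma>) \<in> ell2 ?X" "ell2_norm ?X (T (ket \<sigma>)) \<le> C" if "\<sigma> \<in> K" for \<sigma>
        using op_closed[OF T] C(2)[of "ket \<sigma>"] KG[OF that] by (auto simp: ell2_norm_ket)
      let ?u = "\<lambda>\<sigma> r. T (ket \<sigma>) (inv r \<otimes> (?s \<otimes> \<sigma>))"
      have u: "(\<lambda>r. (cmod (?u \<sigma> r))\<^sup>2) summable_on ?X" "ell2_norm ?X (?u \<sigma>) \<le> C" if "\<sigma> \<in> K" for \<sigma>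
      proof -
        have b: "bij_betw (\<lambda>r. inv r \<otimes> (?s \<otimes> \<sigma>)) ?X ?X"
          by (rule bij_inv_r_mult) (use s KG[OF that] in simp)
        show "(\<lambda>r. (cmod (?u \<sigma> r))\<^sup>2) summable_on ?X"
          using summable_on_reindex_bij_betw[OF b, of "\<lambda>x. (cmod (T (ket \<sigma>) x))\<^sup>2"]
            ell2_summable[OF Tk(1)[OF that]] by simp
        show "ell2_norm ?X (?u \<sigma>) \<le> C"
          using ell2_norm_reindex[OF b, of "T (ket \<sigma>)"] Tk(2)[OF that] by simp
      qed
      have asum: "(\<lambda>r. (cmod (?a r))\<^sup>2) summable_on ?X"
        by (rule ell2_summable) (simp add: op_closed[OF AB])
      have "symb (op_comp ?X A T) ?s = cmean m (\<lambda>\<sigma>. op_comp ?X A T (ket \<sigma>) (?s \<otimes> \<sigma>))"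
        using True by (simp add: symb_def)
      also have "\<dots> = cmean m (\<lambda>\<sigma>. \<Sum>\<^sub>\<infinity>r\<in>?X. ?a r * ?u \<sigma> r)"
      proof (rule cmean_cong[OF mean coeff_bounded[OF op_comp_bounded[OF AB T] KG]])
        fix \<sigma> assume \<sigma>: "\<sigma> \<in> K"
        show "op_comp ?X A T (ket \<sigma>) (?s \<otimes> \<sigma>) = (\<Sum>\<^sub>\<infinity>r\<in>?X. ?a r * ?u \<sigma> r)"
          using conv[OF Tk(1)[OF \<sigma>], of "?s \<otimes> \<sigma>"] KG[OF \<sigma>] s by (simp add: op_comp_apply)
      qed
      also have "\<dots> = (\<Sum>\<^sub>\<infinity>r\<in>?X. ?a r * cmean m (\<lambda>\<sigma>. ?u \<sigma> r))"
        by (rule cmean_infsum[OF mean asum u C(1)])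
      also have "\<dots> = (\<Sum>\<^sub>\<infinity>r\<in>?X. ?a r * symb T (inv r \<otimes> ?s))"
      proof (rule infsum_cong)
        fix r assume r: "r \<in> ?X"
        show "?a r * cmean m (\<lambda>\<sigma>. ?u \<sigma> r) = ?a r * symb T (inv r \<otimes> ?s)"
        proof (cases "r \<in> K")
          case rK: True
          have "cmean m (\<lambda>\<sigma>. ?u \<sigma> r) = cmean m (\<lambda>\<sigma>. T (ket \<sigma>) (inv r \<otimes> ?s \<otimes> \<sigma>))"
            by (rule cmean_cong[OF mean coeff_bounded[OF T KG]]) (use r xy KG in \<open>simp_all add: m_assoc\<close>)
          then show ?thesis using rK True K_closed by (simp add: symb_def)
        qed (simp add: subgroup_vN_support[OF A K])
      qed
      finally show ?thesis ..
    qed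
    finally show "op_comp ?X A (expect T) (ket y) x = symb (op_comp ?X A T) ?s" .
  qed
qed

text \<open>Multiplication by B on this side replaces \<open>ket \<sigma>\<close> by
  \<open>ket (r \<otimes> \<sigma>)\<close>. Rows of T take the place of columns in the uniform
  bound, and left invariance of the mean undoes the shift by r.\<close>

lemma expect_right_module:
  assumes B: "B \<in> subgroup_vN G K" and T: "T \<in> bounded_operators (carrier G)"
  shows "expect (op_comp (carrier G) T B) = op_comp (carrier G) (expect T) B"
proof -
  let ?X = "carrier G" and ?b = "B (ket \<one>)"
  have BB: "B \<in> bounded_operators ?X" using B subgroup_vN_bounded by blast
  note coeff = subgroup_vN_coeff[OF B subgroup.subset[OF K]]
  obtain C where C: "0 \<le> C" "\<And>f. f \<in> ell2 ?X \<Longrightarrow> ell2_norm ?X (T f) \<le> C * ell2_norm ?X f"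
    using bounded_operatorE[OF T] by blast
  have conv: "S (B (ket y)) x = (\<Sum>\<^sub>\<infinity>r\<in>?X. ?b r * S (ket (r \<otimes> y)) x)"
    if S: "S \<in> bounded_operators ?X" and y: "y \<in> ?X" for S x y
  proof -
    have "S (B (ket y)) x = (\<Sum>\<^sub>\<infinity>z\<in>?X. B (ket y) z * S (ket z) x)"
      by (rule op_apply[OF S op_closed[OF BB]]) (use y in simp)
    also have "\<dots> = (\<Sum>\<^sub>\<infinity>r\<in>?X. B (ket y) (r \<otimes> y) * S (ket (r \<otimes> y)) x)"
      by (rule infsum_reindex_bij_betw[OF bij_r_mult[OF y], symmetric])
    also have "\<dots> = (\<Sum>\<^sub>\<infinity>r\<in>?X. ?b r * S (ket (r \<otimes> y)) x)"
    proof (rule infsum_cong)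
      fix r assume r: "r \<in> ?X"
      then show "B (ket y) (r \<otimes> y) * S (ket (r \<otimes> y)) x = ?b r * S (ket (r \<otimes> y)) x"
        using coeff[of "r \<otimes> y" y] y by (simp add: m_assoc)
    qed
    finally show ?thesis .
  qed
  show ?thesis
  proof (rule expect_eqI[OF op_comp_bounded[OF T BB] op_comp_bounded[OF expect(1)[OF T] BB]])
    fix x y assume xy: "x \<in> ?X" "y \<in> ?X"
    let ?s = "x \<otimes> inv y"
    have s: "?s \<in> ?X" using xy by simp
    have "op_comp ?X (expect T) B (ket y) x = (\<Sum>\<^sub>\<infinity>r\<in>?X. ?b r * expect T (ket (r \<otimes> y)) x)"
      using xy by (simp add: op_comp_apply conv[OF expect(1)[OF T]])
    also have "\<dots> = (\<Sum>\<^sub>\<infinity>r\<in>?X. ?b r * symb T (?s \<otimes> inv r))"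
      by (rule infsum_cong) (use xy in \<open>simp add: expect(2)[OF T] m_assoc inv_mult_group\<close>)
    also have "\<dots> = symb (op_comp ?X T B) ?s"
    proof (cases "?s \<in> K")
      case False
      have "?b r * symb T (?s \<otimes> inv r) = 0" if "r \<in> ?X" for r
        using K_mult_iff(2)[of "inv r" ?s] K_closed(2)[of r] subgroup_vN_support[OF B K, of r] s False
        by (cases "r \<in> K") (auto simp: symb_def)
      then have "(\<Sum>\<^sub>\<infinity>r\<in>?X. ?b r * symb T (?s \<otimes> inv r)) = 0" by (rule infsum_0)
      then show ?thesis using False by (simp add: symb_def)
    next
      case True
      let ?u = "\<lambda>\<sigma> r. T (ket (r \<otimes> \<sigma>)) (?s \<otimes> \<sigma>)"
      have u: "(\<lambda>r. (cmod (?u \<sigma> r))\<^sup>2) summable_on ?X" "ell2_norm ?X (?u \<sigma>) \<le> C" if "\<sigma> \<in> K" for \<sigma>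
      proof -
        have b: "bij_betw (\<lambda>r. r \<otimes> \<sigma>) ?X ?X" by (rule bij_r_mult[OF KG[OF that]])
        show "(\<lambda>r. (cmod (?u \<sigma> r))\<^sup>2) summable_on ?X"
          using summable_on_reindex_bij_betw[OF b, of "\<lambda>z. (cmod (T (ket z) (?s \<otimes> \<sigma>)))\<^sup>2"]
            op_row[OF T] by simp
        show "ell2_norm ?X (?u \<sigma>) \<le> C"
          using ell2_norm_reindex[OF b, of "\<lambda>z. T (ket z) (?s \<otimes> \<sigma>)"] op_row_bound(2)[OF T C] by simp
      qed
      have bsum: "(\<lambda>r. (cmod (?b r))\<^sup>2) summable_on ?X"
        by (rule ell2_summable) (simp add: op_closed[OF BB])
      have "symb (op_comp ?X T B) ?s = cmean m (\<lambda>\<sigma>. op_comp ?X T B (ket \<sigma>) (?s \<otimes> \<sigma>))"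
        using True by (simp add: symb_def)
      also have "\<dots> = cmean m (\<lambda>\<sigma>. \<Sum>\<^sub>\<infinity>r\<in>?X. ?b r * ?u \<sigma> r)"
      proof (rule cmean_cong[OF mean coeff_bounded[OF op_comp_bounded[OF T BB] KG]])
        fix \<sigma> assume \<sigma>: "\<sigma> \<in> K"
        show "op_comp ?X T B (ket \<sigma>) (?s \<otimes> \<sigma>) = (\<Sum>\<^sub>\<infinity>r\<in>?X. ?b r * ?u \<sigma> r)"
          using conv[OF T KG[OF \<sigma>]] KG[OF \<sigma>] by (simp add: op_comp_apply)
      qed
      also have "\<dots> = (\<Sum>\<^sub>\<infinity>r\<in>?X. ?b r * cmean m (\<lambda>\<sigma>. ?u \<sigma> r))"
        by (rule cmean_infsum[OF mean bsum u C(1)])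
      also have "\<dots> = (\<Sum>\<^sub>\<infinity>r\<in>?X. ?b r * symb T (?s \<otimes> inv r))"
      proof (rule infsum_cong)
        fix r assume r: "r \<in> ?X"
        show "?b r * cmean m (\<lambda>\<sigma>. ?u \<sigma> r) = ?b r * symb T (?s \<otimes> inv r)"
        proof (cases "r \<in> K")
          case rK: True
          have bd: "bounded ((\<lambda>\<sigma>. ?u \<sigma> r) ` K)" by (rule coeff_bounded[OF T]) (use r KG in simp)
          have "cmean m (\<lambda>\<sigma>. ?u \<sigma> r) = cmean m (\<lambda>\<sigma>. T (ket (r \<otimes> \<sigma>)) (?s \<otimes> inv r \<otimes> (r \<otimes> \<sigma>)))"
            by (rule cmean_cong[OF mean bd]) (use r s KG in \<open>simp add: m_assoc inv_cancel_left\<close>)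
          also have "\<dots> = cmean m (\<lambda>\<sigma>. T (ket \<sigma>) (?s \<otimes> inv r \<otimes> \<sigma>))"
            by (rule cmean_inv[OF rK coeff_bounded[OF T KG]])
          finally show ?thesis using rK True K_closed by (simp add: symb_def)
        qed (simp add: subgroup_vN_support[OF B K])
      qed
      finally show ?thesis ..
    qed
    finally show "op_comp ?X (expect T) B (ket y) x = symb (op_comp ?X T B) ?s" .
  qed
qed

lemma amenable_subgroup_vN: "amenable_vN_algebra (carrier G) (subgroup_vN G K)"
  unfolding amenable_vN_algebra_def
proof (intro conjI exI)
  show "von_neumann_algebra (carrier G) (subgroup_vN G K)"
    by (rule von_neumann_algebra_subgroup_vN[OF K])
  show "conditional_expectation (carrier G) (subgroup_vN G K) expect"
    unfolding conditional_expectation_def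
  proof (intro conjI ballI allI impI)
    fix A B T assume A: "A \<in> subgroup_vN G K" and B: "B \<in> subgroup_vN G K"
      and T: "T \<in> bounded_operators (carrier G)"
    have "B \<in> bounded_operators (carrier G)" using B subgroup_vN_bounded by blast
    then show "expect (op_comp (carrier G) A (op_comp (carrier G) T B)) =
        op_comp (carrier G) A (op_comp (carrier G) (expect T) B)"
      using A B T by (simp add: expect_left_module expect_right_module op_comp_bounded)
  qed (auto simp: expect_in expect_id expect_add expect_scale expect_positive)
qed

end

section \<open>Amenable groups\<close>

lemma mean_on_eval: "y \<in> Y \<Longrightarrow> mean_on Y (\<lambda>f. f y)"
  by (auto simp: mean_on_def)

text \<open>Compactness of the set of means: exact invariance is an intersection of closed
  conditions, one for each s and each error, any finitely many of which can be met together.\<close>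

lemma approx_invariant_imp_invariant_mean:
  fixes act :: "'g \<Rightarrow> 'x \<Rightarrow> 'x"
  assumes S: "S \<noteq> {}" and act: "\<And>s x. s \<in> S \<Longrightarrow> x \<in> Y \<Longrightarrow> act s x \<in> Y"
    and approx: "\<And>A \<epsilon>. finite A \<Longrightarrow> A \<subseteq> S \<Longrightarrow> 0 < \<epsilon> \<Longrightarrow>
      \<exists>m. mean_on Y m \<and> (\<forall>s\<in>A. \<forall>f C. (\<forall>x\<in>Y. \<bar>f x\<bar> \<le> C) \<longrightarrow> \<bar>m (\<lambda>x. f (act s x)) - m f\<bar> \<le> C * \<epsilon>)"
  shows "\<exists>m. mean_on Y m \<and> (\<forall>s\<in>S. \<forall>f. bounded (f ` Y) \<longrightarrow> m (\<lambda>x. f (act s x)) = m f)"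
proof -
  \<comment> \<open>The half-widths of a compact box for the means. Unbounded functions get width 0,
    which is why m is later replaced by m', equal to 0 on them.\<close>
  define B :: "('x \<Rightarrow> real) \<Rightarrow> real" where
    "B f = (if bounded (f ` Y) then SOME C. \<forall>x\<in>Y. \<bar>f x\<bar> \<le> C else 0)" for f
  have B: "\<forall>x\<in>Y. \<bar>f x\<bar> \<le> B f" if "bounded (f ` Y)" for f
  proof -
    have "\<exists>C. \<forall>x\<in>Y. \<bar>f x\<bar> \<le> C" using that unfolding bounded_iff by auto
    from someI_ex[OF this] show ?thesis using that by (simp add: B_def)
  qed
  define Z where "Z = (\<Pi>\<^sub>E f\<in>UNIV. {- B f..B f})"
  have "compact Z"
    unfolding Z_def compactin_euclidean_iff[symmetric] euclidean_product_topology[symmetric] compactin_PiE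
    by (auto simp: compactin_euclidean_iff)
  define K where "K = (\<lambda>(s, n::nat). {m. mean_on Y m \<and>
    (\<forall>f C. (\<forall>x\<in>Y. \<bar>f x\<bar> \<le> C) \<longrightarrow> \<bar>m (\<lambda>x. f (act s x)) - m f\<bar> \<le> C * inverse (real (Suc n)))})"
  have cont: "continuous_on UNIV (\<lambda>m. m f)" for f :: "'x \<Rightarrow> real" by simp
  have imp: "closed {m. P \<longrightarrow> Q m}" if "closed {m. Q m}" for P and Q :: "(('x \<Rightarrow> real) \<Rightarrow> real) \<Rightarrow> bool"
    using that by (cases P) auto
  have closed_K: "closed (K i)" for i
    unfolding K_def mean_on_def Ball_def
    by (cases i, simp only: prod.case)
       (intro closed_Collect_conj closed_Collect_all imp closed_Collect_eq closed_Collect_le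
          continuous_intros cont)
  have ne: "Z \<inter> (\<Inter>i\<in>I. K i) \<noteq> {}" if I: "finite I" "I \<subseteq> S \<times> UNIV" for I
  proof -
    define N where "N = (if I = {} then 0 else Max (snd ` I))"
    have N: "n \<le> N" if "(s, n) \<in> I" for s n
      using that I(1) by (auto simp: N_def intro!: Max_ge) force
    obtain m where m: "mean_on Y m"
      and inv: "\<And>s f C. s \<in> fst ` I \<Longrightarrow> \<forall>x\<in>Y. \<bar>f x\<bar> \<le> C \<Longrightarrow>
        \<bar>m (\<lambda>x. f (act s x)) - m f\<bar> \<le> C * inverse (real (Suc N))"
      using approx[of "fst ` I" "inverse (real (Suc N))"] I by fastforce
    define m' where "m' f = (if bounded (f ` Y) then m f else 0)" for f
    have m': "mean_on Y m'"
      using m bounded_image_add[of _ Y] bounded_image_scale[of _ Y] unfolding mean_on_def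
      by (simp add: m'_def)
    have "m' f \<in> {- B f..B f}" for f
    proof (cases "bounded (f ` Y)")
      case True
      then have "\<bar>m f\<bar> \<le> B f" using mean_bound[OF m, of f "B f"] B by blast
      then show ?thesis using True by (auto simp: m'_def)
    qed (simp add: m'_def B_def)
      then have "m' \<in> Z" unfolding Z_def PiE_UNIV_domain by blast
    moreover have "m' \<in> K (s, n)" if sn: "(s, n) \<in> I" for s n
    proof -
      have "\<bar>m' (\<lambda>x. f (act s x)) - m' f\<bar> \<le> C * inverse (real (Suc n))" if f: "\<forall>x\<in>Y. \<bar>f x\<bar> \<le> C" for f C
      \<comment> \<open>There is no mean on the empty set: the constant -1 would be vacuously
        nonnegative there and yet have mean -1.\<close>
      proof (cases "Y = {}")
        case True
        have "m (\<lambda>x. - 1) \<ge> 0" by (rule mean_nonneg[OF m]) (auto simp: True)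
        then show ?thesis using mean_const[OF m, of "-1"] by simp
      next
        case False
        then have C: "0 \<le> C" using f by fastforce
        have s: "s \<in> S" using sn I by auto
        have "bounded (f ` Y)" "bounded ((\<lambda>x. f (act s x)) ` Y)"
          using f act[OF s] by (auto intro!: bounded_image_real[of _ _ C])
        then have "\<bar>m' (\<lambda>x. f (act s x)) - m' f\<bar> \<le> C * inverse (real (Suc N))"
          using inv[of s f C] sn f by (force simp: m'_def)
        also have "\<dots> \<le> C * inverse (real (Suc n))"
          using N[OF sn] C by (intro mult_left_mono le_imp_inverse_le) auto
        finally show ?thesis .
      qed
      then show ?thesis using m' by (simp add: K_def)
    qed
    ultimately show ?thesis by auto
  qed
  have "Z \<inter> (\<Inter>i\<in>S \<times> UNIV. K i) \<noteq> {}"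
    by (rule compact_imp_fip_image[OF \<open>compact Z\<close> closed_K ne])
  then obtain m where m: "\<And>s n. s \<in> S \<Longrightarrow> m \<in> K (s, n)" by fastforce
  have "m (\<lambda>x. f (act s x)) = m f" if s: "s \<in> S" and f: "bounded (f ` Y)" for s f
  proof -
    have "\<bar>m (\<lambda>x. f (act s x)) - m f\<bar> \<le> B f * inverse (real (Suc n))" for n
      using m[OF s, of n] B[OF f] by (simp add: K_def)
    moreover have "(\<lambda>n. B f * inverse (real (Suc n))) \<longlonglongrightarrow> 0"
      using tendsto_mult[OF tendsto_const LIMSEQ_inverse_real_of_nat, of "B f"] by simp
    ultimately have "\<bar>m (\<lambda>x. f (act s x)) - m f\<bar> \<le> 0"
      by (intro LIMSEQ_le_const) auto
    then show ?thesis by simp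
  qed
  moreover have "mean_on Y m" using m S by (fastforce simp: K_def)
  ultimately show ?thesis by blast
qed

text \<open>For one element s at a time, a mean is composed with the average over the powers of s
  with exponents 0 to n. Telescoping gives invariance under s up to 2 C / (n + 1), commutativity
  preserves what was reached for earlier elements, and compactness makes the invariance
  exact.\<close>

lemma comm_group_amenable:
  assumes "comm_group G"
  shows "amenable_group G"
proof -
  interpret comm_group G by fact
  let ?X = "carrier G"
  have approx: "\<exists>m. mean_on ?X m \<and> (\<forall>s\<in>A. \<forall>f C. (\<forall>x\<in>?X. \<bar>f x\<bar> \<le> C) \<longrightarrow>
      \<bar>m (\<lambda>x. f (s \<otimes>\<^bsub>G\<^esub> x)) - m f\<bar> \<le> C * (2 / real (Suc n)))"
    if "finite A" "A \<subseteq> ?X" for A n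
    using that
  proof (induction A)
    case empty
    show ?case using mean_on_eval[of "\<one>\<^bsub>G\<^esub>" ?X] by auto
  next
    case (insert s A)
    then obtain m where m: "mean_on ?X m" and inv: "\<And>t f C. t \<in> A \<Longrightarrow> \<forall>x\<in>?X. \<bar>f x\<bar> \<le> C \<Longrightarrow>
      \<bar>m (\<lambda>x. f (t \<otimes>\<^bsub>G\<^esub> x)) - m f\<bar> \<le> C * (2 / real (Suc n))" by auto
    have s: "s \<in> ?X" using insert by auto
    define M where "M f x = (1 / real (Suc n)) * (\<Sum>i<Suc n. f (s [^]\<^bsub>G\<^esub> i \<otimes>\<^bsub>G\<^esub> x))" for f :: "'a \<Rightarrow> real" and x
    have Mb: "\<bar>M f x\<bar> \<le> C" if f: "\<And>x. x \<in> ?X \<Longrightarrow> \<bar>f x\<bar> \<le> C" and x: "x \<in> ?X" for f C x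
    proof -
      have "\<bar>\<Sum>i<Suc n. f (s [^]\<^bsub>G\<^esub> i \<otimes>\<^bsub>G\<^esub> x)\<bar> \<le> (\<Sum>i<Suc n. C)"
        by (rule order_trans[OF sum_abs sum_mono]) (use f s x in auto)
      then have "(1 / real (Suc n)) * \<bar>\<Sum>i<Suc n. f (s [^]\<^bsub>G\<^esub> i \<otimes>\<^bsub>G\<^esub> x)\<bar> \<le> (1 / real (Suc n)) * (real (Suc n) * C)"
        by (intro mult_left_mono) auto
      then show ?thesis by (simp add: M_def abs_mult del: sum.lessThan_Suc)
    qed
    have Mbd: "bounded (M f ` ?X)" if f: "bounded (f ` ?X)" for f
    proof -
      obtain C where "\<And>x. x \<in> ?X \<Longrightarrow> \<bar>f x\<bar> \<le> C" using f unfolding bounded_iff by auto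
      then show ?thesis using Mb by (intro bounded_image_real[of _ _ C]) auto
    qed
    have m': "mean_on ?X (\<lambda>f. m (M f))"
      unfolding mean_on_def
    proof (intro conjI allI impI)
      fix f g :: "'a \<Rightarrow> real" assume "bounded (f ` ?X)" "bounded (g ` ?X)"
      moreover have "M (\<lambda>x. f x + g x) = (\<lambda>x. M f x + M g x)"
        by (simp add: M_def fun_eq_iff sum.distrib distrib_left del: sum.lessThan_Suc)
      ultimately show "m (M (\<lambda>x. f x + g x)) = m (M f) + m (M g)"
        using mean_add[OF m Mbd Mbd, of f g] by simp
    next
      fix c and f :: "'a \<Rightarrow> real" assume "bounded (f ` ?X)"
      moreover have "M (\<lambda>x. c * f x) = (\<lambda>x. c * M f x)"
        by (simp add: M_def fun_eq_iff sum_distrib_left mult.left_commute del: sum.lessThan_Suc)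
      ultimately show "m (M (\<lambda>x. c * f x)) = c * m (M f)"
        using mean_scale[OF m Mbd, of f c] by simp
    next
      fix f :: "'a \<Rightarrow> real" assume "bounded (f ` ?X)" "\<forall>x\<in>?X. 0 \<le> f x"
      then show "0 \<le> m (M f)"
        using s unfolding M_def
        by (intro mean_nonneg[OF m Mbd[unfolded M_def]] mult_nonneg_nonneg sum_nonneg) auto
    next
      have "M (\<lambda>x. 1) = (\<lambda>x. 1)" by (simp add: M_def fun_eq_iff del: sum.lessThan_Suc)
      then show "m (M (\<lambda>x. 1)) = 1" by (simp add: mean_const[OF m])
    qed
    have "\<bar>m (M (\<lambda>x. f (t \<otimes>\<^bsub>G\<^esub> x))) - m (M f)\<bar> \<le> C * (2 / real (Suc n))"
      if t: "t \<in> insert s A" and f: "\<forall>x\<in>?X. \<bar>f x\<bar> \<le> C" for t f C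
    proof (cases "t \<in> A")
      case True
      have tX: "t \<in> ?X" using t insert by auto
      have bf: "bounded ((\<lambda>x. f (t \<otimes>\<^bsub>G\<^esub> x)) ` ?X)"
        using f tX by (intro bounded_image_real[of _ _ C]) auto
      have "m (M (\<lambda>x. f (t \<otimes>\<^bsub>G\<^esub> x))) = m (\<lambda>x. M f (t \<otimes>\<^bsub>G\<^esub> x))"
        by (rule mean_cong[OF m Mbd[OF bf]])
           (use s tX in \<open>simp add: M_def m_lcomm[of t] del: sum.lessThan_Suc\<close>)
      then show ?thesis using inv[OF True, of "M f" C] Mb f by auto
    next
      case False
      then have t: "t = s" using t by simp
      have bf: "bounded (f ` ?X)" "bounded ((\<lambda>x. f (s \<otimes>\<^bsub>G\<^esub> x)) ` ?X)"
        using f s by (auto intro!: bounded_image_real[of _ _ C])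
      have "m (M (\<lambda>x. f (s \<otimes>\<^bsub>G\<^esub> x))) - m (M f) = m (\<lambda>x. M (\<lambda>x. f (s \<otimes>\<^bsub>G\<^esub> x)) x - M f x)"
        by (rule mean_diff[OF m Mbd[OF bf(2)] Mbd[OF bf(1)], symmetric])
      also have "\<bar>\<dots>\<bar> \<le> C * (2 / real (Suc n))"
      proof (rule mean_bound[OF m])
        fix x assume x: "x \<in> ?X"
        have "s \<otimes>\<^bsub>G\<^esub> (s [^]\<^bsub>G\<^esub> i \<otimes>\<^bsub>G\<^esub> x) = s [^]\<^bsub>G\<^esub> Suc i \<otimes>\<^bsub>G\<^esub> x" for i :: nat
          using s x by (simp add: m_assoc m_lcomm[of s])
        then have "M (\<lambda>x. f (s \<otimes>\<^bsub>G\<^esub> x)) x - M f x = (1 / real (Suc n)) *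
            ((\<Sum>i<Suc n. f (s [^]\<^bsub>G\<^esub> Suc i \<otimes>\<^bsub>G\<^esub> x) - f (s [^]\<^bsub>G\<^esub> i \<otimes>\<^bsub>G\<^esub> x)))"
          by (simp add: M_def sum_subtractf right_diff_distrib del: sum.lessThan_Suc nat_pow_Suc)
        also have "\<dots> = (1 / real (Suc n)) * (f (s [^]\<^bsub>G\<^esub> Suc n \<otimes>\<^bsub>G\<^esub> x) - f x)"
          using x sum_lessThan_telescope[of "\<lambda>i. f (s [^]\<^bsub>G\<^esub> i \<otimes>\<^bsub>G\<^esub> x)" "Suc n"]
          by (simp del: sum.lessThan_Suc nat_pow_Suc)
        finally have "\<bar>M (\<lambda>x. f (s \<otimes>\<^bsub>G\<^esub> x)) x - M f x\<bar>
            = (1 / real (Suc n)) * \<bar>f (s [^]\<^bsub>G\<^esub> Suc n \<otimes>\<^bsub>G\<^esub> x) - f x\<bar>"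
          by (simp add: abs_mult)
        also have "\<bar>f (s [^]\<^bsub>G\<^esub> Suc n \<otimes>\<^bsub>G\<^esub> x) - f x\<bar> \<le> 2 * C"
          using f x s by (smt (verit) m_closed nat_pow_closed)
        finally show "\<bar>M (\<lambda>x. f (s \<otimes>\<^bsub>G\<^esub> x)) x - M f x\<bar> \<le> C * (2 / real (Suc n))"
          by (simp add: mult_left_mono divide_right_mono mult.commute)
      qed
      finally show ?thesis by (simp add: t)
    qed
    then show ?case using m' by blast
  qed
  have "\<exists>m. mean_on ?X m \<and> (\<forall>s\<in>?X. \<forall>f. bounded (f ` ?X) \<longrightarrow> m (\<lambda>x. f (s \<otimes>\<^bsub>G\<^esub> x)) = m f)"
  proof (rule approx_invariant_imp_invariant_mean)
    fix A and \<epsilon> :: real assume A: "finite A" "A \<subseteq> ?X" and \<epsilon>: "0 < \<epsilon>"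
    obtain n where n: "inverse (real (Suc n)) < \<epsilon> / 2" using reals_Archimedean[of "\<epsilon> / 2"] \<epsilon> by auto
    have "C * (2 / real (Suc n)) \<le> C * \<epsilon>" if "\<forall>x\<in>?X. \<bar>f x\<bar> \<le> C" for f :: "'a \<Rightarrow> real" and C
    proof -
      have "0 \<le> C" using that by (metis abs_ge_zero one_closed order_trans)
      then show ?thesis using n by (intro mult_left_mono) (auto simp: inverse_eq_divide)
    qed
    then show "\<exists>m. mean_on ?X m \<and> (\<forall>s\<in>A. \<forall>f C. (\<forall>x\<in>?X. \<bar>f x\<bar> \<le> C) \<longrightarrow>
        \<bar>m (\<lambda>x. f (s \<otimes>\<^bsub>G\<^esub> x)) - m f\<bar> \<le> C * \<epsilon>)"
      using approx[OF A, of n] by (meson order_trans)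
  qed auto
  then show ?thesis
    unfolding amenable_group_def invariant_mean_iff using is_group by blast
qed

section \<open>Iterated means and extensions of amenable groups\<close>

definition iter_mean ::
  "(('q \<Rightarrow> real) \<Rightarrow> real) \<Rightarrow> (('n \<Rightarrow> real) \<Rightarrow> real) \<Rightarrow> ('q \<Rightarrow> 'n \<Rightarrow> 'x) \<Rightarrow> ('x \<Rightarrow> real) \<Rightarrow> real" where
  "iter_mean mQ mN j f = mQ (\<lambda>q. mN (\<lambda>n. f (j q n)))"

text \<open>The action may translate the fibre N by an amount depending on the base point q: the
  inner mean absorbs this for each q, and then the outer mean absorbs p. Direct sums, wreath
  products and triangular matrices all have this form.\<close>

lemma iter_mean:
  fixes j :: "'q \<Rightarrow> 'n \<Rightarrow> 'x"
  assumes mQ: "mean_on Q mQ" and mN: "mean_on N mN"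
    and j: "\<And>q n. q \<in> Q \<Longrightarrow> n \<in> N \<Longrightarrow> j q n \<in> Y"
  shows "mean_on Y (iter_mean mQ mN j)"
    and "\<lbrakk>\<And>q. q \<in> Q \<Longrightarrow> p q \<in> Q; \<And>f. bounded (f ` Q) \<Longrightarrow> mQ (\<lambda>q. f (p q)) = mQ f;
      \<And>q f. q \<in> Q \<Longrightarrow> bounded (f ` N) \<Longrightarrow> mN (\<lambda>n. f (t q n)) = mN f;
      \<And>q n. q \<in> Q \<Longrightarrow> n \<in> N \<Longrightarrow> act (j q n) = j (p q) (t q n);
      \<And>y. y \<in> Y \<Longrightarrow> act y \<in> Y; bounded (f ` Y)\<rbrakk>
      \<Longrightarrow> iter_mean mQ mN j (\<lambda>x. f (act x)) = iter_mean mQ mN j f"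
proof -
  have bN: "bounded ((\<lambda>n. f (j q n)) ` N)" if "bounded (f ` Y)" "q \<in> Q" for f :: "'x \<Rightarrow> real" and q
    by (rule bounded_subset[OF that(1)]) (use j that in auto)
  have bQ: "bounded ((\<lambda>q. mN (\<lambda>n. f (j q n))) ` Q)" if f: "bounded (f ` Y)" for f :: "'x \<Rightarrow> real"
  proof -
    obtain C where "\<And>x. x \<in> Y \<Longrightarrow> \<bar>f x\<bar> \<le> C" using f unfolding bounded_iff by auto
    then show ?thesis using j by (intro bounded_image_real[of _ _ C] mean_bound[OF mN]) auto
  qed
  show "mean_on Y (iter_mean mQ mN j)"
    unfolding mean_on_def iter_mean_def
  proof (intro conjI allI impI)
    fix f g :: "'x \<Rightarrow> real" assume f: "bounded (f ` Y)" and g: "bounded (g ` Y)"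
    have "mQ (\<lambda>q. mN (\<lambda>n. f (j q n) + g (j q n))) = mQ (\<lambda>q. mN (\<lambda>n. f (j q n)) + mN (\<lambda>n. g (j q n)))"
      by (rule mean_cong[OF mQ bQ[OF bounded_image_add[OF f g]]]) (rule mean_add[OF mN bN[OF f] bN[OF g]])
    also have "\<dots> = mQ (\<lambda>q. mN (\<lambda>n. f (j q n))) + mQ (\<lambda>q. mN (\<lambda>n. g (j q n)))"
      by (rule mean_add[OF mQ bQ[OF f] bQ[OF g]])
    finally show "mQ (\<lambda>q. mN (\<lambda>n. f (j q n) + g (j q n))) =
        mQ (\<lambda>q. mN (\<lambda>n. f (j q n))) + mQ (\<lambda>q. mN (\<lambda>n. g (j q n)))" .
  next
    fix c and f :: "'x \<Rightarrow> real" assume f: "bounded (f ` Y)"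
    have "mQ (\<lambda>q. mN (\<lambda>n. c * f (j q n))) = mQ (\<lambda>q. c * mN (\<lambda>n. f (j q n)))"
      by (rule mean_cong[OF mQ bQ[OF bounded_image_scale[OF f]]]) (rule mean_scale[OF mN bN[OF f]])
    also have "\<dots> = c * mQ (\<lambda>q. mN (\<lambda>n. f (j q n)))"
      by (rule mean_scale[OF mQ bQ[OF f]])
    finally show "mQ (\<lambda>q. mN (\<lambda>n. c * f (j q n))) = c * mQ (\<lambda>q. mN (\<lambda>n. f (j q n)))" .
  next
    fix f :: "'x \<Rightarrow> real" assume f: "bounded (f ` Y)" "\<forall>x\<in>Y. 0 \<le> f x"
    show "0 \<le> mQ (\<lambda>q. mN (\<lambda>n. f (j q n)))"
      by (intro mean_nonneg[OF mQ bQ[OF f(1)]] mean_nonneg[OF mN bN[OF f(1)]]) (use f j in auto)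
  next
    show "mQ (\<lambda>q. mN (\<lambda>n. 1)) = 1" by (simp add: mean_const[OF mQ] mean_const[OF mN])
  qed
  assume p: "\<And>q. q \<in> Q \<Longrightarrow> p q \<in> Q" and pinv: "\<And>f. bounded (f ` Q) \<Longrightarrow> mQ (\<lambda>q. f (p q)) = mQ f"
    and tinv: "\<And>q f. q \<in> Q \<Longrightarrow> bounded (f ` N) \<Longrightarrow> mN (\<lambda>n. f (t q n)) = mN f"
    and act: "\<And>q n. q \<in> Q \<Longrightarrow> n \<in> N \<Longrightarrow> act (j q n) = j (p q) (t q n)"
    and actY: "\<And>y. y \<in> Y \<Longrightarrow> act y \<in> Y" and f: "bounded (f ` Y)"
  have fa: "bounded ((\<lambda>x. f (act x)) ` Y)"
    by (rule bounded_subset[OF f]) (use actY in auto)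
  have "mN (\<lambda>n. f (act (j q n))) = mN (\<lambda>n. f (j (p q) n))" if q: "q \<in> Q" for q
  proof -
    have "mN (\<lambda>n. f (act (j q n))) = mN (\<lambda>n. f (j (p q) (t q n)))"
      by (rule mean_cong[OF mN bN[OF fa q]]) (simp add: act q)
    also have "\<dots> = mN (\<lambda>n. f (j (p q) n))"
      by (rule tinv[OF q bN[OF f p[OF q]]])
    finally show ?thesis .
  qed
  then have "iter_mean mQ mN j (\<lambda>x. f (act x)) = mQ (\<lambda>q. mN (\<lambda>n. f (j (p q) n)))"
    unfolding iter_mean_def by (intro mean_cong[OF mQ bQ[OF fa]])
  also have "\<dots> = iter_mean mQ mN j f"
    unfolding iter_mean_def by (rule pinv[OF bQ[OF f]])
  finally show "iter_mean mQ mN j (\<lambda>x. f (act x)) = iter_mean mQ mN j f" .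
qed

lemma sum_group_memI:
  assumes "group A" "\<And>i. i \<in> I \<Longrightarrow> a i \<in> carrier A" "\<And>i. i \<notin> I \<Longrightarrow> a i = undefined"
    "finite {i \<in> I. a i \<noteq> \<one>\<^bsub>A\<^esub>}"
  shows "a \<in> carrier (sum_group I (\<lambda>_. A))"
  using assms by (auto simp: carrier_sum_group PiE_iff extensional_def)

lemma sum_group_memD:
  assumes "group A" "a \<in> carrier (sum_group I (\<lambda>_. A))"
  shows "i \<in> I \<Longrightarrow> a i \<in> carrier A" "i \<notin> I \<Longrightarrow> a i = undefined" "finite {i \<in> I. a i \<noteq> \<one>\<^bsub>A\<^esub>}"
  using assms by (auto simp: carrier_sum_group PiE_iff extensional_def)

text \<open>Invariance under elements supported in a finite F is built up one coordinate at a time.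
  A finite set of elements has finite joint support, so compactness finishes.\<close>

lemma amenable_sum_group:
  fixes A :: "('a, 'm) monoid_scheme" and I :: "'i set"
  assumes A: "amenable_group A"
  shows "amenable_group (sum_group I (\<lambda>_. A))"
proof -
  note [simp del] = mult_sum_group one_sum_group
  interpret A: group A using A by (simp add: amenable_group_def)
  let ?S = "sum_group I (\<lambda>_. A)"
  interpret S: group ?S by (simp add: A.is_group)
  obtain \<mu> where \<mu>: "mean_on (carrier A) \<mu>"
    and \<mu>inv: "\<And>g f. g \<in> carrier A \<Longrightarrow> bounded (f ` carrier A) \<Longrightarrow> \<mu> (\<lambda>x. f (g \<otimes>\<^bsub>A\<^esub> x)) = \<mu> f"
    using A unfolding amenable_group_def invariant_mean_iff by blast
  note memD = sum_group_memD[OF A.is_group]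
  have fin: "\<exists>m. mean_on (carrier ?S) m \<and> (\<forall>e\<in>carrier ?S. (\<forall>i\<in>I - F. e i = \<one>\<^bsub>A\<^esub>) \<longrightarrow>
      (\<forall>f. bounded (f ` carrier ?S) \<longrightarrow> m (\<lambda>x. f (e \<otimes>\<^bsub>?S\<^esub> x)) = m f))" if "finite F" "F \<subseteq> I" for F
    using that
  proof (induction F)
    case empty
    have *: "e = \<one>\<^bsub>?S\<^esub>" if "e \<in> carrier ?S" "\<forall>i\<in>I. e i = \<one>\<^bsub>A\<^esub>" for e
      using memD(2)[OF that(1)] that(2) by (auto simp: fun_eq_iff one_sum_group)
    have "f (e \<otimes>\<^bsub>?S\<^esub> \<one>\<^bsub>?S\<^esub>) = f \<one>\<^bsub>?S\<^esub>"
      if e: "e \<in> carrier ?S" "\<forall>i\<in>I - {}. e i = \<one>\<^bsub>A\<^esub>" for e and f :: "('i \<Rightarrow> 'a) \<Rightarrow> real"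
    proof -
      have "e = \<one>\<^bsub>?S\<^esub>" using e by (intro *) auto
      then show ?thesis by (simp only: S.r_one[OF S.one_closed])
    qed
    then show ?case using mean_on_eval[OF S.one_closed] by blast
  next
    case (insert p F)
    then obtain m where m: "mean_on (carrier ?S) m"
      and minv: "\<And>e f. e \<in> carrier ?S \<Longrightarrow> \<forall>i\<in>I - F. e i = \<one>\<^bsub>A\<^esub> \<Longrightarrow> bounded (f ` carrier ?S) \<Longrightarrow>
        m (\<lambda>x. f (e \<otimes>\<^bsub>?S\<^esub> x)) = m f" by auto
    have p: "p \<in> I" using insert by auto
    \<comment> \<open>Multiplying coordinate p on the left by z lets an element e act on z through
      its value at p, and on a through its remaining coordinates.\<close>
    define j where "j z a = a(p := z \<otimes>\<^bsub>A\<^esub> a p)" for z and a :: "'i \<Rightarrow> 'a"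
    have upd: "a(p := z) \<in> carrier ?S" if a: "a \<in> carrier ?S" and z: "z \<in> carrier A" for a z
    proof (rule sum_group_memI[OF A.is_group])
      show "finite {i \<in> I. (a(p := z)) i \<noteq> \<one>\<^bsub>A\<^esub>}"
        by (rule finite_subset[of _ "insert p {i \<in> I. a i \<noteq> \<one>\<^bsub>A\<^esub>}"]) (use memD(3)[OF a] in auto)
    qed (use p z memD[OF a] in auto)
    have j: "j z a \<in> carrier ?S" if "z \<in> carrier A" "a \<in> carrier ?S" for z a
      unfolding j_def using that memD(1)[OF that(2) p] by (intro upd) auto
    have inv: "iter_mean \<mu> m j (\<lambda>x. f (e \<otimes>\<^bsub>?S\<^esub> x)) = iter_mean \<mu> m j f"
      if e: "e \<in> carrier ?S" "\<forall>i\<in>I - insert p F. e i = \<one>\<^bsub>A\<^esub>" and f: "bounded (f ` carrier ?S)" for e f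
    proof (rule iter_mean(2)[OF \<mu> m j, where p = "\<lambda>z. e p \<otimes>\<^bsub>A\<^esub> z"
          and t = "\<lambda>_ a. e(p := \<one>\<^bsub>A\<^esub>) \<otimes>\<^bsub>?S\<^esub> a"])
      have ep: "e p \<in> carrier A" by (rule memD(1)[OF e(1) p])
      show "e p \<otimes>\<^bsub>A\<^esub> z \<in> carrier A" if "z \<in> carrier A" for z using ep that by simp
      show "\<mu> (\<lambda>z. h (e p \<otimes>\<^bsub>A\<^esub> z)) = \<mu> h" if "bounded (h ` carrier A)" for h
        by (rule \<mu>inv[OF ep that])
      show "m (\<lambda>a. h (e(p := \<one>\<^bsub>A\<^esub>) \<otimes>\<^bsub>?S\<^esub> a)) = m h" if "bounded (h ` carrier ?S)" for h
        by (rule minv[OF upd[OF e(1)] _ that]) (use e(2) in auto)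
      show "e \<otimes>\<^bsub>?S\<^esub> j z a = j (e p \<otimes>\<^bsub>A\<^esub> z) (e(p := \<one>\<^bsub>A\<^esub>) \<otimes>\<^bsub>?S\<^esub> a)"
        if z: "z \<in> carrier A" and a: "a \<in> carrier ?S" for z a
        using p ep z memD(1)[OF a p] by (auto simp: j_def fun_eq_iff A.m_assoc mult_sum_group)
      show "e \<otimes>\<^bsub>?S\<^esub> a \<in> carrier ?S" if "a \<in> carrier ?S" for a by (rule S.m_closed[OF e(1) that])
    qed (use f in auto)
    have "mean_on (carrier ?S) (iter_mean \<mu> m j)" by (rule iter_mean(1)[OF \<mu> m j])
    then show ?case using inv by (intro exI[of _ "iter_mean \<mu> m j"]) blast
  qed
  have "\<exists>m. mean_on (carrier ?S) m \<and>
      (\<forall>s\<in>carrier ?S. \<forall>f. bounded (f ` carrier ?S) \<longrightarrow> m (\<lambda>x. f (s \<otimes>\<^bsub>?S\<^esub> x)) = m f)"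
  proof (rule approx_invariant_imp_invariant_mean)
    fix E and \<epsilon> :: real assume E: "finite E" "E \<subseteq> carrier ?S" and \<epsilon>: "0 < \<epsilon>"
    let ?F = "\<Union>e\<in>E. {i \<in> I. e i \<noteq> \<one>\<^bsub>A\<^esub>}"
    have F: "finite ?F" "?F \<subseteq> I" using E memD(3) by auto
    obtain m where m: "mean_on (carrier ?S) m"
      and minv: "\<And>e f. e \<in> carrier ?S \<Longrightarrow> \<forall>i\<in>I - ?F. e i = \<one>\<^bsub>A\<^esub> \<Longrightarrow> bounded (f ` carrier ?S) \<Longrightarrow>
        m (\<lambda>x. f (e \<otimes>\<^bsub>?S\<^esub> x)) = m f" using fin[OF F] by blast
    have "\<bar>m (\<lambda>x. f (e \<otimes>\<^bsub>?S\<^esub> x)) - m f\<bar> \<le> C * \<epsilon>" if e: "e \<in> E" and f: "\<forall>x\<in>carrier ?S. \<bar>f x\<bar> \<le> C" for e f C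
    proof -
      have "bounded (f ` carrier ?S)" using f by (intro bounded_image_real[of _ _ C]) auto
      then have "m (\<lambda>x. f (e \<otimes>\<^bsub>?S\<^esub> x)) = m f" using e E by (intro minv) auto
      moreover have "0 \<le> C" using f S.one_closed by (metis abs_ge_zero order_trans)
      ultimately show ?thesis using \<epsilon> by simp
    qed
    then show "\<exists>m. mean_on (carrier ?S) m \<and> (\<forall>s\<in>E. \<forall>f C. (\<forall>x\<in>carrier ?S. \<bar>f x\<bar> \<le> C) \<longrightarrow>
        \<bar>m (\<lambda>x. f (s \<otimes>\<^bsub>?S\<^esub> x)) - m f\<bar> \<le> C * \<epsilon>)" using m by (intro exI[of _ m]) blast
  qed (use S.one_closed S.m_closed in auto)
  then show ?thesis
    unfolding amenable_group_def invariant_mean_iff using S.is_group by blast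
qed

section \<open>Wreath products\<close>

lemma shift_mult:
  "g \<in> carrier G \<Longrightarrow> group G \<Longrightarrow> shift G g (a \<otimes>\<^bsub>sum_group (carrier G) (\<lambda>_. A)\<^esub> b) =
    shift G g a \<otimes>\<^bsub>sum_group (carrier G) (\<lambda>_. A)\<^esub> shift G g b"
  by (auto simp: shift_def fun_eq_iff group.is_monoid group.inv_closed monoid.m_closed)

lemma shift_shift:
  assumes "group G" "g \<in> carrier G" "h \<in> carrier G"
  shows "shift G g (shift G h a) = shift G (g \<otimes>\<^bsub>G\<^esub> h) a"
proof -
  interpret group G by fact
  show ?thesis using assms by (auto simp: shift_def fun_eq_iff inv_mult_group m_assoc)
qed

lemma shift_one:
  assumes "group G" "group A" "a \<in> carrier (sum_group (carrier G) (\<lambda>_. A))"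
  shows "shift G \<one>\<^bsub>G\<^esub> a = a"
proof -
  interpret group G by fact
  show ?thesis using sum_group_memD(2)[OF assms(2,3)] by (auto simp: shift_def fun_eq_iff)
qed

lemma amenable_wreath_over:
  fixes A :: "('a, 'l) monoid_scheme" and G :: "('g, 'm) monoid_scheme"
  assumes A: "amenable_group A" and G: "group G" and H: "subgroup H G"
    and \<mu>: "mean_on H \<mu>" and \<mu>inv: "\<And>k f. k \<in> H \<Longrightarrow> bounded (f ` H) \<Longrightarrow> \<mu> (\<lambda>x. f (k \<otimes>\<^bsub>G\<^esub> x)) = \<mu> f"
  shows "amenable_group (wreath_over A G H)"
proof -
  let ?S = "sum_group (carrier G) (\<lambda>_. A)" and ?W = "wreath_over A G H"
  have gA: "group A" using A by (simp add: amenable_group_def)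
  interpret G: group G by fact
  interpret H: subgroup H G by fact
  interpret W: group ?W by (rule group_wreath_over[OF gA G H])
  obtain m where m: "mean_on (carrier ?S) m"
    and minv: "\<And>g f. g \<in> carrier ?S \<Longrightarrow> bounded (f ` carrier ?S) \<Longrightarrow> m (\<lambda>x. f (g \<otimes>\<^bsub>?S\<^esub> x)) = m f"
    using amenable_sum_group[OF A, of "carrier G"] unfolding amenable_group_def invariant_mean_iff by blast
  \<comment> \<open>This is the product of h and a in that order, not the pair (a, h). Left
    multiplication by (b, k) then moves h to k h and translates a by a shift of b.\<close>
  define j where "j h a = (shift G h a, h)" for h and a :: "'g \<Rightarrow> 'a"
  note sc = shift_closed[OF gA G]
  have j: "j h a \<in> carrier ?W" if "h \<in> H" "a \<in> carrier ?S" for h a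
    using that sc[of h a] by (auto simp: j_def wreath_over_def)
  have "iter_mean \<mu> m j (\<lambda>x. f (w \<otimes>\<^bsub>?W\<^esub> x)) = iter_mean \<mu> m j f"
    if w: "w \<in> carrier ?W" and f: "bounded (f ` carrier ?W)" for w f
  proof -
    obtain b k where bk: "w = (b, k)" "b \<in> carrier ?S" "k \<in> H" using w by (auto simp: wreath_over_def)
    have kG: "k \<in> carrier G" using bk by auto
    show ?thesis
    proof (rule iter_mean(2)[OF \<mu> m j, where p = "\<lambda>h. k \<otimes>\<^bsub>G\<^esub> h"
          and t = "\<lambda>h a. shift G (inv\<^bsub>G\<^esub> (k \<otimes>\<^bsub>G\<^esub> h)) b \<otimes>\<^bsub>?S\<^esub> a"])
      show "k \<otimes>\<^bsub>G\<^esub> h \<in> H" if "h \<in> H" for h using bk that by simp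
      show "\<mu> (\<lambda>h. f (k \<otimes>\<^bsub>G\<^esub> h)) = \<mu> f" if "bounded (f ` H)" for f by (rule \<mu>inv[OF bk(3) that])
      show "m (\<lambda>a. f (shift G (inv\<^bsub>G\<^esub> (k \<otimes>\<^bsub>G\<^esub> h)) b \<otimes>\<^bsub>?S\<^esub> a)) = m f"
        if "h \<in> H" "bounded (f ` carrier ?S)" for h f
        by (rule minv[OF sc that(2)]) (use bk that in auto)
      show "w \<otimes>\<^bsub>?W\<^esub> j h a = j (k \<otimes>\<^bsub>G\<^esub> h) (shift G (inv\<^bsub>G\<^esub> (k \<otimes>\<^bsub>G\<^esub> h)) b \<otimes>\<^bsub>?S\<^esub> a)"
        if h: "h \<in> H" and a: "a \<in> carrier ?S" for h a
      proof -
        have hG: "h \<in> carrier G" using h by auto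
        have "shift G (k \<otimes>\<^bsub>G\<^esub> h) (shift G (inv\<^bsub>G\<^esub> (k \<otimes>\<^bsub>G\<^esub> h)) b \<otimes>\<^bsub>?S\<^esub> a)
            = b \<otimes>\<^bsub>?S\<^esub> shift G k (shift G h a)"
          using hG kG bk(2) gA by (simp add: shift_mult[OF _ G] shift_shift[OF G] shift_one[OF G gA] del: mult_sum_group)
        then show ?thesis by (simp add: j_def bk(1) wreath_over_def del: mult_sum_group)
      qed
    qed (use w f in auto)
  qed
  moreover have "mean_on (carrier ?W) (iter_mean \<mu> m j)" by (rule iter_mean(1)[OF \<mu> m j])
  ultimately show ?thesis
    unfolding amenable_group_def invariant_mean_iff using W.is_group
    by (intro conjI exI[of _ "iter_mean \<mu> m j"]) blast+
qed

section \<open>Coordinates and conjugation in wreath products\<close>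

lemma wreath_mult:
  "(a, g) \<otimes>\<^bsub>wreath A G\<^esub> (b, h) = (a \<otimes>\<^bsub>sum_group (carrier G) (\<lambda>_. A)\<^esub> shift G g b, g \<otimes>\<^bsub>G\<^esub> h)"
  by (simp add: wreath_def wreath_over_def)

lemma wreath_mem:
  "(a, g) \<in> carrier (wreath A G) \<longleftrightarrow> a \<in> carrier (sum_group (carrier G) (\<lambda>_. A)) \<and> g \<in> carrier G"
  by (simp add: wreath_def wreath_over_def)

lemma wreath_over_mem:
  "(a, g) \<in> carrier (wreath_over A G H) \<longleftrightarrow> a \<in> carrier (sum_group (carrier G) (\<lambda>_. A)) \<and> g \<in> H"
  by (simp add: wreath_over_def)

lemma snd_wreath_mult: "snd (v \<otimes>\<^bsub>wreath A G\<^esub> w) = snd v \<otimes>\<^bsub>G\<^esub> snd w"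
  by (cases v; cases w) (simp add: wreath_mult)

lemma snd_wreath_inv:
  assumes "group A" "group G" "w \<in> carrier (wreath A G)"
  shows "snd (inv\<^bsub>wreath A G\<^esub> w) = inv\<^bsub>G\<^esub> (snd w)"
proof -
  interpret G: group G by fact
  interpret W: group "wreath A G" by (rule group_wreath[OF assms(1,2)])
  have c: "snd v \<in> carrier G" if "v \<in> carrier (wreath A G)" for v
    using that by (cases v) (simp add: wreath_mem)
  have "snd (inv\<^bsub>wreath A G\<^esub> w) \<otimes>\<^bsub>G\<^esub> snd w = \<one>\<^bsub>G\<^esub>"
    using arg_cong[OF W.l_inv[OF assms(3)], of snd]
    by (simp add: snd_wreath_mult) (simp add: wreath_def wreath_over_def)
  then show ?thesis using c assms(3) by (metis G.inv_equality W.inv_closed)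
qed

text \<open>A finite orbit would have a finite joint support U in G. If the component of x in G is
  not 1, conjugation by an element supported at a point outside U creates a nontrivial value there.
  If it is 1, conjugation by T carries a support point of x to infinitely many points.\<close>

lemma infinite_conjugates_wreath:
  fixes A :: "('a, 'l) monoid_scheme" and G :: "('g, 'm) monoid_scheme"
  assumes A: "group A" and G: "group G" and z: "z \<in> carrier A" "z \<noteq> \<one>\<^bsub>A\<^esub>"
    and T: "infinite T" "T \<subseteq> carrier G"
    and D: "D \<subseteq> carrier (wreath A G)"
      "\<And>e. e \<in> carrier (sum_group (carrier G) (\<lambda>_. A)) \<Longrightarrow> (e, \<one>\<^bsub>G\<^esub>) \<in> D"
      "\<And>t. t \<in> T \<Longrightarrow> (\<one>\<^bsub>sum_group (carrier G) (\<lambda>_. A)\<^esub>, t) \<in> D"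
    and x: "x \<in> carrier (wreath A G)" "x \<noteq> \<one>\<^bsub>wreath A G\<^esub>"
  shows "infinite {d \<otimes>\<^bsub>wreath A G\<^esub> x \<otimes>\<^bsub>wreath A G\<^esub> inv\<^bsub>wreath A G\<^esub> d | d. d \<in> D}" (is "infinite ?O")
proof
  note [simp del] = mult_sum_group one_sum_group
  let ?S = "sum_group (carrier G) (\<lambda>_. A)" and ?W = "wreath A G"
  interpret A: group A by fact
  interpret G: group G by fact
  interpret S: group ?S by (simp add: A)
  interpret W: group ?W by (rule group_wreath[OF A G])
  note memD = sum_group_memD[OF A]
  let ?U = "\<Union>y\<in>?O. {p \<in> carrier G. fst y p \<noteq> \<one>\<^bsub>A\<^esub>}"
  assume fin: "finite ?O"
  have OW: "?O \<subseteq> carrier ?W" using D(1) x(1) by auto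
  have U: "finite ?U"
  proof (rule finite_UN_I[OF fin])
    fix y assume "y \<in> ?O"
    then have "y \<in> carrier ?W" by (rule subsetD[OF OW])
    then have "fst y \<in> carrier ?S" by (cases y) (simp add: wreath_mem)
    then show "finite {p \<in> carrier G. fst y p \<noteq> \<one>\<^bsub>A\<^esub>}" by (rule memD(3))
  qed
  \<comment> \<open>The conjugate is characterised by (c, k') d = d x, so that coordinates can be
    compared without computing inverses in the wreath product.\<close>
  have conj: "\<exists>c k'. (c, k') \<in> ?O \<and> c \<in> carrier ?S \<and> k' \<in> carrier G \<and> (c, k') \<otimes>\<^bsub>?W\<^esub> d = d \<otimes>\<^bsub>?W\<^esub> x"
    if d: "d \<in> D" for d
  proof -
    let ?y = "d \<otimes>\<^bsub>?W\<^esub> x \<otimes>\<^bsub>?W\<^esub> inv\<^bsub>?W\<^esub> d"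
    have dW: "d \<in> carrier ?W" using d D by auto
    have yO: "?y \<in> ?O" using d by blast
    obtain c k' where y: "?y = (c, k')" by (cases ?y)
    have "(c, k') \<in> ?O" using yO unfolding y .
    moreover from this have "(c, k') \<in> carrier ?W" by (rule subsetD[OF OW])
    then have "c \<in> carrier ?S" "k' \<in> carrier G" by (simp_all add: wreath_mem)
    moreover have "(c, k') \<otimes>\<^bsub>?W\<^esub> d = d \<otimes>\<^bsub>?W\<^esub> x"
      unfolding y[symmetric] using dW x(1) by (simp add: W.m_assoc)
    ultimately show ?thesis by blast
  qed
  obtain b k where bk: "x = (b, k)" "b \<in> carrier ?S" "k \<in> carrier G"
    using x(1) by (cases x) (auto simp: wreath_mem)
  show False
  proof (cases "k = \<one>\<^bsub>G\<^esub>")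
    case False
    have "infinite (carrier G)" using T infinite_super by blast
    then have "infinite (carrier G - (?U \<union> {p \<in> carrier G. b p \<noteq> \<one>\<^bsub>A\<^esub>}))"
      using U memD(3)[OF bk(2)] by (intro Diff_infinite_finite finite_UnI)
    from infinite_imp_nonempty[OF this]
    obtain p where p: "p \<in> carrier G" "p \<notin> ?U" "b p = \<one>\<^bsub>A\<^esub>" by blast
    define e where "e = (\<lambda>i\<in>carrier G. if i = p then z else \<one>\<^bsub>A\<^esub>)"
    have e: "e \<in> carrier ?S"
    proof (rule sum_group_memI[OF A])
      show "finite {i \<in> carrier G. e i \<noteq> \<one>\<^bsub>A\<^esub>}" by (rule finite_subset[of _ "{p}"]) (auto simp: e_def)
    qed (use z in \<open>auto simp: e_def\<close>)
    from conj[OF D(2)[OF e]] obtain c k' where c: "(c, k') \<in> ?O" "c \<in> carrier ?S" "k' \<in> carrier G"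
      and eq: "(c, k') \<otimes>\<^bsub>?W\<^esub> (e, \<one>\<^bsub>G\<^esub>) = (e, \<one>\<^bsub>G\<^esub>) \<otimes>\<^bsub>?W\<^esub> x" by blast
    have k': "k' = k" and "c \<otimes>\<^bsub>?S\<^esub> shift G k e = e \<otimes>\<^bsub>?S\<^esub> b"
      using eq bk c by (auto simp: wreath_mult shift_one[OF G A])
    then have "(c \<otimes>\<^bsub>?S\<^esub> shift G k e) p = (e \<otimes>\<^bsub>?S\<^esub> b) p" by simp
    \<comment> \<open>As k is not 1, the shifted e is trivial at p, so the value z on the other side
      can only come from c.\<close>
    moreover have "inv\<^bsub>G\<^esub> k \<otimes>\<^bsub>G\<^esub> p \<noteq> p"
      using False bk(3) p(1) by (metis G.inv_closed G.inv_eq_1_iff G.r_cancel_one')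
    ultimately have "c p = z"
      using p z bk c memD(1)[OF c(2) p(1)] by (simp add: mult_sum_group shift_def e_def)
    then have "p \<in> ?U" using p(1) z by (intro UN_I[OF c(1)]) simp
    then show False using p by blast
  next
    case True
    have "b \<noteq> \<one>\<^bsub>?S\<^esub>" using x(2) bk True by (auto simp: wreath_def wreath_over_def)
    moreover have "b = \<one>\<^bsub>?S\<^esub>" if "\<forall>p\<in>carrier G. b p = \<one>\<^bsub>A\<^esub>"
    proof
      fix p show "b p = \<one>\<^bsub>?S\<^esub> p"
        using memD(2)[OF bk(2), of p] that by (cases "p \<in> carrier G") (simp_all add: one_sum_group)
    qed
    ultimately obtain p where p: "p \<in> carrier G" "b p \<noteq> \<one>\<^bsub>A\<^esub>" by blast
    have "(\<lambda>t. t \<otimes>\<^bsub>G\<^esub> p) ` T \<subseteq> ?U"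
    proof
      fix q assume "q \<in> (\<lambda>t. t \<otimes>\<^bsub>G\<^esub> p) ` T"
      then obtain t where t: "t \<in> T" "t \<in> carrier G" "q = t \<otimes>\<^bsub>G\<^esub> p" using T by auto
      from conj[OF D(3)[OF t(1)]] obtain c k' where c: "(c, k') \<in> ?O" "c \<in> carrier ?S" "k' \<in> carrier G"
        and eq: "(c, k') \<otimes>\<^bsub>?W\<^esub> (\<one>\<^bsub>?S\<^esub>, t) = (\<one>\<^bsub>?S\<^esub>, t) \<otimes>\<^bsub>?W\<^esub> x" by blast
      have "shift G k' \<one>\<^bsub>?S\<^esub> = \<one>\<^bsub>?S\<^esub>"
        using c(3) by (auto simp: shift_def one_sum_group fun_eq_iff)
      then have "c = shift G t b"
        using eq bk c t shift_closed[OF A G t(2) bk(2)] by (simp add: wreath_mult)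
      then have "c q \<noteq> \<one>\<^bsub>A\<^esub>" using t p by (simp add: shift_def G.m_assoc[symmetric])
      moreover have "q \<in> carrier G" using t p(1) by simp
      ultimately show "q \<in> ?U" using c(1) by (intro UN_I[OF c(1)]) simp
    qed
    then have "finite ((\<lambda>t. t \<otimes>\<^bsub>G\<^esub> p) ` T)" using U by (rule finite_subset)
    moreover have "inj_on (\<lambda>t. t \<otimes>\<^bsub>G\<^esub> p) T"
    proof (rule inj_onI)
      fix s t assume "s \<in> T" "t \<in> T" "s \<otimes>\<^bsub>G\<^esub> p = t \<otimes>\<^bsub>G\<^esub> p"
      then show "s = t" using T(2) p(1) G.right_cancel[of p s t] by blast
    qed
    ultimately have "finite T" by (rule finite_imageD)
    then show False using T(1) by simp
  qed
qed

text \<open>The direct sum is normal and lies in the smaller group, so double cosets and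
  intersections of conjugates are decided by the component in G; the hypotheses on H thus lift to
  the wreath product.\<close>

theorem amenable_maximal_wreath:
  fixes A :: "('a, 'l) monoid_scheme" and G :: "('g, 'm) monoid_scheme"
  assumes A: "amenable_group A" and z: "z \<in> carrier A" "z \<noteq> \<one>\<^bsub>A\<^esub>"
    and G: "group G" and H: "subgroup H G" "H \<noteq> carrier G"
    and \<mu>: "mean_on H \<mu>" "\<And>k f. k \<in> H \<Longrightarrow> bounded (f ` H) \<Longrightarrow> \<mu> (\<lambda>x. f (k \<otimes>\<^bsub>G\<^esub> x)) = \<mu> f"
    and double_coset: "\<And>g x. g \<in> carrier G - H \<Longrightarrow> x \<in> carrier G - H \<Longrightarrow>
      \<exists>s\<in>H. \<exists>t\<in>H. x = s \<otimes>\<^bsub>G\<^esub> g \<otimes>\<^bsub>G\<^esub> t"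
    and infinite: "\<And>g. g \<in> carrier G - H \<Longrightarrow> infinite {h \<in> H. inv\<^bsub>G\<^esub> g \<otimes>\<^bsub>G\<^esub> h \<otimes>\<^bsub>G\<^esub> g \<in> H}"
  defines "X \<equiv> carrier (wreath A G)" and "M \<equiv> group_vN (wreath A G)"
    and "N \<equiv> subgroup_vN (wreath A G) (carrier (wreath_over A G H))"
  shows "factor X M \<and> factor X N \<and> N \<subseteq> M \<and> amenable_vN_algebra X N \<and> maximal_vN_subalgebra X N M"
proof -
  note [simp del] = mult_sum_group one_sum_group
  have gA: "group A" using A by (simp add: amenable_group_def)
  let ?S = "sum_group (carrier G) (\<lambda>_. A)" and ?W = "wreath A G" and ?K = "carrier (wreath_over A G H)"
  interpret G: group G by fact
  interpret H: subgroup H G by fact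
  interpret S: group ?S by (simp add: gA)
  interpret W: group ?W by (rule group_wreath[OF gA G])
  have K: "subgroup ?K ?W" by (rule subgroup_wreath_over[OF gA G H(1)])
  have notK: "snd w \<in> carrier G - H" if "w \<in> carrier ?W - ?K" for w
    using that by (cases w) (auto simp: wreath_mem wreath_over_mem)
  have orbits: "infinite {d \<otimes>\<^bsub>?W\<^esub> x \<otimes>\<^bsub>?W\<^esub> inv\<^bsub>?W\<^esub> d | d. d \<in> ?K \<and> inv\<^bsub>?W\<^esub> w \<otimes>\<^bsub>?W\<^esub> d \<otimes>\<^bsub>?W\<^esub> w \<in> ?K}"
    if w: "w \<in> carrier ?W - ?K" and x: "x \<in> carrier ?W" "x \<noteq> \<one>\<^bsub>?W\<^esub>" for w x
  proof -
    let ?g = "snd w"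
    define T where "T = {h \<in> H. inv\<^bsub>G\<^esub> ?g \<otimes>\<^bsub>G\<^esub> h \<otimes>\<^bsub>G\<^esub> ?g \<in> H}"
    have g: "?g \<in> carrier G" using notK[OF w] by blast
    have mem: "(e, h) \<in> {d. d \<in> ?K \<and> inv\<^bsub>?W\<^esub> w \<otimes>\<^bsub>?W\<^esub> d \<otimes>\<^bsub>?W\<^esub> w \<in> ?K}"
      if "e \<in> carrier ?S" "h \<in> T" for e h
    proof -
      have eh: "(e, h) \<in> ?K" using that by (simp add: T_def wreath_over_mem)
      then have "(e, h) \<in> carrier ?W" using subgroup.subset[OF K] by blast
      then have 1: "inv\<^bsub>?W\<^esub> w \<otimes>\<^bsub>?W\<^esub> (e, h) \<otimes>\<^bsub>?W\<^esub> w \<in> carrier ?W" using w by auto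
      have "snd (inv\<^bsub>?W\<^esub> w \<otimes>\<^bsub>?W\<^esub> (e, h) \<otimes>\<^bsub>?W\<^esub> w) \<in> H"
        using that w by (simp add: snd_wreath_mult snd_wreath_inv[OF gA G] T_def)
      with 1 have "inv\<^bsub>?W\<^esub> w \<otimes>\<^bsub>?W\<^esub> (e, h) \<otimes>\<^bsub>?W\<^esub> w \<in> ?K"
        by (metis prod.collapse wreath_mem wreath_over_mem)
      with eh show ?thesis by blast
    qed
    have one: "\<one>\<^bsub>G\<^esub> \<in> T" using g by (simp add: T_def)
    have "infinite {d \<otimes>\<^bsub>?W\<^esub> x \<otimes>\<^bsub>?W\<^esub> inv\<^bsub>?W\<^esub> d | d. d \<in> {d. d \<in> ?K \<and> inv\<^bsub>?W\<^esub> w \<otimes>\<^bsub>?W\<^esub> d \<otimes>\<^bsub>?W\<^esub> w \<in> ?K}}"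
    proof (rule infinite_conjugates_wreath[OF gA G z, where T = T])
      show "infinite T" unfolding T_def by (rule infinite[OF notK[OF w]])
      show "{d. d \<in> ?K \<and> inv\<^bsub>?W\<^esub> w \<otimes>\<^bsub>?W\<^esub> d \<otimes>\<^bsub>?W\<^esub> w \<in> ?K} \<subseteq> carrier ?W"
        using subgroup.subset[OF K] by blast
    qed (use mem one S.one_closed x in \<open>auto simp: T_def\<close>)
    then show ?thesis by simp
  qed
  obtain g where g: "g \<in> carrier G - H" using H H.subset by blast
  then have w: "(\<one>\<^bsub>?S\<^esub>, g) \<in> carrier ?W - ?K"
    by (auto simp: wreath_mem wreath_over_mem)
  \<comment> \<open>Orbits under the intersection for a single w outside \<open>?K\<close> are
    already infinite, and enlarging the conjugating set keeps them so; this serves both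
    factors.\<close>
  have icc: "infinite {d \<otimes>\<^bsub>?W\<^esub> x \<otimes>\<^bsub>?W\<^esub> inv\<^bsub>?W\<^esub> d | d. d \<in> L}"
    if x: "x \<in> carrier ?W" "x \<noteq> \<one>\<^bsub>?W\<^esub>" and L: "?K \<subseteq> L" for x L
    by (rule infinite_super[OF _ orbits[OF w x]]) (use L in blast)
  have M: "factor X M"
    unfolding X_def M_def group_vN_def
    by (rule W.factor_subgroup_vN[OF W.subgroup_self icc]) (use subgroup.subset[OF K] in auto)
  have N: "factor X N"
    unfolding X_def N_def by (rule W.factor_subgroup_vN[OF K icc]) auto
  have max: "maximal_vN_subalgebra X N M"
    unfolding X_def N_def M_def
  proof (rule W.maximal_subgroup_vN[OF K _ orbits])
    fix v x assume v: "v \<in> carrier ?W - ?K" and x: "x \<in> carrier ?W - ?K"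
    obtain a g where ag: "v = (a, g)" "a \<in> carrier ?S" "g \<in> carrier G" using v by (cases v) (auto simp: wreath_mem)
    obtain b y where b_y: "x = (b, y)" "b \<in> carrier ?S" "y \<in> carrier G" using x by (cases x) (auto simp: wreath_mem)
    obtain s t where st: "s \<in> H" "t \<in> H" "y = s \<otimes>\<^bsub>G\<^esub> g \<otimes>\<^bsub>G\<^esub> t"
      using double_coset[OF notK[OF v] notK[OF x]] ag b_y by auto
    \<comment> \<open>Chosen to solve the first coordinate: multiplication by s shifts a, and
      \<open>?c\<close> replaces the result by b.\<close>
    let ?c = "b \<otimes>\<^bsub>?S\<^esub> inv\<^bsub>?S\<^esub> (shift G s a)"
    have sa: "shift G s a \<in> carrier ?S" using st by (intro shift_closed[OF gA G _ ag(2)]) auto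
    have one: "shift G h \<one>\<^bsub>?S\<^esub> = \<one>\<^bsub>?S\<^esub>" if "h \<in> carrier G" for h
      using that by (auto simp: shift_def one_sum_group fun_eq_iff)
    have "x = (?c, s) \<otimes>\<^bsub>?W\<^esub> v \<otimes>\<^bsub>?W\<^esub> (\<one>\<^bsub>?S\<^esub>, t)"
      using ag b_y st sa by (simp add: wreath_mult one S.m_assoc S.l_inv del: inv_sum_group)
    moreover have "(?c, s) \<in> ?K" "(\<one>\<^bsub>?S\<^esub>, t) \<in> ?K"
      using st b_y sa by (auto simp: wreath_over_mem simp del: inv_sum_group)
    ultimately show "\<exists>s\<in>?K. \<exists>t\<in>?K. x = s \<otimes>\<^bsub>?W\<^esub> v \<otimes>\<^bsub>?W\<^esub> t" by blast
  qed
  then have NM: "N \<subseteq> M" by (simp add: maximal_vN_subalgebra_def)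
  have "amenable_group (wreath_over A G H)" by (rule amenable_wreath_over[OF A G H(1) \<mu>])
  then obtain m where m: "mean_on ?K m"
    and minv: "\<And>k f. k \<in> ?K \<Longrightarrow> bounded (f ` ?K) \<Longrightarrow> m (\<lambda>x. f (k \<otimes>\<^bsub>wreath_over A G H\<^esub> x)) = m f"
    unfolding amenable_group_def invariant_mean_iff by blast
  have eq: "(\<otimes>\<^bsub>wreath_over A G H\<^esub>) = (\<otimes>\<^bsub>?W\<^esub>)" by (simp add: wreath_def wreath_over_def)
  interpret subgroup_mean ?W ?K m
    by (intro subgroup_mean.intro subgroup_mean_axioms.intro W.is_group K m) (rule minv[unfolded eq])
  have "amenable_vN_algebra X N"
    unfolding X_def N_def by (rule amenable_subgroup_vN)
  with M N NM max show ?thesis by blast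
qed

section \<open>The special linear group of degree two over the rationals\<close>

definition mat2 :: "rat \<Rightarrow> rat \<Rightarrow> rat \<Rightarrow> rat \<Rightarrow> rat ^ 2 ^ 2" where
  "mat2 a b c d = vector [vector [a, b], vector [c, d]]"

lemma mat2_nth [simp]:
  "mat2 a b c d $ 1 $ 1 = a" "mat2 a b c d $ 1 $ 2 = b"
  "mat2 a b c d $ 2 $ 1 = c" "mat2 a b c d $ 2 $ 2 = d"
  by (simp_all add: mat2_def)

lemma mat2_eta: "g = mat2 (g $ 1 $ 1) (g $ 1 $ 2) (g $ 2 $ 1) (g $ 2 $ 2)"
  by (simp add: vec_eq_iff forall_2)

lemma mat2_eq_iff: "mat2 a b c d = mat2 a' b' c' d' \<longleftrightarrow> a = a' \<and> b = b' \<and> c = c' \<and> d = d'"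
  by (metis mat2_nth)

lemma SL2Q_mem: "mat2 a b c d \<in> carrier SL2Q \<longleftrightarrow> a * d - b * c = 1"
  by (simp add: special_linear_def det_2)

lemma upper_triangular_mem: "mat2 a b c d \<in> upper_triangular_SL2Q \<longleftrightarrow> c = 0 \<and> a * d = 1"
  by (auto simp: upper_triangular_SL2Q_def SL2Q_mem)

lemma SL2Q_mult:
  "mat2 a b c d \<otimes>\<^bsub>SL2Q\<^esub> mat2 a' b' c' d' = mat2 (a * a' + b * c') (a * b' + b * d') (c * a' + d * c') (c * b' + d * d')"
  by (simp add: special_linear_def vec_eq_iff forall_2 matrix_matrix_mult_def sum_2)

lemma SL2Q_double_coset:
  assumes g: "g \<in> carrier SL2Q - upper_triangular_SL2Q" and x: "x \<in> carrier SL2Q - upper_triangular_SL2Q"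
  shows "\<exists>s\<in>upper_triangular_SL2Q. \<exists>t\<in>upper_triangular_SL2Q. x = s \<otimes>\<^bsub>SL2Q\<^esub> g \<otimes>\<^bsub>SL2Q\<^esub> t"
proof -
  obtain a b c d where g': "g = mat2 a b c d" using mat2_eta by blast
  obtain a' b' c' d' where x': "x = mat2 a' b' c' d'" using mat2_eta by blast
  have c: "c \<noteq> 0" "c' \<noteq> 0" and b: "b = (a * d - 1) / c" "b' = (a' * d' - 1) / c'"
    using g x by (auto simp: g' x' upper_triangular_SL2Q_def SL2Q_mem field_simps)
  show ?thesis
  proof (intro bexI)
    \<comment> \<open>The right factor changes the ratio of the lower entries from d / c to d' / c'.
      The diagonal of the left factor rescales the lower row, and its corner entry corrects a; the
      determinant then forces b'.\<close>
    show "x = mat2 (c / c') (a' / c - a / c') 0 (c' / c) \<otimes>\<^bsub>SL2Q\<^esub> g \<otimes>\<^bsub>SL2Q\<^esub> mat2 1 (d' / c' - d / c) 0 1"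
      using c by (simp add: g' x' SL2Q_mult mat2_eq_iff b field_simps)
  qed (use c in \<open>simp_all add: upper_triangular_mem\<close>)
qed

text \<open>Upper triangular matrices fix the point at infinity of the projective line, and their
  conjugates by g fix a / c. The matrices fixing both points form a torus with eigenvalues t and 1 /
  t.\<close>

lemma SL2Q_infinite_intersection:
  assumes g: "g \<in> carrier SL2Q - upper_triangular_SL2Q"
  shows "infinite {h \<in> upper_triangular_SL2Q. inv\<^bsub>SL2Q\<^esub> g \<otimes>\<^bsub>SL2Q\<^esub> h \<otimes>\<^bsub>SL2Q\<^esub> g \<in> upper_triangular_SL2Q}"
    (is "infinite ?T")
proof -
  interpret group SL2Q by (rule group_special_linear)
  obtain a b c d where g': "g = mat2 a b c d" using mat2_eta by blast
  have c: "c \<noteq> 0" and b: "b = (a * d - 1) / c" and gc: "g \<in> carrier SL2Q"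
    using g by (auto simp: g' upper_triangular_SL2Q_def SL2Q_mem field_simps)
  \<comment> \<open>The corner entry makes (a, c) an eigenvector with eigenvalue 1 / t; t runs
    through the positive integers.\<close>
  define h where "h n = (let t = of_nat (Suc n) in mat2 t (a / c * (1 / t - t)) 0 (1 / t))" for n
  have "h n \<in> ?T" for n
  proof -
    define t :: rat where "t = of_nat (Suc n)"
    have t: "t \<noteq> 0" by (simp add: t_def del: of_nat_Suc)
    have hn: "h n = mat2 t (a / c * (1 / t - t)) 0 (1 / t)" by (simp add: h_def t_def Let_def)
    let ?k = "mat2 (1 / t) (d / c * (1 / t - t)) 0 t"
    have h: "h n \<in> upper_triangular_SL2Q" and k: "?k \<in> upper_triangular_SL2Q"
      using t by (simp_all add: hn upper_triangular_mem)
    then have hk: "h n \<in> carrier SL2Q" "?k \<in> carrier SL2Q" by (auto simp: upper_triangular_SL2Q_def)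
    have "h n \<otimes>\<^bsub>SL2Q\<^esub> g = g \<otimes>\<^bsub>SL2Q\<^esub> ?k"
      using t c by (simp add: hn g' SL2Q_mult mat2_eq_iff b field_simps)
    then have "inv\<^bsub>SL2Q\<^esub> g \<otimes>\<^bsub>SL2Q\<^esub> h n \<otimes>\<^bsub>SL2Q\<^esub> g = ?k"
      using gc hk by (simp add: m_assoc inv_cancel_left)
    then show ?thesis using h k by simp
  qed
  moreover have "inj h"
  proof (rule injI)
    fix n n' assume "h n = h n'"
    then have "h n $ 1 $ 1 = h n' $ 1 $ 1" by simp
    then show "n = n'" by (simp add: h_def Let_def)
  qed
  ultimately show ?thesis
    by (metis (no_types, lifting) finite_subset image_subsetI infinite_UNIV_nat finite_imageD)
qed

text \<open>The group is an extension of the multiplicative group of nonzero rationals by the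
  additive group of rationals, so two means on commutative groups are iterated.\<close>

lemma upper_triangular_SL2Q_mean:
  obtains \<mu> where "mean_on upper_triangular_SL2Q \<mu>"
    and "\<And>k f. k \<in> upper_triangular_SL2Q \<Longrightarrow> bounded (f ` upper_triangular_SL2Q) \<Longrightarrow>
      \<mu> (\<lambda>x. f (k \<otimes>\<^bsub>SL2Q\<^esub> x)) = \<mu> f"
proof -
  let ?H = upper_triangular_SL2Q
  interpret group SL2Q by (rule group_special_linear)
  interpret H: subgroup ?H SL2Q by (rule subgroup_upper_triangular)
  define add :: "rat monoid" where "add = \<lparr>carrier = UNIV, monoid.mult = (+), one = 0\<rparr>"
  define mul :: "rat monoid" where "mul = \<lparr>carrier = - {0}, monoid.mult = (*), one = 1\<rparr>"
  have "comm_group add"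
    by (rule comm_groupI) (auto simp: add_def intro: exI[of _ "- _"])
  then obtain mN :: "(rat \<Rightarrow> real) \<Rightarrow> real" where mN: "mean_on UNIV mN" "\<And>g f. bounded (range f) \<Longrightarrow> mN (\<lambda>x. f (g + x)) = mN f"
    using comm_group_amenable[of add] unfolding amenable_group_def invariant_mean_iff
    by (auto simp: add_def)
  have "comm_group mul"
  proof (rule comm_groupI)
    fix x assume "x \<in> carrier mul"
    then show "\<exists>y\<in>carrier mul. y \<otimes>\<^bsub>mul\<^esub> x = \<one>\<^bsub>mul\<^esub>"
      by (intro bexI[of _ "inverse x"]) (auto simp: mul_def)
  qed (auto simp: mul_def)
  then obtain mQ :: "(rat \<Rightarrow> real) \<Rightarrow> real" where mQ: "mean_on (- {0}) mQ"
    "\<And>g f. g \<noteq> 0 \<Longrightarrow> bounded (f ` (- {0})) \<Longrightarrow> mQ (\<lambda>x. f (g * x)) = mQ f"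
    using comm_group_amenable[of mul] unfolding amenable_group_def invariant_mean_iff
    by (auto simp: mul_def)
  \<comment> \<open>The diagonal matrix with entries q and 1 / q times the unipotent matrix with
    corner n.\<close>
  define j where "j q n = mat2 q (q * n) 0 (1 / q)" for q n
  have j: "j q n \<in> ?H" if "q \<in> - {0}" for q n using that by (simp add: j_def upper_triangular_mem)
  show thesis
  proof (rule that)
    show "mean_on ?H (iter_mean mQ mN j)" by (rule iter_mean(1)[OF mQ(1) mN(1) j])
    fix k and f :: "rat ^ 2 ^ 2 \<Rightarrow> real" assume k: "k \<in> ?H" and f: "bounded (f ` ?H)"
    obtain a b c d where k': "k = mat2 a b c d" using mat2_eta by blast
    then have a: "c = 0" "a \<noteq> 0" "d = 1 / a" using k by (auto simp: upper_triangular_mem eq_divide_eq mult.commute)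
    show "iter_mean mQ mN j (\<lambda>x. f (k \<otimes>\<^bsub>SL2Q\<^esub> x)) = iter_mean mQ mN j f"
    \<comment> \<open>The corner of the product is a q n + b / q; dividing by a q shows that n is
      shifted by b / (a q q).\<close>
    proof (rule iter_mean(2)[OF mQ(1) mN(1) j, where p = "\<lambda>q. a * q" and t = "\<lambda>q n. b / (a * q * q) + n"])
      show "k \<otimes>\<^bsub>SL2Q\<^esub> j q n = j (a * q) (b / (a * q * q) + n)" if "q \<in> - {0}" for q n
        using that a by (simp add: k' j_def SL2Q_mult mat2_eq_iff field_simps)
      show "k \<otimes>\<^bsub>SL2Q\<^esub> y \<in> ?H" if "y \<in> ?H" for y using k that by (rule H.m_closed)
    qed (use a f mQ(2) mN(2) in auto)
  qed
qed

theorem amenable_maximal_wreath_SL2Q: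
  fixes A :: "('a, 'l) monoid_scheme"
  assumes "amenable_group A" "z \<in> carrier A" "z \<noteq> \<one>\<^bsub>A\<^esub>"
  shows "let X = carrier (wreath A SL2Q);
          M = group_vN (wreath A SL2Q);
          N = subgroup_vN (wreath A SL2Q) (carrier (wreath_over A SL2Q upper_triangular_SL2Q))
      in factor X M \<and> factor X N \<and> N \<subseteq> M \<and>
         amenable_vN_algebra X N \<and> maximal_vN_subalgebra X N M"
proof -
  obtain \<mu> where \<mu>: "mean_on upper_triangular_SL2Q \<mu>"
    "\<And>k f. k \<in> upper_triangular_SL2Q \<Longrightarrow> bounded (f ` upper_triangular_SL2Q) \<Longrightarrow>
      \<mu> (\<lambda>x. f (k \<otimes>\<^bsub>SL2Q\<^esub> x)) = \<mu> f"
    using upper_triangular_SL2Q_mean by blast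
  have "mat2 0 (-1) 1 0 \<in> carrier SL2Q - upper_triangular_SL2Q"
    by (simp add: SL2Q_mem upper_triangular_mem)
  then have ne: "upper_triangular_SL2Q \<noteq> carrier SL2Q" by blast
  show ?thesis
    unfolding Let_def
    by (rule amenable_maximal_wreath[OF assms group_special_linear subgroup_upper_triangular ne \<mu>
          SL2Q_double_coset SL2Q_infinite_intersection])
qed

theorem proposition3p18:
  fixes \<Lambda> :: "('a, 'b) monoid_scheme"
  assumes "group \<Lambda>" and "countable (carrier \<Lambda>)"
    and "amenable_group \<Lambda>" and "ICC \<Lambda>"
  shows
    "(let X = carrier (wreath \<Lambda> SL2Q);
          M = group_vN (wreath \<Lambda> SL2Q);
          N = subgroup_vN (wreath \<Lambda> SL2Q) (carrier (wreath_over \<Lambda> SL2Q upper_triangular_SL2Q))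
      in factor X M \<and> factor X N \<and> N \<subseteq> M \<and>
         amenable_vN_algebra X N \<and> maximal_vN_subalgebra X N M) \<and>
     (let X = carrier (wreath integer_group SL2Q);
          M = group_vN (wreath integer_group SL2Q);
          N = subgroup_vN (wreath integer_group SL2Q)
                (carrier (wreath_over integer_group SL2Q upper_triangular_SL2Q))
      in factor X M \<and> factor X N \<and> N \<subseteq> M \<and>
         amenable_vN_algebra X N \<and> maximal_vN_subalgebra X N M)"
proof -
  have "carrier \<Lambda> \<noteq> {\<one>\<^bsub>\<Lambda>\<^esub>}" using assms(4) by (auto simp: ICC_def)
  then obtain z where z: "z \<in> carrier \<Lambda>" "z \<noteq> \<one>\<^bsub>\<Lambda>\<^esub>"
    using group.is_monoid[OF assms(1)] monoid.one_closed by blast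
  have "1 \<in> carrier integer_group" "1 \<noteq> \<one>\<^bsub>integer_group\<^esub>" by simp_all
  then show ?thesis
    by (intro conjI amenable_maximal_wreath_SL2Q[OF assms(3) z]
        amenable_maximal_wreath_SL2Q[OF comm_group_amenable[OF abelian_integer_group]])
qed

end
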